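(* Let $M$ be a hyperbolic once-punctured torus bundle with monodromy $\phi\in\mathrm{SL}(2,\mathbb{Z})$ and fundamental group $\Gamma=\langle a,b,x\mid \phi(a)=xax^{-1},\ \phi(b)=xbx^{-1}\rangle$, and let $F_2=\langle a,b\rangle$ be the fiber group. Let $\mathfrak{g}=\mathfrak{sl}(4,\mathbb{R})$ and let $\mathrm{Ad}\,\rho:\Gamma\to\mathrm{Aut}(\mathfrak{g})$ be the composition of the holonomy representation $\rho:\Gamma\to\mathrm{PSO}(3,1)\subset\mathrm{PGL}(4,\mathbb{R})$ of $M$ with the adjoint representation of $\mathrm{PGL}(4,\mathbb{R})$. Then the characteristic polynomial of (the generator $xF_2$ of) the $\Gamma/F_2$-action on $H^1(F_2;\mathfrak{g})$ induced by the Lyndon–Hochschild–Serre spectral sequence on group cohomology is equal to the twisted Alexander polynomial of the representation $\mathrm{Ad}\,\rho$ with the map $\alpha:\Gamma\to\Gamma/F_2\simeq\langle x\rangle$.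
   Context: A hyperbolic once-punctured torus bundle $M$ is a fiber bundle over $S^1$ with fiber a once-punctured torus $F$ and monodromy $\phi\in \mathrm{SL}(2,\mathbb{Z})$, $|\mathrm{tr}\,\phi|>2$; it carries a unique complete hyperbolic structure. $F_2=\langle a,b\rangle=\pi_1(F)$ is a free normal subgroup of rank 2 of $\Gamma=\pi_1(M)$; $\phi$ also denotes the automorphism of $F_2$ representing the monodromy, and $x$ is a meridian of the boundary torus. $\mathrm{PSO}(3,1)$ is the projectivization of the identity component $\mathrm{SO}^0(3,1)$ of the isometry group of the form $x_1y_1+x_2y_2+x_3y_3-x_4y_4$ on $\mathbb{R}^4$. The holonomy $\rho$ is the discrete faithful representation $\Gamma\to\mathrm{PSO}(3,1)$ of the complete hyperbolic structure. $\Gamma$ acts on $\mathfrak{g}=\mathfrak{sl}(4,\mathbb{R})$ by $gX=\rho(g)X\rho(g)^{-1}$. $\Gamma/F_2$-action: for a 1-cocycle $f:F_2\to\mathfrak{g}$ (a map with $f(gh)=f(g)+gf(h)$), $x$ acts by $(xf)(g)=x f(x^{-1}gx)$; this induces an action of $\Gamma/F_2=\langle xF_2\rangle\cong\mathbb{Z}$ on $H^1(F_2;\mathfrak{g})$, the one occurring in the spectral sequence $H^p(\Gamma/F_2;H^q(F_2;\mathfrak{g}))\Rightarrow H^{p+q}(\Gamma;\mathfrak{g})$. Twisted Alexander polynomial: let $\Gamma=\langle a_1,\dots,a_n\mid r_1,\dots,r_{n-1}\rangle$ be a deficiency-one presentation, $\sigma:\Gamma\to\mathrm{GL}(l,K)$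 a representation over a field $K$, and $\alpha:\Gamma\to\langle t\rangle\cong\mathbb{Z}$ a surjective homomorphism. Let $\Phi:\mathbb{Z}F_n\to \mathrm{M}(l,K[t,t^{-1}])$ be the ring homomorphism obtained from $\mathbb{Z}F_n\to\mathbb{Z}\Gamma$ followed by $\sigma\otimes\alpha$ (so $g\mapsto \alpha(g)\sigma(g)$). The twisted Alexander matrix is the $(n-1)\times n$ block matrix with $(i,j)$ block $\Phi(\partial r_i/\partial a_j)$, where $\partial/\partial a_j:F_n\to\mathbb{Z}F_n$ is the Fox derivative, determined by $\partial(uv)/\partial a_j=\partial u/\partial a_j+u\,\partial v/\partial a_j$ and $\partial a_i/\partial a_j=\delta_{ij}$. Choosing $k$ with $\det\Phi(1-a_k)\neq0$ and letting $\mathcal{A}_{\sigma,\alpha,k}$ be this matrix with its $k$-th block column removed, viewed as an $l(n-1)\times l(n-1)$ matrix, the twisted Alexander polynomial is $\Delta_{\sigma,\alpha}(t)=\det\mathcal{A}_{\sigma,\alpha,k}/\det\Phi(1-a_k)$. It does not depend on $k$ and is well defined only up to multiplication by nonzero elements of $K$ and by powers $t^{ls}$, $s\in\mathbb{Z}$; equality of polynomials is understood up to this indeterminacy. Here it is taken for the given presentation of $\Gamma$, with $\alpha(F_2)=1$ and $\alpha(x)=t$. *)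

theory Defs
  imports
    "HOL-Analysis.Analysis"
    "HOL-Algebra.Elementary_Groups"
    "HOL-Algebra.AbelCoset"
    "HOL-Library.Poly_Mapping"
    "HOL-Computational_Algebra.Polynomial_Factorial"
    "Jordan_Normal_Form.Char_Poly"
    "Jordan_Normal_Form.VS_Connect"
begin

no_notation Matrix.vec_index (infixl \<open>$\<close> 100)

section \<open>Free groups, presentations and Fox derivatives\<close>

text \<open>A letter \<open>(i, True)\<close> is the generator \<open>i\<close>, a letter \<open>(i, False)\<close> its inverse.\<close>

type_synonym 'i letter = "'i \<times> bool"

definition letter_inv :: "'i letter \<Rightarrow> 'i letter" where
  "letter_inv l = (fst l, \<not> snd l)"

fun push :: "'i letter \<Rightarrow> 'i letter list \<Rightarrow> 'i letter list" where
  "push l [] = [l]"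
| "push l (m # w) = (if m = letter_inv l then w else l # m # w)"

definition reduced :: "'i letter list \<Rightarrow> bool" where
  "reduced = successively (\<lambda>l m. m \<noteq> letter_inv l)"

lemma letter_inv_inv [simp]: "letter_inv (letter_inv l) = l"
  by (simp add: letter_inv_def)

lemma reduced_Nil [simp]: "reduced []"
  by (simp add: reduced_def)

lemma reduced_Cons:
  "reduced (l # w) \<longleftrightarrow> w = [] \<or> hd w \<noteq> letter_inv l \<and> reduced w"
  by (auto simp: reduced_def successively_Cons)

lemma reduced_push: "reduced w \<Longrightarrow> reduced (push l w)"
  by (cases w) (auto simp: reduced_Cons)

lemma reduced_foldr_push: "reduced w \<Longrightarrow> reduced (foldr push u w)"
  by (induction u) (auto simp: reduced_push)

lemma push_push_inv: "reduced w \<Longrightarrow> push l (push (letter_inv l) w) = w"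
  by (cases w; cases "tl w") (auto simp: reduced_Cons)

lemma push_reduced: "reduced (l # w) \<Longrightarrow> push l w = l # w"
  by (cases w) (auto simp: reduced_Cons)

lemma foldr_push_Nil: "reduced u \<Longrightarrow> foldr push u [] = u"
proof (induction u)
  case (Cons l u)
  then show ?case by (metis foldr_Cons comp_apply push_reduced reduced_Cons reduced_Nil)
qed simp

lemma foldr_push_push:
  "reduced w \<Longrightarrow> foldr push (push l v) w = push l (foldr push v w)"
  using push_push_inv[OF reduced_foldr_push, of w l] by (cases v) auto

lemma foldr_push_assoc:
  "reduced w \<Longrightarrow> foldr push (foldr push u v) w = foldr push u (foldr push v w)"
  by (induction u) (auto simp: foldr_push_push)

lemma foldr_push_inv:
  "reduced w \<Longrightarrow> foldr push (rev (map letter_inv u)) (foldr push u w) = w"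
proof (induction u)
  case (Cons l u)
  then show ?case
    using push_push_inv[OF reduced_foldr_push, of w "letter_inv l" u] by simp
qed simp

lemma reduced_inv: "reduced u \<Longrightarrow> reduced (rev (map letter_inv u))"
  unfolding reduced_def successively_rev successively_map
  by (erule successively_mono) (auto simp: letter_inv_def prod_eq_iff)

typedef 'i free_group = "{w :: 'i letter list. reduced w}"
  morphisms word Abs_free_group
  by (rule exI[of _ "[]"]) simp

setup_lifting type_definition_free_group

text \<open>The free group is written additively, so that \<open>'i free_group \<Rightarrow>\<^sub>0 int\<close> is its integral
  group ring: the product of finitely supported functions in the library is the convolution
  with respect to \<open>+\<close>.\<close>

instantiation free_group :: (type) group_add
begin

lift_definition zero_free_group :: "'a free_group" is "[]" by simp

lift_definition plus_free_group :: "'a free_group \<Rightarrow> 'a free_group \<Rightarrow> 'a free_group"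
  is "foldr push" by (rule reduced_foldr_push)

lift_definition uminus_free_group :: "'a free_group \<Rightarrow> 'a free_group"
  is "\<lambda>u. rev (map letter_inv u)" by (rule reduced_inv)

definition minus_free_group :: "'a free_group \<Rightarrow> 'a free_group \<Rightarrow> 'a free_group"
  where "minus_free_group u v = u + - v"

instance
proof
  fix a b c :: "'a free_group"
  show "a + b + c = a + (b + c)" by transfer (rule foldr_push_assoc)
  show "0 + a = a" by transfer simp
  show "a + 0 = a" by transfer (rule foldr_push_Nil)
  show "- a + a = 0"
    by transfer (metis foldr_push_Nil foldr_push_inv reduced_Nil)
  show "a + - b = a - b" by (simp add: minus_free_group_def)
qed

end

lift_definition gen :: "'i \<Rightarrow> 'i free_group" is "\<lambda>i. [(i, True)]"
  by (simp add: reduced_Cons)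

definition free_group_monoid :: "'i free_group monoid" ("\<F>") where
  "\<F> = \<lparr>carrier = UNIV, mult = (+), one = 0\<rparr>"

text \<open>The homomorphism from the free group to \<open>G\<close> that sends \<open>gen i\<close> to \<open>v i\<close>.\<close>

definition free_eval :: "('g, 'm) monoid_scheme \<Rightarrow> ('i \<Rightarrow> 'g) \<Rightarrow> 'i free_group \<Rightarrow> 'g" where
  "free_eval G v w =
     foldr (\<lambda>(i, positive) y. (if positive then v i else inv\<^bsub>G\<^esub> v i) \<otimes>\<^bsub>G\<^esub> y) (word w) \<one>\<^bsub>G\<^esub>"

text \<open>\<open>G = \<langle>gs | rs\<rangle>\<close>, where the generator \<open>i\<close> stands for the element \<open>v i\<close> of \<open>G\<close>: the
  kernel of the evaluation map is the normal closure of the relators.\<close>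

definition group_presentation ::
  "('g, 'm) monoid_scheme \<Rightarrow> 'i list \<Rightarrow> ('i \<Rightarrow> 'g) \<Rightarrow> 'i free_group list \<Rightarrow> bool" where
  "group_presentation G gs v rs \<longleftrightarrow>
     group G \<and> distinct gs \<and> set gs = UNIV \<and> range v \<subseteq> carrier G \<and>
     generate G (range v) = carrier G \<and>
     kernel \<F> G (free_eval G v) = \<Inter>{N. N \<lhd> \<F> \<and> set rs \<subseteq> N}"

definition letter_val :: "'i letter \<Rightarrow> 'i free_group" where
  "letter_val l = (if snd l then gen (fst l) else - gen (fst l))"

definition fox_letter :: "'i \<Rightarrow> 'i letter \<Rightarrow> ('i free_group \<Rightarrow>\<^sub>0 int)" where
  "fox_letter j l =
     (if fst l \<noteq> j then 0 else if snd l then 1 else - Poly_Mapping.single (- gen j) 1)"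

primrec fox_word :: "'i \<Rightarrow> 'i letter list \<Rightarrow> ('i free_group \<Rightarrow>\<^sub>0 int)" where
  "fox_word j [] = 0"
| "fox_word j (l # w) = fox_letter j l + Poly_Mapping.single (letter_val l) 1 * fox_word j w"

definition fox :: "'i \<Rightarrow> 'i free_group \<Rightarrow> ('i free_group \<Rightarrow>\<^sub>0 int)" where
  "fox j u = fox_word j (word u)"

lemma letter_val_inv: "letter_val (letter_inv l) = - letter_val l"
  by (simp add: letter_val_def letter_inv_def)

lemma fox_letter_inv:
  "fox_letter j l + Poly_Mapping.single (letter_val l) 1 * fox_letter j (letter_inv l) = 0"
  by (auto simp: fox_letter_def letter_val_def letter_inv_def mult_single)

lemma fox_word_push: "fox_word j (push l w) = fox_word j (l # w)"
proof (cases w)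
  case (Cons m w')
  have "fox_letter j l + Poly_Mapping.single (letter_val l) 1 *
      (fox_letter j (letter_inv l) + Poly_Mapping.single (- letter_val l) 1 * fox_word j w')
    = fox_word j w'"
    using fox_letter_inv[of j l]
    by (simp add: distrib_left mult_single flip: mult.assoc add.assoc)
  with Cons show ?thesis by (auto simp: letter_val_inv)
qed simp

lemma fox_word_foldr_push:
  "fox_word j (foldr push u v) =
     fox_word j u + Poly_Mapping.single (sum_list (map letter_val u)) 1 * fox_word j v"
  by (induction u)
     (auto simp: fox_word_push distrib_left mult_single add.assoc simp flip: mult.assoc)

lemma word_letter_val: "word (letter_val l) = [l]"
  by (cases l) (auto simp: letter_val_def gen.rep_eq uminus_free_group.rep_eq letter_inv_def)

lemma word_sum_letter_val: "word (sum_list (map letter_val w)) = foldr push w []"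
  by (induction w) (auto simp: zero_free_group.rep_eq plus_free_group.rep_eq word_letter_val)

lemma sum_letter_val_word: "sum_list (map letter_val (word u)) = u"
  by (metis foldr_push_Nil mem_Collect_eq word word_inject word_sum_letter_val)

lemma fox_add: "fox j (u + v) = fox j u + Poly_Mapping.single u 1 * fox j v"
  by (simp add: fox_def plus_free_group.rep_eq fox_word_foldr_push sum_letter_val_word)

lemma fox_gen: "fox j (gen i) = (if i = j then 1 else 0)"
  by (simp add: fox_def gen.rep_eq fox_letter_def)


section \<open>Vector spaces, bases and characteristic polynomials\<close>

definition ordered_basis :: "('k::field, 'v, 'm) module_scheme \<Rightarrow> 'v list \<Rightarrow> bool" where
  "ordered_basis V vs \<longleftrightarrow> distinct vs \<and> vectorspace.basis class_ring V (set vs)"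

definition coordinates ::
  "('k::field, 'v, 'm) module_scheme \<Rightarrow> 'v list \<Rightarrow> 'v \<Rightarrow> 'k Matrix.vec" where
  "coordinates V vs u = (THE c. c \<in> carrier_vec (length vs) \<and>
     u = (\<Oplus>\<^bsub>V\<^esub>i\<in>{..<length vs}. vec_index c i \<odot>\<^bsub>V\<^esub> vs ! i))"

definition matrix_of ::
  "('k::field, 'v, 'm) module_scheme \<Rightarrow> 'v list \<Rightarrow> ('v \<Rightarrow> 'v) \<Rightarrow> 'k Matrix.mat" where
  "matrix_of V vs T = Matrix.mat (length vs) (length vs)
     (\<lambda>(i, j). vec_index (coordinates V vs (T (vs ! j))) i)"

text \<open>The choice of basis is immaterial: matrices in different bases are similar.\<close>

definition char_poly_endo ::
  "('k::field, 'v, 'm) module_scheme \<Rightarrow> ('v \<Rightarrow> 'v) \<Rightarrow> 'k poly" where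
  "char_poly_endo V T = char_poly (matrix_of V (SOME vs. ordered_basis V vs) T)"

definition quotient_space ::
  "('k, 'v, 'm) module_scheme \<Rightarrow> 'v set \<Rightarrow> ('k, 'v set) module" where
  "quotient_space V W =
     \<lparr>carrier = a_rcosets\<^bsub>V\<^esub> W, mult = undefined, one = undefined,
      zero = W, add = set_add V,
      smult = (\<lambda>c C. \<Union>u\<in>C. W +>\<^bsub>V\<^esub> (c \<odot>\<^bsub>V\<^esub> u))\<rparr>"


section \<open>First cohomology\<close>

text \<open>\<open>G\<close> acts on the vector space \<open>V\<close> by \<open>act\<close>, and \<open>N\<close> is a normal subgroup of \<open>G\<close>.  Cochains
  on \<open>N\<close> are extensional functions, that is, \<open>undefined\<close> outside \<open>N\<close>.\<close>

definition cocycles ::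
  "('g, 'n) monoid_scheme \<Rightarrow> 'g set \<Rightarrow> ('k, 'v, 'm) module_scheme \<Rightarrow> ('g \<Rightarrow> 'v \<Rightarrow> 'v) \<Rightarrow>
   ('g \<Rightarrow> 'v) set" where
  "cocycles G N V act =
     {f \<in> N \<rightarrow>\<^sub>E carrier V. \<forall>g\<in>N. \<forall>h\<in>N. f (g \<otimes>\<^bsub>G\<^esub> h) = f g \<oplus>\<^bsub>V\<^esub> act g (f h)}"

definition coboundaries ::
  "'g set \<Rightarrow> ('k, 'v, 'm) module_scheme \<Rightarrow> ('g \<Rightarrow> 'v \<Rightarrow> 'v) \<Rightarrow> ('g \<Rightarrow> 'v) set" where
  "coboundaries N V act = (\<lambda>u. \<lambda>g\<in>N. act g u \<ominus>\<^bsub>V\<^esub> u) ` carrier V"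

definition cocycle_space ::
  "('g, 'n) monoid_scheme \<Rightarrow> 'g set \<Rightarrow> ('k, 'v, 'm) module_scheme \<Rightarrow> ('g \<Rightarrow> 'v \<Rightarrow> 'v) \<Rightarrow>
   ('k, 'g \<Rightarrow> 'v) module" where
  "cocycle_space G N V act =
     \<lparr>carrier = cocycles G N V act, mult = undefined, one = undefined,
      zero = (\<lambda>g\<in>N. \<zero>\<^bsub>V\<^esub>), add = (\<lambda>f f'. \<lambda>g\<in>N. f g \<oplus>\<^bsub>V\<^esub> f' g),
      smult = (\<lambda>c f. \<lambda>g\<in>N. c \<odot>\<^bsub>V\<^esub> f g)\<rparr>"

definition H1 ::
  "('g, 'n) monoid_scheme \<Rightarrow> 'g set \<Rightarrow> ('k, 'v, 'm) module_scheme \<Rightarrow> ('g \<Rightarrow> 'v \<Rightarrow> 'v) \<Rightarrow>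
   ('k, ('g \<Rightarrow> 'v) set) module" where
  "H1 G N V act = quotient_space (cocycle_space G N V act) (coboundaries N V act)"

definition cocycle_action ::
  "('g, 'n) monoid_scheme \<Rightarrow> 'g set \<Rightarrow> ('g \<Rightarrow> 'v \<Rightarrow> 'v) \<Rightarrow> 'g \<Rightarrow> ('g \<Rightarrow> 'v) \<Rightarrow> ('g \<Rightarrow> 'v)" where
  "cocycle_action G N act x f = (\<lambda>g\<in>N. act x (f (inv\<^bsub>G\<^esub> x \<otimes>\<^bsub>G\<^esub> g \<otimes>\<^bsub>G\<^esub> x)))"

text \<open>The action of \<open>G Mod N\<close> on \<open>H1 G N V act\<close>.  Since \<open>N\<close> acts trivially on its own cohomology,
  every representative \<open>x \<in> Q\<close> maps the class \<open>C\<close> onto the same class.\<close>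

definition H1_action ::
  "('g, 'n) monoid_scheme \<Rightarrow> 'g set \<Rightarrow> ('g \<Rightarrow> 'v \<Rightarrow> 'v) \<Rightarrow> 'g set \<Rightarrow>
   ('g \<Rightarrow> 'v) set \<Rightarrow> ('g \<Rightarrow> 'v) set" where
  "H1_action G N act Q C = (\<Union>x\<in>Q. cocycle_action G N act x ` C)"


section \<open>Twisted Alexander polynomials\<close>

text \<open>Laurent polynomials over \<open>K\<close> are viewed inside the field \<open>K(t)\<close> of rational functions.  The
  infinite cyclic group generated by \<open>t\<close> is identified with the integers, so \<open>\<alpha> g\<close> is the
  exponent of \<open>t\<close>.\<close>

abbreviation t_var :: "'k::field poly fract" where
  "t_var \<equiv> to_fract [:0, 1:]"

abbreviation const_fract :: "'k::field \<Rightarrow> 'k poly fract" where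
  "const_fract c \<equiv> to_fract [:c:]"

definition alexander_hom ::
  "('g, 'm) monoid_scheme \<Rightarrow> ('i \<Rightarrow> 'g) \<Rightarrow> nat \<Rightarrow> ('g \<Rightarrow> 'k::field Matrix.mat) \<Rightarrow> ('g \<Rightarrow> int) \<Rightarrow>
   ('i free_group \<Rightarrow>\<^sub>0 int) \<Rightarrow> 'k poly fract Matrix.mat" where
  "alexander_hom G v l \<sigma> \<alpha> p = Matrix.mat l l (\<lambda>(i, j).
     \<Sum>w\<in>Poly_Mapping.keys p. of_int (Poly_Mapping.lookup p w) *
       (t_var powi \<alpha> (free_eval G v w) * const_fract (\<sigma> (free_eval G v w) $$ (i, j))))"

text \<open>The block column indexed by \<open>js ! j\<close> consists of the derivatives with respect to the
  generator \<open>js ! j\<close>; removing a block column means removing a generator from \<open>js\<close>.\<close>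

definition alexander_matrix ::
  "('g, 'm) monoid_scheme \<Rightarrow> ('i \<Rightarrow> 'g) \<Rightarrow> 'i list \<Rightarrow> 'i free_group list \<Rightarrow> nat \<Rightarrow>
   ('g \<Rightarrow> 'k::field Matrix.mat) \<Rightarrow> ('g \<Rightarrow> int) \<Rightarrow> 'k poly fract Matrix.mat" where
  "alexander_matrix G v js rs l \<sigma> \<alpha> =
     Matrix.mat (l * length rs) (l * length js) (\<lambda>(p, q).
       alexander_hom G v l \<sigma> \<alpha> (fox (js ! (q div l)) (rs ! (p div l))) $$ (p mod l, q mod l))"

definition is_twisted_alexander_polynomial ::
  "('g, 'm) monoid_scheme \<Rightarrow> 'i list \<Rightarrow> ('i \<Rightarrow> 'g) \<Rightarrow> 'i free_group list \<Rightarrow> nat \<Rightarrow>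
   ('g \<Rightarrow> 'k::field Matrix.mat) \<Rightarrow> ('g \<Rightarrow> int) \<Rightarrow> 'k poly fract \<Rightarrow> bool" where
  "is_twisted_alexander_polynomial G gs v rs l \<sigma> \<alpha> \<Delta> \<longleftrightarrow>
     length gs = length rs + 1 \<and>
     (\<exists>k\<in>set gs.
        let d = Determinant.det (alexander_hom G v l \<sigma> \<alpha> (1 - Poly_Mapping.single (gen k) 1))
        in d \<noteq> 0 \<and> \<Delta> = Determinant.det (alexander_matrix G v (removeAll k gs) rs l \<sigma> \<alpha>) / d)"

text \<open>Equality up to the indeterminacy of the twisted Alexander polynomial of a representation
  of degree \<open>l\<close>.\<close>

definition alexander_equal :: "nat \<Rightarrow> 'k::field poly fract \<Rightarrow> 'k poly fract \<Rightarrow> bool" where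
  "alexander_equal l p q \<longleftrightarrow>
     (\<exists>c s. c \<noteq> 0 \<and> p = const_fract c * t_var powi (int l * s) * q)"


section \<open>Once-punctured torus bundles\<close>

datatype fiber_gen = A | B

datatype bundle_gen = Fiber fiber_gen | Meridian

lemma UNIV_fiber_gen: "UNIV = {A, B}"
  using fiber_gen.exhaust by auto

instance fiber_gen :: finite
  by standard (simp add: UNIV_fiber_gen)

definition bundle_gens :: "bundle_gen list" where
  "bundle_gens = [Fiber A, Fiber B, Meridian]"

definition exponent_sum :: "'i \<Rightarrow> 'i free_group \<Rightarrow> int" where
  "exponent_sum i u = (\<Sum>l\<leftarrow>word u. if fst l = i then (if snd l then 1 else - 1) else 0)"

text \<open>\<open>\<phi>\<close> is an automorphism of the fiber group inducing the matrix \<open>P\<close> on the first homology of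
  the fiber.  It is the one determined by the choice of a meridian of the boundary torus as stable
  letter: the meridian commutes with the boundary curve of the fiber, so \<open>\<phi>\<close> fixes
  the commutator of the two generators.\<close>

definition represents_monodromy ::
  "int ^ fiber_gen ^ fiber_gen \<Rightarrow> (fiber_gen free_group \<Rightarrow> fiber_gen free_group) \<Rightarrow> bool" where
  "represents_monodromy P \<phi> \<longleftrightarrow>
     \<phi> \<in> iso \<F> \<F> \<and>
     (\<forall>i j. exponent_sum i (\<phi> (gen j)) = P $ i $ j) \<and>
     \<phi> (gen A + gen B - gen A - gen B) = gen A + gen B - gen A - gen B"

text \<open>The relators \<open>\<phi>(g) (x g x\<^sup>-\<^sup>1)\<^sup>-\<^sup>1\<close>.\<close>

definition bundle_relator ::
  "(fiber_gen free_group \<Rightarrow> fiber_gen free_group) \<Rightarrow> fiber_gen \<Rightarrow> bundle_gen free_group" where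
  "bundle_relator \<phi> i =
     free_eval \<F> (\<lambda>j. gen (Fiber j)) (\<phi> (gen i)) - (gen Meridian + gen (Fiber i) - gen Meridian)"

definition bundle_relators ::
  "(fiber_gen free_group \<Rightarrow> fiber_gen free_group) \<Rightarrow> bundle_gen free_group list" where
  "bundle_relators \<phi> = [bundle_relator \<phi> A, bundle_relator \<phi> B]"

definition fiber_group :: "('g, 'm) monoid_scheme \<Rightarrow> (bundle_gen \<Rightarrow> 'g) \<Rightarrow> 'g set" where
  "fiber_group G v = generate G (range (\<lambda>i. v (Fiber i)))"


section \<open>The holonomy and its adjoint representation\<close>

definition lorentz_form :: "real ^ 4 \<Rightarrow> real ^ 4 \<Rightarrow> real" where
  "lorentz_form x y = x $ 1 * y $ 1 + x $ 2 * y $ 2 + x $ 3 * y $ 3 - x $ 4 * y $ 4"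

definition O31 :: "(real ^ 4 ^ 4) set" where
  "O31 = {X. \<forall>x y. lorentz_form (X *v x) (X *v y) = lorentz_form x y}"

definition SO31_0 :: "(real ^ 4 ^ 4) set" where
  "SO31_0 = connected_component_set O31 (Finite_Cartesian_Product.mat 1)"

definition GL4 :: "(real ^ 4 ^ 4) monoid" where
  "GL4 = \<lparr>carrier = {X. invertible X}, mult = (**), one = Finite_Cartesian_Product.mat 1\<rparr>"

definition scalars4 :: "(real ^ 4 ^ 4) set" where
  "scalars4 = {Finite_Cartesian_Product.mat c | c. c \<noteq> 0}"

definition PGL4 :: "(real ^ 4 ^ 4) set monoid" where
  "PGL4 = GL4 Mod scalars4"

definition proj4 :: "real ^ 4 ^ 4 \<Rightarrow> (real ^ 4 ^ 4) set" where
  "proj4 X = scalars4 #>\<^bsub>GL4\<^esub> X"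

definition PSO31 :: "(real ^ 4 ^ 4) set set" where
  "PSO31 = proj4 ` SO31_0"

text \<open>By Mostow--Prasad rigidity, the discrete faithful representations of the fundamental group of
  a hyperbolic once-punctured torus bundle are precisely the holonomies of its complete
  hyperbolic structure, and any two of them are conjugate by an isometry.  Projectivization
  restricts to a homeomorphism from \<open>SO31_0\<close> onto \<open>PSO31\<close>, so discreteness is tested in
  \<open>SO31_0\<close>.\<close>

definition discrete_faithful ::
  "('g, 'm) monoid_scheme \<Rightarrow> ('g \<Rightarrow> (real ^ 4 ^ 4) set) \<Rightarrow> bool" where
  "discrete_faithful G \<rho> \<longleftrightarrow>
     \<rho> \<in> hom G PGL4 \<and> \<rho> ` carrier G \<subseteq> PSO31 \<and> inj_on \<rho> (carrier G) \<and>
     discrete {X \<in> SO31_0. proj4 X \<in> \<rho> ` carrier G}"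

definition sl4 :: "(real, real ^ 4 ^ 4) module" where
  "sl4 = \<lparr>carrier = {X. Determinants.trace X = 0}, mult = undefined, one = undefined,
          zero = 0, add = (+), smult = scaleR\<rparr>"

text \<open>Conjugation by a matrix only depends on its class in \<open>PGL4\<close>.\<close>

definition Ad :: "(real ^ 4 ^ 4) set \<Rightarrow> real ^ 4 ^ 4 \<Rightarrow> real ^ 4 ^ 4" where
  "Ad p X = (let Y = (SOME Y. Y \<in> p) in Y ** X ** matrix_inv Y)"

end

theory Submission
  imports Defs
begin

text \<open>
  A cocycle on the free group of rank \<open>2\<close> is determined by its values on \<open>a\<close> and \<open>b\<close>, so the
  space of cocycles is \<open>V \<oplus> V\<close> for \<open>V = sl(4)\<close>.  Let \<open>M\<close> be the matrix of the meridian on it,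
  \<open>X\<close> the matrix of the meridian on \<open>V\<close>, and \<open>J\<close> the matrix of \<open>f \<mapsto> f \<circ> \<phi>\<close>, which consists of
  Fox derivatives.  Then \<open>J M = X \<oplus> X\<close>, so that the Alexander matrix \<open>J - t (X \<oplus> X)\<close> equals
  \<open>J (1 - t M)\<close> and the Alexander polynomial is \<open>det (1 - t M) / det (1 - t X)\<close> up to a constant.

  Both determinants are reciprocal to characteristic polynomials, and both are palindromic: \<open>X\<close>
  preserves the trace form, and \<open>M\<close> preserves the cup product pairing of the fiber with values on
  the boundary curve.  That pairing is nondegenerate already on cocycles.

  The coboundaries form a copy of \<open>V\<close>, as the fiber has no invariants in \<open>V\<close>; hence the
  characteristic polynomial of \<open>M\<close> is that of \<open>X\<close> times that of the action on cohomology.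
  Invariants are excluded by Lorentz geometry: the peripheral subgroup is free abelian of rank \<open>2\<close>
  and discrete, so it fixes a null vector, and an invariant matrix that is not a scalar would force
  the fiber to fix a null line or a proper nondegenerate subspace, contradicting freeness and
  discreteness.
\<close>

section \<open>Lorentz geometry\<close>

text \<open>Fox calculus produces \<open>det (1 - t M)\<close>, whereas the claim concerns
  \<open>det (t - M)\<close>, and the indeterminacy allows only constants and powers of
  \<open>t\<close> divisible by the degree. A symmetry of \<open>M\<close> itself has to bridge the
  gap. Absolute cohomology offers none directly: the cup product of the free fiber takes values in a
  zero group. Cocycles, however, are cohomology relative to a base point, and with the base point on
  the boundary curve the cup product can be evaluated along that curve. That \<phi> fixes the
  commutator of the generators enters twice: it makes this pairing invariant, and it makes the
  meridian commute with the boundary curve, which gives the peripheral subgroup of rank 2. The rank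
  is what excludes invariants. If the orbit of the peripheral null vector under the fiber spanned a
  proper subspace, the norms of peripheral elements would be bounded in terms of a single additive
  real function; such a function stays bounded on infinitely many points of a lattice of rank 2,
  while discreteness allows only finitely many elements of bounded norm.\<close>

notation lorentz_form (infixl "\<star>" 70)

lemma lorentz_commute: "x \<star> y = y \<star> x"
  by (simp add: lorentz_form_def mult.commute)

lemma lorentz_simps [simp]:
  "(x + y) \<star> z = x \<star> z + y \<star> z" "x \<star> (y + z) = x \<star> y + x \<star> z"
  "(x - y) \<star> z = x \<star> z - y \<star> z" "x \<star> (y - z) = x \<star> y - x \<star> z"
  "(c *\<^sub>R x) \<star> z = c * (x \<star> z)" "x \<star> (c *\<^sub>R z) = c * (x \<star> z)"
  "(- x) \<star> z = - (x \<star> z)" "x \<star> (- z) = - (x \<star> z)"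
  "0 \<star> x = 0" "x \<star> 0 = 0"
  by (auto simp: lorentz_form_def algebra_simps)

lemma lorentz_axis:
  "x \<star> axis 1 1 = x $ 1" "x \<star> axis 2 1 = x $ 2" "x \<star> axis 3 1 = x $ 3" "x \<star> axis 4 1 = - x $ 4"
  by (auto simp: lorentz_form_def axis_def)

lemma lorentz_nondegenerate: "(\<And>y. x \<star> y = 0) \<Longrightarrow> x = 0"
  using lorentz_axis[of x] by (simp add: Finite_Cartesian_Product.vec_eq_iff forall_4)

lemma lorentz_eqI: "(\<And>z. x \<star> z = y \<star> z) \<Longrightarrow> x = y"
  using lorentz_nondegenerate[of "x - y"] by simp

lemma norm_le_4: "norm (x :: real ^ 4) \<le> \<bar>x $ 1\<bar> + \<bar>x $ 2\<bar> + \<bar>x $ 3\<bar> + \<bar>x $ 4\<bar>"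
  using norm_le_l1_cart[of x] by (simp add: sum_4)

lemma power2_norm_4: "(norm (x :: real ^ 4))\<^sup>2 = (x $ 1)\<^sup>2 + (x $ 2)\<^sup>2 + (x $ 3)\<^sup>2 + (x $ 4)\<^sup>2"
  by (simp add: power2_norm_eq_inner inner_vec_def sum_4 flip: power2_eq_square)

lemma Cauchy_Schwarz_3:
  "(a * x + b * y + c * z)\<^sup>2 \<le> (a\<^sup>2 + b\<^sup>2 + c\<^sup>2) * (x\<^sup>2 + y\<^sup>2 + (z::real)\<^sup>2)"
proof -
  have "(a\<^sup>2 + b\<^sup>2 + c\<^sup>2) * (x\<^sup>2 + y\<^sup>2 + z\<^sup>2) - (a * x + b * y + c * z)\<^sup>2
      = (a * y - b * x)\<^sup>2 + (a * z - c * x)\<^sup>2 + (b * z - c * y)\<^sup>2"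
    by (simp add: power2_eq_square algebra_simps)
  then show ?thesis using zero_le_power2[of "a * y - b * x"] zero_le_power2[of "a * z - c * x"] zero_le_power2[of "b * z - c * y"] by linarith
qed

text \<open>Cauchy-Schwarz on the spatial parts bounds the time coordinate of \<open>w\<close>.
  Beyond positivity of the form on the complement of \<open>u\<close>, the explicit constant is what
  later bounds whole isometries.\<close>

lemma orthogonal_timelike:
  assumes "u \<star> u < 0" "u \<star> w = 0"
  shows "(norm w)\<^sup>2 * (- (u \<star> u)) \<le> 2 * (u $ 4)\<^sup>2 * (w \<star> w)"
proof -
  define U where "U = (u $ 1)\<^sup>2 + (u $ 2)\<^sup>2 + (u $ 3)\<^sup>2"
  define W where "W = (w $ 1)\<^sup>2 + (w $ 2)\<^sup>2 + (w $ 3)\<^sup>2"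
  define q where "q = - (u \<star> u)"
  have q: "q = (u $ 4)\<^sup>2 - U" "q > 0"
    using assms by (auto simp: q_def U_def lorentz_form_def power2_eq_square)
  have U0: "U \<ge> 0" "W \<ge> 0" by (auto simp: U_def W_def)
  have "(w $ 4)\<^sup>2 * (u $ 4)\<^sup>2 = (u $ 1 * w $ 1 + u $ 2 * w $ 2 + u $ 3 * w $ 3)\<^sup>2"
    using assms(2) by (simp add: lorentz_form_def power_mult_distrib mult.commute flip: power_mult_distrib)
  also have "\<dots> \<le> U * W"
    unfolding U_def W_def by (rule Cauchy_Schwarz_3)
  finally have 1: "(w $ 4)\<^sup>2 * (u $ 4)\<^sup>2 \<le> ((u $ 4)\<^sup>2 - q) * W" using q by simp
  then have 2: "W * q \<le> (u $ 4)\<^sup>2 * (W - (w $ 4)\<^sup>2)" by (simp add: algebra_simps)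
  have u4: "(u $ 4)\<^sup>2 > 0" using q U0 by linarith
  have "W - (w $ 4)\<^sup>2 \<ge> 0"
    proof -
    have "0 \<le> (u $ 4)\<^sup>2 * (W - (w $ 4)\<^sup>2)" using 2 q(2) U0 by (meson mult_nonneg_nonneg less_imp_le order_trans)
    then show ?thesis using u4 by (auto simp: zero_le_mult_iff)
  qed
  have ww: "w \<star> w = W - (w $ 4)\<^sup>2" by (simp add: W_def lorentz_form_def power2_eq_square)
  have "(norm w)\<^sup>2 = W + (w $ 4)\<^sup>2" by (simp add: power2_norm_4 W_def)
  also have "\<dots> \<le> 2 * W" using \<open>W - (w $ 4)\<^sup>2 \<ge> 0\<close> by simp
  finally have "(norm w)\<^sup>2 * q \<le> 2 * W * q" using q by (simp add: mult_right_mono)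
  also have "\<dots> \<le> 2 * ((u $ 4)\<^sup>2 * (W - (w $ 4)\<^sup>2))" using 2 by simp
  finally show ?thesis using ww by (simp add: q_def mult.assoc)
qed

lemma orthogonal_timelike_pos:
  assumes "u \<star> u < 0" "u \<star> w = 0" "w \<noteq> 0"
  shows "w \<star> w > 0"
proof -
  have "(norm w)\<^sup>2 * (- (u \<star> u)) > 0" using assms by (intro mult_pos_pos) auto
  then have "0 < 2 * (u $ 4)\<^sup>2 * (w \<star> w)" using orthogonal_timelike[OF assms(1,2)] by linarith
  then show ?thesis by (auto simp: zero_less_mult_iff not_less)
qed

text \<open>Subtracting the multiple of \<open>x\<close> with the same time coordinate leaves a null
  vector without time component, which is zero.\<close>

lemma null_orthogonal_imp_parallel:
  assumes "x \<star> x = 0" "y \<star> y = 0" "x \<star> y = 0" "x \<noteq> 0"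
  shows "\<exists>c. y = c *\<^sub>R x"
proof -
  have x4: "x $ 4 \<noteq> 0"
  proof
    assume "x $ 4 = 0"
    then have "(x $ 1)\<^sup>2 + (x $ 2)\<^sup>2 + (x $ 3)\<^sup>2 = 0"
      using assms(1) by (simp add: lorentz_form_def power2_eq_square)
    then have "x $ 1 = 0 \<and> x $ 2 = 0 \<and> x $ 3 = 0"
      by (simp add: add_nonneg_eq_0_iff)
    then have "x = 0" using \<open>x $ 4 = 0\<close> by (simp add: Finite_Cartesian_Product.vec_eq_iff forall_4)
    then show False using assms(4) by simp
  qed
  define z where "z = y - (y $ 4 / x $ 4) *\<^sub>R x"
  have "z $ 4 = 0" using x4 by (simp add: z_def)
  moreover have "z \<star> z = 0" using assms by (simp add: z_def lorentz_commute[of y x])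
  ultimately have "(z $ 1)\<^sup>2 + (z $ 2)\<^sup>2 + (z $ 3)\<^sup>2 = 0"
    by (simp add: lorentz_form_def power2_eq_square)
  then have "z $ 1 = 0 \<and> z $ 2 = 0 \<and> z $ 3 = 0"
    by (simp add: add_nonneg_eq_0_iff)
  then have "z = 0" using \<open>z $ 4 = 0\<close> by (simp add: Finite_Cartesian_Product.vec_eq_iff forall_4)
  then show ?thesis by (auto simp: z_def)
qed

section \<open>Isometries of the Lorentz form\<close>

lemma O31D: "X \<in> O31 \<Longrightarrow> (X *v x) \<star> (X *v y) = x \<star> y"
  by (simp add: O31_def)

lemma O31_one: "Finite_Cartesian_Product.mat 1 \<in> O31"
  by (simp add: O31_def)

lemma O31_mult: "X \<in> O31 \<Longrightarrow> Y \<in> O31 \<Longrightarrow> X ** Y \<in> O31"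
  by (simp add: O31_def flip: matrix_vector_mul_assoc)

lemma O31_invertible: assumes "X \<in> O31" shows "invertible X"
proof -
  have "x = 0" if "X *v x = 0" for x
  proof (rule lorentz_nondegenerate)
    fix y show "x \<star> y = 0" using O31D[OF assms, of x y] that by simp
  qed
  then show ?thesis
    unfolding invertible_left_inverse matrix_left_invertible_ker by blast
qed

lemma invertible_matrix_inv:
  fixes X :: "real ^ 'n ^ 'n"
  assumes "invertible X"
  shows "X ** matrix_inv X = Finite_Cartesian_Product.mat 1" "matrix_inv X ** X = Finite_Cartesian_Product.mat 1"
  using someI_ex[OF assms[unfolded invertible_def]] by (auto simp: matrix_inv_def)

lemma O31_inv: assumes "X \<in> O31" shows "matrix_inv X \<in> O31"
proof -
  have "(matrix_inv X *v x) \<star> (matrix_inv X *v y) = x \<star> y" for x y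
    using O31D[OF assms, of "matrix_inv X *v x" "matrix_inv X *v y"]
    by (simp add: matrix_vector_mul_assoc invertible_matrix_inv[OF O31_invertible[OF assms]])
  then show ?thesis by (simp add: O31_def)
qed

lemma norm_matrix_le:
  assumes "\<And>j. norm ((g :: real ^ 4 ^ 4) *v axis j 1) \<le> K"
  shows "norm g \<le> 16 * K"
proof -
  have e: "\<bar>g $ i $ j\<bar> \<le> K" for i j
  proof -
    have "(g *v axis j 1) $ i = g $ i $ j" by (simp add: matrix_vector_mul_component inner_axis)
    then show ?thesis using component_le_norm_cart[of "g *v axis j 1" i] assms[of j] by simp
  qed
  have "norm (g $ i) \<le> 4 * K" for i
    using norm_le_4[of "g $ i"] e[of i 1] e[of i 2] e[of i 3] e[of i 4] by linarith
  moreover have "norm g \<le> (\<Sum>i\<in>UNIV. norm (g $ i))" by (simp add: norm_vec_def L2_set_le_sum)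
  ultimately show ?thesis unfolding sum_4 by (smt (verit))
qed

text \<open>Properness of the action on hyperbolic space: the component of a vector along
  \<open>u\<close> moves with \<open>g *v u\<close>, and its orthogonal part keeps its Lorentz
  square, so that \<open>orthogonal_timelike\<close> bounds its image in terms of
  \<open>g *v u\<close>.\<close>

lemma O31_norm_bound:
  assumes "u \<star> u < 0"
  obtains K where "\<And>g. g \<in> O31 \<Longrightarrow> norm g \<le> K * norm (g *v u)"
proof -
  define q where "q = - (u \<star> u)"
  have q: "q > 0" using assms by (simp add: q_def)
  have "\<exists>K. \<forall>g\<in>O31. norm (g *v v) \<le> K * norm (g *v u)" for v
  proof -
    define a where "a = (u \<star> v) / (u \<star> u)"
    define p where "p = v - a *\<^sub>R u"
    have up: "u \<star> p = 0" using assms by (simp add: p_def a_def)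
    have pp: "p \<star> p \<ge> 0" using orthogonal_timelike_pos[OF assms up] by (cases "p = 0") auto
    define K where "K = \<bar>a\<bar> + sqrt (2 * (p \<star> p) / q)"
    have "norm (g *v v) \<le> K * norm (g *v u)" if g: "g \<in> O31" for g
    proof -
      have 1: "(g *v u) \<star> (g *v u) < 0" "(g *v u) \<star> (g *v p) = 0" using assms up O31D[OF g] by auto
      have "(norm (g *v p))\<^sup>2 * q \<le> 2 * ((g *v u) $ 4)\<^sup>2 * (p \<star> p)"
        using orthogonal_timelike[OF 1] O31D[OF g] by (simp add: q_def)
      also have "\<dots> \<le> 2 * (norm (g *v u))\<^sup>2 * (p \<star> p)"
        by (intro mult_right_mono mult_left_mono pp) (auto simp: component_le_norm_cart simp flip: abs_le_square_iff)
      finally have "(norm (g *v p))\<^sup>2 \<le> (2 * (p \<star> p) / q) * (norm (g *v u))\<^sup>2"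
        using q by (simp add: field_simps)
      then have "norm (g *v p) \<le> sqrt ((2 * (p \<star> p) / q) * (norm (g *v u))\<^sup>2)"
        by (rule real_le_rsqrt)
      also have "\<dots> = sqrt (2 * (p \<star> p) / q) * norm (g *v u)"
        by (subst real_sqrt_mult) simp
      finally have 2: "norm (g *v p) \<le> sqrt (2 * (p \<star> p) / q) * norm (g *v u)" .
      have "g *v v = a *\<^sub>R (g *v u) + g *v p"
        by (simp add: p_def matrix_vector_mult_diff_distrib matrix_vector_mult_scaleR)
      then have "norm (g *v v) \<le> norm (a *\<^sub>R (g *v u)) + norm (g *v p)" by (metis norm_triangle_ineq)
      then show ?thesis using 2 by (simp add: K_def algebra_simps)
    qed
    then show ?thesis by blast
  qed
  then obtain K where K: "\<And>v g. g \<in> O31 \<Longrightarrow> norm (g *v v) \<le> K v * norm (g *v u)" by metis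
  define K' where "K' = (\<Sum>j\<in>(UNIV::4 set). \<bar>K (axis j 1)\<bar>)"
  have "norm g \<le> (16 * K') * norm (g *v u)" if "g \<in> O31" for g
  proof -
    have "norm (g *v axis j 1) \<le> K' * norm (g *v u)" for j
    proof -
      have "\<bar>K (axis j 1)\<bar> \<le> K'" unfolding K'_def by (rule member_le_sum) auto
      then show ?thesis using K[OF that, of "axis j 1"]
        by (smt (verit) mult_right_mono norm_ge_zero)
    qed
    then show ?thesis using norm_matrix_le by (metis mult.assoc)
  qed
  then show thesis using that by blast
qed

text \<open>A linear map from dimension 4 to dimension 3 has a kernel.\<close>

lemma orthogonal_vector_exists:
  fixes a b c :: "real ^ 4"
  obtains e where "e \<noteq> 0" "a \<star> e = 0" "b \<star> e = 0" "c \<star> e = 0"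
proof -
  define f :: "real ^ 4 \<Rightarrow> real ^ 3" where "f = (\<lambda>x. vector [a \<star> x, b \<star> x, c \<star> x])"
  have lin: "linear f"
    by (rule linearI) (simp_all add: f_def Finite_Cartesian_Product.vec_eq_iff forall_3 vector_3 distrib_left)
  have "\<not> inj f"
  proof
    assume "inj f"
    then have "dim (range f) = dim (UNIV :: (real ^ 4) set)"
      using dim_image_eq[OF lin, of UNIV] by simp
    moreover have "dim (range f) \<le> 3" using dim_subset_UNIV[of "range f"]
      by simp
    ultimately show False by simp
  qed
  then obtain e where "e \<noteq> 0" "f e = 0"
    using linear_injective_0[OF lin] by blast
  then have "a \<star> e = 0" "b \<star> e = 0" "c \<star> e = 0"
    by (auto simp: f_def Finite_Cartesian_Product.vec_eq_iff forall_3 vector_3)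
  then show thesis using that \<open>e \<noteq> 0\<close> by blast
qed

section \<open>Limits of divergent sequences of isometries\<close>

lemma tendsto_lorentz:
  assumes "(f \<longlongrightarrow> a) F" "(g \<longlongrightarrow> b) F"
  shows "((\<lambda>k. f k \<star> g k) \<longlongrightarrow> a \<star> b) F"
  unfolding lorentz_form_def by (intro tendsto_intros tendsto_vec_nth assms)

lemma tendsto_matrix_vector:
  fixes f :: "'k \<Rightarrow> real ^ 4 ^ 4"
  assumes "(f \<longlongrightarrow> a) F"
  shows "((\<lambda>k. f k *v x) \<longlongrightarrow> a *v x) F"
  unfolding matrix_vector_mult_def by (intro vec_tendstoI) (auto intro!: tendsto_intros tendsto_vec_nth assms)

lemma tendsto_matrix_vector':
  fixes X :: "real ^ 4 ^ 4"
  assumes "(f \<longlongrightarrow> a) F"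
  shows "((\<lambda>k. X *v f k) \<longlongrightarrow> X *v a) F"
  unfolding matrix_vector_mult_def by (intro vec_tendstoI) (auto intro!: tendsto_intros tendsto_vec_nth assms)

lemma lorentz_inverse:
  assumes "g \<in> O31"
  shows "(matrix_inv g *v x) \<star> y = x \<star> (g *v y)"
  using O31D[OF assms, of "matrix_inv g *v x" y]
  by (simp add: matrix_vector_mul_assoc invertible_matrix_inv[OF O31_invertible[OF assms]])

text \<open>Normalised by their norms, the elements of a sequence in \<^term>\<open>O31\<close> that leaves every
  bounded set accumulate at a matrix whose image is totally isotropic, hence of the form
  \<open>v \<mapsto> (m \<star> v) n\<close> with null vectors \<open>n\<close> and \<open>m\<close>.  Whatever commutes with the sequence commutes
  with this limit.\<close>

lemma unbounded_sequence_null_vectors: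
  fixes S :: "nat \<Rightarrow> real ^ 4 ^ 4"
  assumes S: "\<And>k. S k \<in> O31" and fin: "\<And>C. finite {k. norm (S k) \<le> C}"
  shows "\<exists>n m. n \<noteq> 0 \<and> m \<noteq> 0 \<and> n \<star> n = 0 \<and> m \<star> m = 0 \<and>
    (\<forall>X. (\<forall>k. X ** S k = S k ** X) \<longrightarrow> (\<exists>\<mu>. X *v n = \<mu> *\<^sub>R n)) \<and>
    (\<forall>g \<mu>. (\<forall>k. g ** S k = S k ** g) \<longrightarrow> g \<in> O31 \<longrightarrow> g *v n = \<mu> *\<^sub>R n \<longrightarrow> \<mu> *\<^sub>R (g *v m) = m)"
proof -
  define N where "N k = norm (S k)" for k
  have N0: "N k > 0" for k
  proof -
    have "S k \<noteq> 0" using O31D[OF S[of k], of "axis 4 1" "axis 4 1"] by (auto simp: lorentz_axis)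
    then show ?thesis by (simp add: N_def)
  qed
  have "compact (sphere (0 :: real ^ 4 ^ 4) 1)" by simp
  moreover have "\<forall>k. (1 / N k) *\<^sub>R S k \<in> sphere 0 1" using N0 by (simp add: N_def less_imp_neq)
  ultimately obtain L r where L: "L \<in> sphere 0 1" and r: "strict_mono (r :: nat \<Rightarrow> nat)"
    and lim: "((\<lambda>k. (1 / N k) *\<^sub>R S k) \<circ> r) \<longlonglongrightarrow> L"
    unfolding compact_def by meson
  define s where "s k = 1 / N (r k)" for k
  have lim: "(\<lambda>k. s k *\<^sub>R S (r k)) \<longlonglongrightarrow> L" using lim by (simp add: s_def o_def)
  have "filterlim N at_top sequentially"
    unfolding filterlim_at_top eventually_cofinite[symmetric] cofinite_eq_sequentially[symmetric]
    unfolding eventually_cofinite using fin by (auto simp: N_def not_le intro: finite_subset[rotated] less_imp_le)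
  then have "filterlim (\<lambda>k. N (r k)) at_top sequentially"
    using filterlim_compose filterlim_subseq[OF r] by blast
  then have s0: "s \<longlonglongrightarrow> 0" unfolding s_def using tendsto_divide_0[OF tendsto_const] filterlim_at_top_imp_at_infinity by blast
  have limv: "(\<lambda>k. s k *\<^sub>R (S (r k) *v v)) \<longlonglongrightarrow> L *v v" for v
    using tendsto_matrix_vector[OF lim, of v] by (simp add: scaleR_matrix_vector_assoc)
  have ss: "(\<lambda>k. s k * (s k * c)) \<longlonglongrightarrow> 0" for c
    using tendsto_mult[OF s0 tendsto_mult[OF s0 tendsto_const[of c]]] by simp
  \<comment> \<open>The scaled isometries multiply the form by the square of \<open>s k\<close>,
    which tends to zero.\<close>
  have iso: "(L *v v) \<star> (L *v w) = 0" for v w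
  proof -
    have "(\<lambda>k. s k * (s k * (v \<star> w))) \<longlonglongrightarrow> (L *v v) \<star> (L *v w)"
      using tendsto_lorentz[OF limv[of v] limv[of w]] O31D[OF S] by simp
    then show ?thesis using ss LIMSEQ_unique by blast
  qed
  have comm: "X *v (L *v v) = L *v (X *v v)" if "\<And>k. X ** S k = S k ** X" for X v
  proof -
    have "(\<lambda>k. X *v (s k *\<^sub>R (S (r k) *v v))) \<longlonglongrightarrow> X *v (L *v v)"
      by (rule tendsto_matrix_vector'[OF limv])
    moreover have "X *v (s k *\<^sub>R (S (r k) *v v)) = s k *\<^sub>R (S (r k) *v (X *v v))" for k
      using that[of "r k"] by (simp add: matrix_vector_mult_scaleR matrix_vector_mul_assoc)
    ultimately show ?thesis using limv[of "X *v v"] LIMSEQ_unique by fastforce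
  qed
  have "L \<noteq> 0" using L by auto
  then obtain v0 where v0: "L *v v0 \<noteq> 0"
    by (metis matrix_eq matrix_vector_mult_0)
  define n where "n = L *v v0"
  have nn: "n \<star> n = 0" "n \<noteq> 0" using iso v0 by (auto simp: n_def)
  have "\<exists>c. L *v v = c *\<^sub>R n" for v
    using null_orthogonal_imp_parallel[OF nn(1) iso[of v v] _ nn(2)] iso by (simp add: n_def)
  then obtain c where c: "\<And>v. L *v v = c v *\<^sub>R n" by metis
  obtain z where z: "z \<star> n \<noteq> 0" using lorentz_nondegenerate[of n] nn(2) lorentz_commute by metis
  \<comment> \<open>The functional sending \<open>v\<close> to \<open>z \<star> (L *v v)\<close> is
    to be represented by a vector \<open>m\<close>. Moving the isometries to the other side shows
    \<open>m\<close> as the limit of scaled inverses applied to \<open>z\<close>, and the Lorentz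
    squares of these tend to zero.\<close>
  define y where "y k = s k *\<^sub>R (matrix_inv (S (r k)) *v z)" for k
  have yv: "(\<lambda>k. y k \<star> v) \<longlonglongrightarrow> z \<star> (L *v v)" for v
    using tendsto_lorentz[OF tendsto_const limv, of z v] by (simp add: y_def lorentz_inverse[OF S])
  define m :: "real ^ 4" where "m = (\<chi> i. if i = 4 then - (z \<star> (L *v axis i 1)) else z \<star> (L *v axis i 1))"
  have ym: "y \<longlonglongrightarrow> m"
  proof (rule vec_tendstoI)
    fix i
    show "(\<lambda>k. y k $ i) \<longlonglongrightarrow> m $ i"
      using yv[of "axis 1 1"] yv[of "axis 2 1"] yv[of "axis 3 1"] tendsto_minus[OF yv[of "axis 4 1"]] exhaust_4[of i]
      by (auto simp: m_def lorentz_axis)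
  qed
  have mv: "m \<star> v = z \<star> (L *v v)" for v
    using tendsto_lorentz[OF ym tendsto_const, of v] yv[of v] LIMSEQ_unique by blast
  have mm: "m \<star> m = 0"
  proof -
    have "(\<lambda>k. s k * (s k * (z \<star> z))) \<longlonglongrightarrow> m \<star> m"
      using tendsto_lorentz[OF ym ym] O31D[OF O31_inv[OF S]] by (simp add: y_def)
    then show ?thesis using ss LIMSEQ_unique by blast
  qed
  have "m \<star> v0 \<noteq> 0" unfolding mv using z unfolding n_def .
  then have m0: "m \<noteq> 0" by (rule contrapos_nn) (simp only: lorentz_simps)
  have X: "\<exists>\<mu>. X *v n = \<mu> *\<^sub>R n" if "\<And>k. X ** S k = S k ** X" for X
    using comm[OF that, of v0] c[of "X *v v0"] by (auto simp flip: n_def)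
  have g: "\<mu> *\<^sub>R (g *v m) = m"
    if g: "\<And>k. g ** S k = S k ** g" "g \<in> O31" "g *v n = \<mu> *\<^sub>R n" for g \<mu>
  proof -
    \<comment> \<open>\<open>g\<close> commutes with \<open>L\<close> and scales its image by
      \<open>\<mu>\<close>, hence it scales the functional of \<open>m\<close> by
      \<open>\<mu>\<close>. As \<open>g\<close> is an isometry, this turns into a statement about
      \<open>g *v m\<close>.\<close>
    have *: "m \<star> (g *v v) = \<mu> * (m \<star> v)" for v
      unfolding mv comm[OF g(1), symmetric] by (simp add: c g(3) matrix_vector_mult_scaleR)
    show "\<mu> *\<^sub>R (g *v m) = m"
    proof (rule lorentz_eqI)
      fix x
      have "x = g *v (matrix_inv g *v x)"
        by (simp add: matrix_vector_mul_assoc invertible_matrix_inv[OF O31_invertible[OF g(2)]])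
      then show "(\<mu> *\<^sub>R (g *v m)) \<star> x = m \<star> x"
        using *[of "matrix_inv g *v x"] O31D[OF g(2), of m "matrix_inv g *v x"] by simp
    qed
  qed
  show ?thesis using nn m0 mm X g by blast
qed

section \<open>Additive functions on a lattice of rank two\<close>

lemma additive_int_pair:
  fixes f :: "int \<Rightarrow> int \<Rightarrow> real"
  assumes "\<And>i j k l. f (i + k) (j + l) = f i j + f k l"
  shows "f i j = i * f 1 0 + j * f 0 1"
proof -
  have f0: "f 0 0 = 0" using assms[of 0 0 0 0] by simp
  have 1: "f i 0 = i * f 1 0" for i
  proof (induction i rule: int_induct[of _ 0])
    case (step1 i) then show ?case using assms[of i 1 0 0] by (simp add: algebra_simps)
  next
    case (step2 i) then show ?case using assms[of "i - 1" 1 0 0] by (simp add: algebra_simps)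
  qed (simp add: f0)
  have 2: "f 0 j = j * f 0 1" for j
  proof (induction j rule: int_induct[of _ 0])
    case (step1 i) then show ?case using assms[of 0 0 i 1] by (simp add: algebra_simps)
  next
    case (step2 i) then show ?case using assms[of 0 0 "i - 1" 1] by (simp add: algebra_simps)
  qed (simp add: f0)
  show ?thesis using assms[of i 0 0 j] 1[of i] 2[of j] by simp
qed

text \<open>Extended to the real plane, \<open>f\<close> vanishes on a line, and a strip around a
  line contains infinitely many lattice points.\<close>

lemma additive_int_pair_infinite:
  fixes f :: "int \<Rightarrow> int \<Rightarrow> real"
  assumes "\<And>i j k l. f (i + k) (j + l) = f i j + f k l"
  obtains C where "infinite {(i, j). \<bar>f i j\<bar> \<le> C}"
proof -
  note f = additive_int_pair[of f, OF assms]
  show thesis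
  proof (cases "f 0 1 = 0")
    case True
    have "f 0 j = 0" for j using f[of 0 j] True by simp
    then have "(\<lambda>j. (0, j)) ` UNIV \<subseteq> {(i, j). \<bar>f i j\<bar> \<le> 0}"
      by auto
    moreover have "infinite ((\<lambda>j. (0 :: int, j)) ` (UNIV :: int set))"
      by (metis finite_imageD infinite_UNIV_int inj_onI prod.inject)
    ultimately show thesis using that infinite_super by blast
  next
    case False
    \<comment> \<open>The lattice point in column \<open>i\<close> next to the zero line of
      \<open>f\<close>; rounding costs at most one step of size \<open>f 0 1\<close>.\<close>
    define h where "h i = - \<lfloor>i * f 1 0 / f 0 1\<rfloor>" for i :: int
    have "\<bar>f i (h i)\<bar> \<le> \<bar>f 0 1\<bar>" for i
    proof -
      define x where "x = i * f 1 0 / f 0 1"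
      have "f i (h i) = (x - \<lfloor>x\<rfloor>) * f 0 1"
        using False by (subst f) (simp add: h_def x_def algebra_simps)
      moreover have "\<bar>x - \<lfloor>x\<rfloor>\<bar> \<le> 1" by linarith
      ultimately show ?thesis by (simp add: abs_mult mult_left_le_one_le)
    qed
    then have "(\<lambda>i. (i, h i)) ` UNIV \<subseteq> {(i, j). \<bar>f i j\<bar> \<le> \<bar>f 0 1\<bar>}" by auto
    moreover have "infinite ((\<lambda>i. (i, h i)) ` (UNIV :: int set))"
      by (metis finite_imageD infinite_UNIV_int inj_onI prod.inject)
    ultimately show thesis using that infinite_super by blast
  qed
qed

section \<open>Null frames and the stabiliser of a null line\<close>

lemma vector_4:
  "(vector [a, b, c, d] :: 'a :: zero ^ 4) $ 1 = a" "(vector [a, b, c, d] :: 'a ^ 4) $ 2 = b"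
  "(vector [a, b, c, d] :: 'a ^ 4) $ 3 = c" "(vector [a, b, c, d] :: 'a ^ 4) $ 4 = d"
  by (simp_all add: vector_def)

text \<open>Light-cone coordinates: a hyperbolic pair of null vectors with an orthonormal basis of
  its complement. In such a frame an isometry that preserves the line of \<open>n\<close> is block
  triangular.\<close>

definition null_frame :: "real ^ 4 \<Rightarrow> real ^ 4 \<Rightarrow> real ^ 4 \<Rightarrow> real ^ 4 \<Rightarrow> bool" where
  "null_frame n n' s e \<longleftrightarrow>
     n \<star> n = 0 \<and> n' \<star> n' = 0 \<and> n \<star> n' = - 1 \<and> s \<star> s = 1 \<and> e \<star> e = 1 \<and>
     n \<star> s = 0 \<and> n \<star> e = 0 \<and> n' \<star> s = 0 \<and> n' \<star> e = 0 \<and> s \<star> e = 0"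

lemma null_frame_simps:
  assumes "null_frame n n' s e"
  shows "n \<star> n = 0" "n' \<star> n' = 0" "n \<star> n' = - 1" "s \<star> s = 1" "e \<star> e = 1"
     "n \<star> s = 0" "n \<star> e = 0" "n' \<star> s = 0" "n' \<star> e = 0" "s \<star> e = 0"
     "n' \<star> n = - 1" "s \<star> n = 0" "e \<star> n = 0" "s \<star> n' = 0" "e \<star> n' = 0" "e \<star> s = 0"
  using assms unfolding null_frame_def by (auto simp: lorentz_commute)

text \<open>Taking pairings with the frame is a surjective map between spaces of equal dimension,
  hence injective, so it suffices to compare pairings. The signs and the exchange of
  \<open>n\<close> and \<open>n'\<close> reflect \<open>n \<star> n' = - 1\<close>.\<close>

lemma null_frame_expansion:
  assumes "null_frame n n' s e"
  shows "v = (- (v \<star> n')) *\<^sub>R n + (- (v \<star> n)) *\<^sub>R n' + (v \<star> s) *\<^sub>R s + (v \<star> e) *\<^sub>R e"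
proof -
  note F = null_frame_simps[OF assms]
  define f :: "real ^ 4 \<Rightarrow> real ^ 4" where "f = (\<lambda>x. vector [x \<star> n, x \<star> n', x \<star> s, x \<star> e])"
  have lin: "linear f"
    by (rule linearI) (simp_all add: f_def Finite_Cartesian_Product.vec_eq_iff forall_4 vector_4)
  have "\<exists>x. y = f x" for y
    by (rule exI[of _ "(- (y $ 2)) *\<^sub>R n + (- (y $ 1)) *\<^sub>R n' + (y $ 3) *\<^sub>R s + (y $ 4) *\<^sub>R e"])
      (simp add: f_def Finite_Cartesian_Product.vec_eq_iff forall_4 vector_4 F)
  then have "surj f" by (auto simp: surj_def)
  then have "inj f" using linear_surjective_imp_injective[OF lin] by simp
  moreover have "f v = f ((- (v \<star> n')) *\<^sub>R n + (- (v \<star> n)) *\<^sub>R n' + (v \<star> s) *\<^sub>R s + (v \<star> e) *\<^sub>R e)"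
    by (simp add: f_def F)
  ultimately show ?thesis by (simp add: inj_eq)
qed

lemma null_frame_matrix_eqI:
  fixes X Y :: "real ^ 4 ^ 4"
  assumes "null_frame n n' s e" "X *v n = Y *v n" "X *v n' = Y *v n'" "X *v s = Y *v s" "X *v e = Y *v e"
  shows "X = Y"
proof -
  have "X *v v = Y *v v" for v
    by (subst (1 2) null_frame_expansion[OF assms(1), of v])
      (simp only: matrix_vector_right_distrib matrix_vector_mult_scaleR assms)
  then show ?thesis by (simp add: matrix_eq)
qed

lemma null_frame_exists:
  assumes "n \<star> n = 0" "n' \<star> n' = 0" "n \<star> n' = - 1" "s \<star> n = 0" "s \<star> n' = 0" "s \<star> s = 1"
  obtains e where "null_frame n n' s e"
proof -
  obtain e where e: "e \<noteq> 0" "n \<star> e = 0" "n' \<star> e = 0" "s \<star> e = 0"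
    using orthogonal_vector_exists by blast
  have "(n + n') \<star> (n + n') < 0" using assms by (simp add: lorentz_commute[of n' n])
  then have pos: "e \<star> e > 0" using orthogonal_timelike_pos[of "n + n'" e] e by simp
  have "n \<star> s = 0" "n' \<star> s = 0" using assms lorentz_commute by metis+
  then have "null_frame n n' s ((1 / sqrt (e \<star> e)) *\<^sub>R e)"
    using e pos assms by (simp add: null_frame_def)
  then show thesis using that by blast
qed

lemma spacelike_unit_exists:
  assumes "n \<star> n = 0" "n' \<star> n' = 0" "n \<star> n' = - 1"
  obtains s where "s \<star> n = 0" "s \<star> n' = 0" "s \<star> s = 1"
proof -
  obtain e where e: "e \<noteq> 0" "n \<star> e = 0" "n' \<star> e = 0"
    using orthogonal_vector_exists by blast
  have "(n + n') \<star> (n + n') < 0" using assms by (simp add: lorentz_commute[of n' n])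
  then have pos: "e \<star> e > 0" using orthogonal_timelike_pos[of "n + n'" e] e by simp
  have "e \<star> n = 0" "e \<star> n' = 0" using e lorentz_commute by metis+
  then show thesis
    by (intro that[of "(1 / sqrt (e \<star> e)) *\<^sub>R e"]) (use pos in simp_all)
qed

text \<open>\<open>w\<close> is \<open>n\<close> with its spatial part reversed. The two pair to a
  multiple of the squared time coordinate, which is nonzero for a nonzero null vector.\<close>

lemma opposite_null_exists:
  assumes "n \<star> n = 0" "n \<noteq> 0"
  obtains n' where "n' \<star> n' = 0" "n \<star> n' = - 1"
proof -
  define w :: "real ^ 4" where "w = vector [- n $ 1, - n $ 2, - n $ 3, n $ 4]"
  have 1: "w \<star> w = 0" using assms(1) by (simp add: w_def lorentz_form_def vector_4)
  have 2: "n \<star> w = - 2 * (n $ 4)\<^sup>2" using assms(1)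
    by (simp add: w_def lorentz_form_def vector_4 power2_eq_square)
  have "n \<star> w \<noteq> 0"
  proof
    assume "n \<star> w = 0"
    then have 4: "n $ 4 = 0" using 2 by simp
    then have "(n $ 1)\<^sup>2 + (n $ 2)\<^sup>2 + (n $ 3)\<^sup>2 = 0"
      using assms(1) by (simp add: lorentz_form_def power2_eq_square)
    then have "n $ 1 = 0 \<and> n $ 2 = 0 \<and> n $ 3 = 0" by (simp add: add_nonneg_eq_0_iff)
    then show False using 4 assms(2) by (simp add: Finite_Cartesian_Product.vec_eq_iff forall_4)
  qed
  then show thesis by (intro that[of "(- 1 / (n \<star> w)) *\<^sub>R w"]) (simp_all add: 1)
qed

text \<open>The stabiliser of a null line acts on the line, on the Euclidean plane \<open>n\<^sup>\<perp> / n\<close>, and on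
  the rest by translations.  Commutators of squares act as translations, which commute.\<close>

lemma null_line_stabiliser_metabelian:
  fixes T :: "'h :: group_add \<Rightarrow> real ^ 4 ^ 4" and a b c d :: 'h
  assumes hom: "\<And>u w. T (u + w) = T u ** T w" and T: "\<And>u. T u \<in> O31"
    and n: "n \<star> n = 0" "n \<noteq> 0" and fix_n: "\<And>u. \<exists>\<mu>. T u *v n = \<mu> *\<^sub>R n"
  defines "k \<equiv> ((a + a) + (b + b)) - ((b + b) + (a + a))"
    and "l \<equiv> ((c + c) + (d + d)) - ((d + d) + (c + c))"
  shows "T (k + l) = T (l + k)"
proof -
  obtain n' where n': "n' \<star> n' = 0" "n \<star> n' = - 1" using opposite_null_exists[OF n] by blast
  obtain s where s: "s \<star> n = 0" "s \<star> n' = 0" "s \<star> s = 1"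
    using spacelike_unit_exists[OF n(1) n'] by blast
  obtain e where fr: "null_frame n n' s e"
    using null_frame_exists[OF n(1) n' s] by blast
  note F = null_frame_simps[OF fr]
  obtain f where f: "\<And>u. T u *v n = f u *\<^sub>R n" using fix_n by metis
  have hom': "T (u + w) *v v = T u *v (T w *v v)" for u w v
    by (simp add: hom matrix_vector_mul_assoc)
  have f_add: "f (u + w) = f u * f w" for u w
  proof -
    have "f (u + w) *\<^sub>R n = (f u * f w) *\<^sub>R n"
      unfolding f[symmetric] hom' by (simp add: f matrix_vector_mult_scaleR mult.commute)
    then show ?thesis using n(2) by simp
  qed
  have f0: "f u \<noteq> 0" for u
  proof
    assume "f u = 0"
    then have "T (- u + u) *v n = 0" by (simp only: f f_add) simp
    then have "n \<star> n' = 0" using O31D[OF T, of "- u + u" n n'] by simp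
    then show False using n' by simp
  qed
  have perp: "(T u *v v) \<star> n = 0" if "v \<star> n = 0" for u v
    using O31D[OF T, of u v n] that f0[of u] by (simp add: f)
  \<comment> \<open>\<open>p\<close>, \<open>q\<close>, \<open>r\<close>, \<open>t\<close> are the
    entries of the orthogonal transformation induced on the plane orthogonal to \<open>n\<close>
    modulo \<open>n\<close>; \<open>x\<close> and \<open>y\<close> are the translation part.\<close>
  define p q r t where "p u = (T u *v s) \<star> s" and "q u = (T u *v s) \<star> e"
    and "r u = (T u *v e) \<star> s" and "t u = (T u *v e) \<star> e" for u
  define x y where "x u = - ((T u *v s) \<star> n')" and "y u = - ((T u *v e) \<star> n')" for u
  have Ts: "T u *v s = x u *\<^sub>R n + p u *\<^sub>R s + q u *\<^sub>R e" for u
    using null_frame_expansion[OF fr, of "T u *v s"] perp[of s u] F by (simp add: x_def p_def q_def)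
  have Te: "T u *v e = y u *\<^sub>R n + r u *\<^sub>R s + t u *\<^sub>R e" for u
    using null_frame_expansion[OF fr, of "T u *v e"] perp[of e u] F by (simp add: y_def r_def t_def)
  have orth: "p u * p u + q u * q u = 1" "r u * r u + t u * t u = 1" "p u * r u + q u * t u = 0" for u
  proof -
    show "p u * p u + q u * q u = 1" using O31D[OF T, of u s s] unfolding Ts by (simp add: F)
    show "r u * r u + t u * t u = 1" using O31D[OF T, of u e e] unfolding Te by (simp add: F)
    show "p u * r u + q u * t u = 0" using O31D[OF T, of u s e] unfolding Te Ts by (simp add: F mult.commute)
  qed
  have Tadd: "T (u + w) *v s = (x w * f u) *\<^sub>R n + p w *\<^sub>R (T u *v s) + q w *\<^sub>R (T u *v e)"
    "T (u + w) *v e = (y w * f u) *\<^sub>R n + r w *\<^sub>R (T u *v s) + t w *\<^sub>R (T u *v e)" for u w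
    unfolding hom' Ts[of w] Te[of w] by (simp_all add: matrix_vector_right_distrib matrix_vector_mult_scaleR f)
  have add: "p (u + w) = p w * p u + q w * r u" "q (u + w) = p w * q u + q w * t u"
    "r (u + w) = r w * p u + t w * r u" "t (u + w) = r w * q u + t w * t u" for u w
    unfolding p_def[of "u + w"] q_def[of "u + w"] r_def[of "u + w"] t_def[of "u + w"] Tadd
    by (simp_all only: lorentz_simps Ts Te F) simp_all
  \<comment> \<open>An orthogonal transformation of the plane is a rotation or a reflection, and the
    square of either is a rotation. This is why the commutators are formed from squares.\<close>
  have square: "t (u + u) = p (u + u) \<and> r (u + u) = - q (u + u)" for u
  proof -
    have "(p u = t u \<and> q u = - r u) \<or> (p u = - t u \<and> q u = r u)"
    proof -
      \<comment> \<open>Multiplying by the unit lengths makes all terms homogeneous of degree 4, and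
        then the orthogonality relation \<open>p u * r u + q u * t u\<close> factors out.\<close>
      have "p u * p u - t u * t u = p u * p u * (r u * r u + t u * t u) - t u * t u * (p u * p u + q u * q u)"
        using orth[of u] by simp
      also have "\<dots> = (p u * r u - q u * t u) * (p u * r u + q u * t u)" by (simp add: algebra_simps)
      finally have "(p u - t u) * (p u + t u) = 0" using orth(3) by (simp add: algebra_simps)
      moreover have "q u * q u - r u * r u = q u * q u * (r u * r u + t u * t u) - r u * r u * (p u * p u + q u * q u)"
        using orth[of u] by simp
      then have "q u * q u - r u * r u = (q u * t u - p u * r u) * (p u * r u + q u * t u)" by (simp add: algebra_simps)
      then have "(q u - r u) * (q u + r u) = 0" using orth(3) by (simp add: algebra_simps)
      moreover have "p u * q u + t u * r u = p u * q u * (r u * r u + t u * t u) + t u * r u * (p u * p u + q u * q u)"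
        using orth[of u] by simp
      then have "p u * q u + t u * r u = (q u * r u + p u * t u) * (p u * r u + q u * t u)" by (simp add: algebra_simps)
      then have "(p u - t u) * (q u - r u) = 0" "(p u + t u) * (q u + r u) = 0"
        using orth(3)[of u] by (simp_all add: algebra_simps)
      ultimately show ?thesis by (auto simp: eq_neg_iff_add_eq_0)
    qed
    then show ?thesis
    proof
      assume "p u = t u \<and> q u = - r u"
      then have "p u = t u" "q u = - r u" by auto
      then show ?thesis unfolding add[of u u] by simp
    next
      assume "p u = - t u \<and> q u = r u"
      then have "p u = - t u" "q u = r u" by auto
      then show ?thesis unfolding add[of u u] by simp
    qed
  qed
  \<comment> \<open>Rotations of the plane commute, and so do the scalars on the null line; hence a
    commutator of squares is trivial on both.\<close>
  have trivial: "f g = 1 \<and> p g = 1 \<and> q g = 0 \<and> r g = 0 \<and> t g = 1"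
    if g: "g = ((a + a) + (b + b)) - ((b + b) + (a + a))" for g a b
  proof -
    let ?u = "a + a" and ?w = "b + b"
    have eq: "?u + ?w = g + (?w + ?u)" by (simp add: g)
    have rot: "p (u + w) = p (w + u) \<and> q (u + w) = q (w + u) \<and> r (u + w) = r (w + u) \<and>
        t (u + w) = t (w + u) \<and> t (w + u) = p (w + u) \<and> r (w + u) = - q (w + u)"
      if "t u = p u \<and> r u = - q u" "t w = p w \<and> r w = - q w" for u w
      unfolding add[of u w] add[of w u] using that by (simp add: mult.commute)
    note rot = rot[OF square[of a] square[of b]]
    define P Q where "P = p (?w + ?u)" and "Q = q (?w + ?u)"
    have 0: "p (?u + ?w) = P" "q (?u + ?w) = Q" "r (?u + ?w) = - Q" "t (?u + ?w) = P"
      "p (?w + ?u) = P" "q (?w + ?u) = Q" "r (?w + ?u) = - Q" "t (?w + ?u) = P"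
      using rot by (simp_all add: P_def Q_def del: add.assoc)
    have 1: "P = P * p g + Q * r g" "Q = P * q g + Q * t g" "- Q = - Q * p g + P * r g" "P = - Q * q g + P * t g"
      using add[of g "?w + ?u", folded eq] unfolding 0 by blast+
    have 2: "P * P + Q * Q = 1" using orth(1) unfolding P_def Q_def by blast
    \<comment> \<open>The four equations in \<open>1\<close> are solved for the entries of
      \<open>g\<close> by multiplying with the inverse of the rotation \<open>(P, Q)\<close>, which
      is its transpose.\<close>
    have "P * P + Q * Q = P * (P * p g + Q * r g) + - Q * (- Q * p g + P * r g)"
      unfolding 1(1,3)[symmetric] by simp
    also have "\<dots> = (P * P + Q * Q) * p g" by (simp add: algebra_simps)
    finally have "p g = 1" using 2 by simp
    have "Q * P - P * Q = Q * (P * p g + Q * r g) + P * (- Q * p g + P * r g)"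
      unfolding 1(1,3)[symmetric] by simp
    also have "\<dots> = (P * P + Q * Q) * r g" by (simp add: algebra_simps)
    finally have "r g = 0" using 2 by simp
    have "P * Q - Q * P = P * (P * q g + Q * t g) + - Q * (- Q * q g + P * t g)"
      unfolding 1(2,4)[symmetric] by simp
    also have "\<dots> = (P * P + Q * Q) * q g" by (simp add: algebra_simps)
    finally have "q g = 0" using 2 by simp
    have "P * P + Q * Q = Q * (P * q g + Q * t g) + P * (- Q * q g + P * t g)"
      unfolding 1(2,4)[symmetric] by simp
    also have "\<dots> = (P * P + Q * Q) * t g" by (simp add: algebra_simps)
    finally have "t g = 1" using 2 by simp
    note \<open>p g = 1\<close> \<open>q g = 0\<close> \<open>r g = 0\<close> \<open>t g = 1\<close>
    moreover have "f g = 1" using f_add[of g "?w + ?u", folded eq] f_add[of ?u ?w] f_add[of ?w ?u] f0[of "?w + ?u"]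
      by simp
    ultimately show ?thesis by simp
  qed
  define z where "z u = - ((T u *v n') \<star> n')" for u
  \<comment> \<open>For such elements the isometry property forces the components along
    \<open>s\<close> and \<open>e\<close> to be the translation part again. A product of two of them
    then depends symmetrically on the factors.\<close>
  have Tn': "T u *v n' = z u *\<^sub>R n + n' + x u *\<^sub>R s + y u *\<^sub>R e"
    if u: "f u = 1 \<and> p u = 1 \<and> q u = 0 \<and> r u = 0 \<and> t u = 1" for u
  proof -
    have n1: "(T u *v n') \<star> n = - 1" using O31D[OF T, of u n' n] u F by (simp add: f)
    have "(T u *v n') \<star> s = x u" using O31D[OF T, of u n' s] u n1 F by (simp add: Ts)
    moreover have "(T u *v n') \<star> e = y u" using O31D[OF T, of u n' e] u n1 F by (simp add: Te)
    ultimately show ?thesis using null_frame_expansion[OF fr, of "T u *v n'"] n1 by (simp add: z_def)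
  qed
  note K = trivial[OF k_def[THEN meta_eq_to_obj_eq]] and L = trivial[OF l_def[THEN meta_eq_to_obj_eq]]
  show ?thesis
    unfolding hom
    by (rule null_frame_matrix_eqI[OF fr])
      (simp_all add: f Ts Te Tn'[OF K] Tn'[OF L] K L matrix_vector_right_distrib matrix_vector_mult_scaleR algebra_simps
        flip: matrix_vector_mul_assoc)
qed

section \<open>Matrices commuting with the fiber\<close>

lemma norm_triangle_4:
  fixes u v w x :: "'a :: real_normed_vector"
  shows "norm (u + v + w + x) \<le> norm u + norm v + norm w + norm x"
  using norm_triangle_ineq[of "u + v + w" x] norm_triangle_ineq[of "u + v" w] norm_triangle_ineq[of u v]
  by linarith

text \<open>\<open>T\<close> stands for the fiber, \<open>D\<close> for the peripheral subgroup, and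
  \<open>c\<close> for the boundary curve, which lies in both. A null vector \<open>n\<close> whose
  line is fixed by \<open>D\<close> is an eigenvector of \<open>X\<close>, so \<open>X\<close> is a
  scalar on the span \<open>U\<close> of the orbit of \<open>n\<close> under \<open>T\<close>; the
  work is to show that \<open>U\<close> is everything. The elements \<open>k\<close> and
  \<open>l\<close> witness that \<open>T\<close> does not fix the line of \<open>n\<close>.\<close>

lemma commutant_scalar:
  fixes T :: "'h :: group_add \<Rightarrow> real ^ 4 ^ 4" and D :: "int \<Rightarrow> int \<Rightarrow> real ^ 4 ^ 4"
  assumes T_add: "\<And>u w. T (u + w) = T u ** T w" and T: "\<And>u. T u \<in> O31"
    and D_add: "\<And>i j k l. D (i + k) (j + l) = D i j ** D k l" and D: "\<And>i j. D i j \<in> O31"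
    and Tc: "T c = D 1 0"
    and normal: "\<And>i j u. \<exists>w. D i j ** T u = T w ** D i j"
    and fin: "\<And>C. finite {(i, j). norm (D i j) \<le> C}"
    and k: "k = ((a + a) + (b + b)) - ((b + b) + (a + a))"
    and l: "l = ((a' + a') + (b' + b')) - ((b' + b') + (a' + a'))"
    and kl: "T (k + l) \<noteq> T (l + k)"
    and comm: "\<And>u. X ** T u = T u ** X"
  shows "\<exists>\<mu>. X = \<mu> *\<^sub>R Finite_Cartesian_Product.mat 1"
proof -
  \<comment> \<open>The factor \<open>q\<close> passes to a sublattice: signs are removed by
    squaring, so that norms get controlled on multiples of 4 only.\<close>
  have unbounded: False
    if add: "\<And>i j k l. f (i + k) (j + l) = f i j + f k l" and "q \<noteq> 0"
      and bd: "\<And>C. \<exists>K. \<forall>i j. \<bar>f i j\<bar> \<le> C \<longrightarrow> norm (D (q * i) (q * j)) \<le> K"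
    for f :: "int \<Rightarrow> int \<Rightarrow> real" and q
  proof -
    obtain C where C: "infinite {(i, j). \<bar>f i j\<bar> \<le> C}" using additive_int_pair_infinite[of f] add by blast
    obtain K where K: "\<And>i j. \<bar>f i j\<bar> \<le> C \<Longrightarrow> norm (D (q * i) (q * j)) \<le> K" using bd[of C] by blast
    have "inj_on (\<lambda>(i, j). (q * i, q * j)) {(i, j). \<bar>f i j\<bar> \<le> C}"
      using \<open>q \<noteq> 0\<close> by (auto simp: inj_on_def)
    then have "infinite ((\<lambda>(i, j). (q * i, q * j)) ` {(i, j). \<bar>f i j\<bar> \<le> C})"
      using C finite_imageD by blast
    moreover have "(\<lambda>(i, j). (q * i, q * j)) ` {(i, j). \<bar>f i j\<bar> \<le> C} \<subseteq> {(i, j). norm (D i j) \<le> K}"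
      using K by auto
    ultimately show False using fin finite_subset by blast
  qed
  have D_mult: "D (i + k) (j + l) *v v = D i j *v (D k l *v v)" for i j k l v
    by (simp add: D_add matrix_vector_mul_assoc)
  have T_mult: "T (u + w) *v v = T u *v (T w *v v)" for u w v
    by (simp add: T_add matrix_vector_mul_assoc)
  have inj: "v = w" if "g \<in> O31" "g *v v = g *v w" for g v w
    using that O31_invertible[of g] by (metis invertible_matrix_inv(2) matrix_vector_mul_assoc matrix_vector_mul_lid)
  have T0: "T 0 *v v = v" for v
    using T_mult[of 0 0 v] inj[OF T[of 0], of "T 0 *v v" v] by simp
  \<comment> \<open>Positive powers of the boundary curve: they come from the fiber, so
    \<open>X\<close> commutes with them, and all of \<open>D\<close> commutes with them as
    well.\<close>
  define S where "S k = D (1 + int k) 0" for k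
  have "finite {k. norm (S k) \<le> C}" for C
  proof -
    have "(\<lambda>k. (1 + int k, 0 :: int)) ` {k. norm (S k) \<le> C} \<subseteq> {(i, j). norm (D i j) \<le> C}"
      by (auto simp: S_def)
    then have "finite ((\<lambda>k. (1 + int k, 0 :: int)) ` {k. norm (S k) \<le> C})" using fin finite_subset by blast
    then show ?thesis by (rule finite_imageD) (auto simp: inj_on_def)
  qed
  moreover have "S k \<in> O31" for k by (simp add: S_def D)
  ultimately obtain n m where nm: "n \<noteq> 0" "m \<noteq> 0" "n \<star> n = 0" "m \<star> m = 0"
    and S1: "\<And>X. (\<And>k. X ** S k = S k ** X) \<Longrightarrow> \<exists>\<mu>. X *v n = \<mu> *\<^sub>R n"
    and S2: "\<And>g \<mu>. (\<And>k. g ** S k = S k ** g) \<Longrightarrow> g \<in> O31 \<Longrightarrow> g *v n = \<mu> *\<^sub>R n \<Longrightarrow> \<mu> *\<^sub>R (g *v m) = m"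
    using unbounded_sequence_null_vectors[of S] by metis
  have SD: "D i j ** S k = S k ** D i j" for i j k
    unfolding S_def D_add[symmetric] by (simp add: add.commute)
  have SX: "X ** S k = S k ** X" for k
  proof (induction k)
    case 0 then show ?case using comm[of c] by (simp add: S_def Tc)
  next
    case (Suc k)
    have "S (Suc k) = S k ** D 1 0" unfolding S_def D_add[symmetric] by (simp add: add.commute)
    then show ?case using Suc comm[of c] by (metis Tc matrix_mul_assoc)
  qed
  obtain \<mu> where \<mu>: "X *v n = \<mu> *\<^sub>R n" using S1 SX by blast
  have "\<exists>\<mu>. D i j *v n = \<mu> *\<^sub>R n" for i j using S1 SD by blast
  then obtain f where f: "\<And>i j. D i j *v n = f i j *\<^sub>R n" by metis
  have fm: "f i j *\<^sub>R (D i j *v m) = m" for i j using S2[OF SD D f] .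
  have f0: "f i j \<noteq> 0" for i j using fm[of i j] nm(2) by auto
  have f_add: "f (i + k) (j + l) = f i j * f k l" for i j k l
  proof -
    have "f (i + k) (j + l) *\<^sub>R n = (f i j * f k l) *\<^sub>R n"
      unfolding f[symmetric] D_mult by (simp add: f matrix_vector_mult_scaleR mult.commute)
    then show ?thesis using nm(1) by simp
  qed
  \<comment> \<open>Otherwise \<open>D\<close> scales \<open>n\<close> and \<open>m\<close> by
    reciprocal factors, as along the axis of a hyperbolic isometry. The logarithm of the factor is
    then an additive parameter that controls the norm.\<close>
  have "n \<star> m = 0"
  proof (rule ccontr)
    assume nm0: "n \<star> m \<noteq> 0"
    \<comment> \<open>With this \<open>r\<close> the vector \<open>u\<close> below satisfies
      \<open>u \<star> u = - 2\<close>.\<close>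
    define r where "r = - 1 / (n \<star> m)"
    define u where "u = n + r *\<^sub>R m"
    have "u \<star> u < 0" using nm nm0 by (simp add: u_def r_def lorentz_commute[of m n])
    then obtain K where K: "\<And>g. g \<in> O31 \<Longrightarrow> norm g \<le> K * norm (g *v u)" using O31_norm_bound by blast
    show False
    proof (rule unbounded[of "\<lambda>i j. ln \<bar>f i j\<bar>" 1])
      show "ln \<bar>f (i + k) (j + l)\<bar> = ln \<bar>f i j\<bar> + ln \<bar>f k l\<bar>" for i j k l
        using f0 by (simp add: f_add abs_mult ln_mult)
      fix C
      have "norm (D i j) \<le> \<bar>K\<bar> * (exp C * norm n + exp C * (\<bar>r\<bar> * norm m))" if C: "\<bar>ln \<bar>f i j\<bar>\<bar> \<le> C" for i j
      proof -
        have "ln \<bar>f i j\<bar> \<le> C" "- ln \<bar>f i j\<bar> \<le> C" using C by auto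
        then have 1: "\<bar>f i j\<bar> \<le> exp C" "1 / \<bar>f i j\<bar> \<le> exp C" using f0[of i j]
          by (metis exp_le_cancel_iff exp_ln zero_less_abs_iff)
            (metis \<open>- ln \<bar>f i j\<bar> \<le> C\<close> exp_le_cancel_iff exp_ln zero_less_abs_iff exp_minus inverse_eq_divide f0)
        have "D i j *v m = (1 / f i j) *\<^sub>R m"
          using arg_cong[OF fm[of i j], of "\<lambda>v. (1 / f i j) *\<^sub>R v"] f0[of i j] by simp
        then have "D i j *v u = f i j *\<^sub>R n + (1 / f i j) *\<^sub>R (r *\<^sub>R m)"
          by (simp add: u_def matrix_vector_right_distrib matrix_vector_mult_scaleR f)
        then have "norm (D i j *v u) \<le> norm (f i j *\<^sub>R n) + norm ((1 / f i j) *\<^sub>R (r *\<^sub>R m))"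
          by (simp only: norm_triangle_ineq)
        also have "\<dots> = \<bar>f i j\<bar> * norm n + (1 / \<bar>f i j\<bar>) * (\<bar>r\<bar> * norm m)" by simp
        also have "\<dots> \<le> exp C * norm n + exp C * (\<bar>r\<bar> * norm m)"
          by (intro add_mono mult_right_mono 1) auto
        finally have "norm (D i j *v u) \<le> exp C * norm n + exp C * (\<bar>r\<bar> * norm m)" .
        moreover have "norm (D i j) \<le> \<bar>K\<bar> * norm (D i j *v u)"
          using K[OF D, of i j] by (meson abs_ge_self mult_right_mono norm_ge_zero order_trans)
        ultimately show ?thesis by (meson abs_ge_zero mult_left_mono order_trans)
      qed
      then show "\<exists>K. \<forall>i j. \<bar>ln \<bar>f i j\<bar>\<bar> \<le> C \<longrightarrow> norm (D (1 * i) (1 * j)) \<le> K" by auto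
    qed simp
  qed
  then obtain r where r: "m = r *\<^sub>R n" using null_orthogonal_imp_parallel nm by blast
  have ff: "f i j * f i j = 1" for i j
    using fm[of i j] nm(1,2) unfolding r by (simp add: matrix_vector_mult_scaleR f)
  \<comment> \<open>If the whole fiber fixed the line of \<open>n\<close>, the commutators of
    squares \<open>k\<close> and \<open>l\<close> would have commuting images.\<close>
  obtain h where h: "\<And>\<mu>. T h *v n \<noteq> \<mu> *\<^sub>R n"
    using null_line_stabiliser_metabelian[of T n a b a' b', OF T_add T nm(3,1)] kl unfolding k l by blast
  define r' where "r' = n \<star> (T h *v n)"
  have r': "r' \<noteq> 0"
    using null_orthogonal_imp_parallel[of n "T h *v n"] nm O31D[OF T] h by (auto simp: r'_def)
  define n' where "n' = (- 1 / r') *\<^sub>R (T h *v n)"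
  have "(T h *v n) \<star> (T h *v n) = 0" using O31D[OF T] nm by metis
  then have n': "n' \<star> n' = 0" "n \<star> n' = - 1" using r' unfolding n'_def by (simp_all add: r'_def[symmetric])
  define U where "U = span (range (\<lambda>u. T u *v n))"
  have "T 0 *v n \<in> U" unfolding U_def by (intro span_base rangeI)
  then have nU: "n \<in> U" unfolding T0 .
  have n'U: "n' \<in> U" unfolding n'_def U_def by (intro span_scale span_base rangeI)
  \<comment> \<open>\<open>D\<close> normalises the image of \<open>T\<close> and fixes the line of
    \<open>n\<close>, hence maps the lines of the orbit to lines of the orbit.\<close>
  have DU: "D i j *v v \<in> U" if "v \<in> U" for i j v
    using that unfolding U_def
  proof (induction rule: span_induct_alt)
    case base then show ?case by (simp add: span_zero)
  next
    case (step r x y)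
    then obtain u where u: "x = T u *v n" by blast
    obtain w where w: "D i j ** T u = T w ** D i j" using normal by blast
    have "D i j *v x = T w *v (D i j *v n)" by (simp add: u w matrix_vector_mul_assoc)
    then have "D i j *v x = f i j *\<^sub>R (T w *v n)" by (simp add: f matrix_vector_mult_scaleR)
    then have "D i j *v x \<in> span (range (\<lambda>u. T u *v n))" by (auto intro: span_scale span_base)
    then show ?case using step by (simp add: matrix_vector_right_distrib matrix_vector_mult_scaleR span_add span_scale)
  qed
  have XU: "X *v v = \<mu> *\<^sub>R v" if "v \<in> U" for v
    using that unfolding U_def
  proof (induction rule: span_induct_alt)
    case (step r x y)
    then obtain u where u: "x = T u *v n" by blast
    have "X *v x = T u *v (X *v n)" by (simp add: u comm matrix_vector_mul_assoc)
    then have "X *v x = \<mu> *\<^sub>R x" by (simp add: \<mu> u matrix_vector_mult_scaleR)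
    then show ?case using step by (simp add: matrix_vector_right_distrib matrix_vector_mult_scaleR algebra_simps)
  qed simp
  have "U = UNIV"
  proof (rule ccontr)
    assume "U \<noteq> UNIV"
    then obtain y where y: "y \<noteq> 0" "\<And>x. x \<in> U \<Longrightarrow> y \<bullet> x = 0"
      using span_not_UNIV_orthogonal[of "range (\<lambda>u. T u *v n)"] unfolding U_def by blast
    \<comment> \<open>Changing the sign of the time coordinate turns Euclidean into Lorentz
      orthogonality.\<close>
    define s0 :: "real ^ 4" where "s0 = vector [y $ 1, y $ 2, y $ 3, - y $ 4]"
    have s0: "s0 \<star> x = 0" if "x \<in> U" for x
      using y(2)[OF that] by (simp add: s0_def lorentz_form_def vector_4 inner_vec_def sum_4)
    have "s0 \<noteq> 0"
      using y(1) by (simp add: s0_def Finite_Cartesian_Product.vec_eq_iff forall_4 vector_4)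
    moreover have "(n + n') \<star> (n + n') < 0" using n' nm by (simp add: lorentz_commute[of n' n])
    moreover have "(n + n') \<star> s0 = 0" using s0[OF nU] s0[OF n'U] by (simp add: lorentz_commute)
    ultimately have pos: "s0 \<star> s0 > 0" using orthogonal_timelike_pos by blast
    define s where "s = (1 / sqrt (s0 \<star> s0)) *\<^sub>R s0"
    have s: "s \<star> s = 1" "\<And>x. x \<in> U \<Longrightarrow> s \<star> x = 0" using pos s0 by (auto simp: s_def)
    obtain e where fr: "null_frame n n' s e"
      using null_frame_exists[OF nm(3) n' s(2)[OF nU] s(2)[OF n'U] s(1)] by blast
    note F = null_frame_simps[OF fr]
    \<comment> \<open>On doubled indices the eigenvalue of \<open>n\<close> is
      \<open>f i j * f i j = 1\<close>, so \<open>n\<close> itself is fixed.\<close>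
    define E where "E i j = D (2 * i) (2 * j)" for i j
    have E_mult: "E (i + k) (j + l) *v v = E i j *v (E k l *v v)" for i j k l v
      by (simp add: E_def D_mult[symmetric] distrib_left)
    have EO: "E i j \<in> O31" for i j by (simp add: E_def D)
    have En: "E i j *v n = n" for i j
      using f_add[of i i j j] ff[of i j] by (simp add: E_def f flip: mult_2)
    define x t where "x i j = - ((E i j *v n') \<star> n')" and "t i j = (E i j *v n') \<star> e" for i j
    define z b where "z i j = - ((E i j *v e) \<star> n')" and "b i j = (E i j *v e) \<star> s" for i j
    define \<epsilon> where "\<epsilon> i j = (E i j *v e) \<star> e" for i j
    have En': "E i j *v n' = x i j *\<^sub>R n + n' + t i j *\<^sub>R e" for i j
    proof -
      have "(E i j *v n') \<star> s = 0" using s(2)[OF DU[OF n'U]] by (simp add: E_def lorentz_commute)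
      moreover have "(E i j *v n') \<star> n = - 1" using O31D[OF EO, of i j n' n] by (simp add: En F)
      ultimately show ?thesis using null_frame_expansion[OF fr, of "E i j *v n'"] by (simp add: x_def t_def)
    qed
    have xt: "2 * x i j = t i j * t i j" for i j
      using O31D[OF EO, of i j n' n'] unfolding En' by (simp add: F)
    have Ee: "E i j *v e = z i j *\<^sub>R n + b i j *\<^sub>R s + \<epsilon> i j *\<^sub>R e" for i j
    proof -
      have "(E i j *v e) \<star> n = 0" using O31D[OF EO, of i j e n] by (simp add: En F)
      then show ?thesis using null_frame_expansion[OF fr, of "E i j *v e"] by (simp add: z_def b_def \<epsilon>_def)
    qed
    have b\<epsilon>: "b i j * b i j + \<epsilon> i j * \<epsilon> i j = 1" for i j
      using O31D[OF EO, of i j e e] unfolding Ee by (simp add: F)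
    have E2: "E (i + k) (j + l) *v n' = x k l *\<^sub>R n + (E i j *v n') + t k l *\<^sub>R (E i j *v e)" for i j k l
      unfolding E_mult En'[of k l] by (simp add: matrix_vector_right_distrib matrix_vector_mult_scaleR En)
    have t_add: "t (i + k) (j + l) = t i j + t k l * \<epsilon> i j" for i j k l
      unfolding t_def[of "i + k" "j + l"] E2 by (simp add: F En' Ee)
    \<comment> \<open>\<open>E\<close> preserves \<open>U\<close>, whose elements have no component
      along \<open>s\<close>.\<close>
    have tb: "t k l * b i j = 0" for i j k l
    proof -
      have "(E (i + k) (j + l) *v n') \<star> s = t k l * b i j" unfolding E2 by (simp add: F En' Ee)
      then show ?thesis unfolding En' by (simp add: F)
    qed
    \<comment> \<open>If \<open>t\<close> does not vanish identically, all \<open>b\<close> are zero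
      and \<open>\<epsilon>\<close> is a sign. Doubling once more makes the sign 1 and
      \<open>t\<close> additive.\<close>
    have add: "t (2 * (i + k)) (2 * (j + l)) = t (2 * i) (2 * j) + t (2 * k) (2 * l)" for i j k l
    proof (cases "\<forall>i j. t i j = 0")
      case False
      then have b0: "b i j = 0" for i j using tb by (metis mult_eq_0_iff)
      have "E (i + i) (j + j) *v e = E i j *v (z i j *\<^sub>R n + \<epsilon> i j *\<^sub>R e)"
        unfolding E_mult Ee[of i j] by (simp add: b0)
      also have "\<dots> \<star> e = 1"
        using b\<epsilon>[of i j] by (simp add: b0 F Ee En matrix_vector_right_distrib matrix_vector_mult_scaleR)
      finally have "\<epsilon> (2 * i) (2 * j) = 1" by (simp add: \<epsilon>_def flip: mult_2)
      then show ?thesis using t_add[of "2 * i" "2 * k" "2 * j" "2 * l"] by (simp add: distrib_left)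
    qed simp
    obtain K where K: "\<And>g. g \<in> O31 \<Longrightarrow> norm g \<le> K * norm (g *v (n + n'))"
      using O31_norm_bound \<open>(n + n') \<star> (n + n') < 0\<close> by blast
    show False
    proof (rule unbounded[of "\<lambda>i j. t (2 * i) (2 * j)" 4])
      fix C
      have "norm (D (4 * i) (4 * j)) \<le> \<bar>K\<bar> * (norm n + (C * C / 2) * norm n + norm n' + C * norm e)"
        if C: "\<bar>t (2 * i) (2 * j)\<bar> \<le> C" for i j
      proof -
        define \<tau> where "\<tau> = t (2 * i) (2 * j)"
        have \<tau>: "\<bar>\<tau>\<bar> \<le> C" using C by (simp add: \<tau>_def)
        \<comment> \<open>A parabolic isometry moves the timelike vector \<open>n + n'\<close> by an
          amount that is quadratic in the translation \<open>\<tau>\<close>, so a bound on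
          \<open>\<tau>\<close> bounds the norm.\<close>
        have "D (4 * i) (4 * j) *v (n + n') = n + (\<tau> * \<tau> / 2) *\<^sub>R n + n' + \<tau> *\<^sub>R e"
        proof -
          have "D (4 * i) (4 * j) = E (2 * i) (2 * j)" by (simp add: E_def)
          moreover have "x (2 * i) (2 * j) = \<tau> * \<tau> / 2" using xt[of "2 * i" "2 * j"] by (simp add: \<tau>_def)
          ultimately show ?thesis
            by (simp only: matrix_vector_right_distrib En En' \<tau>_def[symmetric] add.assoc)
        qed
        then have "norm (D (4 * i) (4 * j) *v (n + n')) \<le>
            norm n + norm ((\<tau> * \<tau> / 2) *\<^sub>R n) + norm n' + norm (\<tau> *\<^sub>R e)"
          by (simp only: norm_triangle_4)
        also have "\<dots> = norm n + (\<bar>\<tau>\<bar> * \<bar>\<tau>\<bar> / 2) * norm n + norm n' + \<bar>\<tau>\<bar> * norm e"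
          by (simp add: abs_mult)
        also have "\<dots> \<le> norm n + (C * C / 2) * norm n + norm n' + C * norm e"
          using \<tau> by (intro add_mono mult_right_mono divide_right_mono mult_mono) auto
        finally have "norm (D (4 * i) (4 * j) *v (n + n')) \<le> norm n + (C * C / 2) * norm n + norm n' + C * norm e" .
        moreover have "norm (D (4 * i) (4 * j)) \<le> \<bar>K\<bar> * norm (D (4 * i) (4 * j) *v (n + n'))"
          using K[OF D] by (meson abs_ge_self mult_right_mono norm_ge_zero order_trans)
        ultimately show ?thesis by (meson abs_ge_zero mult_left_mono order_trans)
      qed
      then show "\<exists>K. \<forall>i j. \<bar>t (2 * i) (2 * j)\<bar> \<le> C \<longrightarrow> norm (D (4 * i) (4 * j)) \<le> K" by blast
    qed (use add in simp_all)
  qed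
  then have "X *v v = (\<mu> *\<^sub>R Finite_Cartesian_Product.mat 1) *v v" for v
    using XU by (simp flip: scaleR_matrix_vector_assoc)
  then show ?thesis using matrix_eq by blast
qed

section \<open>Free groups and the group of the bundle\<close>

lemma free_group_induct [case_names zero add]:
  assumes "P 0" "\<And>l u. P u \<Longrightarrow> P (letter_val l + u)"
  shows "P u"
proof -
  have "P (sum_list (map letter_val w))" for w
    by (induction w) (auto intro: assms)
  then show ?thesis using sum_letter_val_word by metis
qed

lemma group_free_group: "group \<F>"
  by (rule groupI) (auto simp: free_group_monoid_def add.assoc intro: left_minus)

lemma free_group_monoid_simps [simp]:
  "carrier \<F> = UNIV" "mult \<F> = (+)" "one \<F> = 0"
  by (auto simp: free_group_monoid_def)

lemma inv_free_group [simp]: "inv\<^bsub>\<F>\<^esub> u = - u"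
  by (rule group.inv_equality[OF group_free_group]) auto

text \<open>The universal property of the free group. It is applied with \<Gamma>, with a free group
  and with a group of permutations as target.\<close>

locale group_assignment = group G for G (structure) and v :: "'i \<Rightarrow> 'a" +
  assumes range: "range v \<subseteq> carrier G"
begin

lemma assignment_closed [simp]: "v i \<in> carrier G"
  using range by auto

abbreviation "letter_eval \<equiv> \<lambda>(i, positive). if positive then v i else inv v i"

lemma letter_eval_closed: "letter_eval l \<in> carrier G"
  by (cases l) auto

definition "word_eval w = foldr (\<lambda>l y. letter_eval l \<otimes> y) w \<one>"

lemma word_eval_closed: "word_eval w \<in> carrier G"
  unfolding word_eval_def by (induction w) (auto simp: letter_eval_closed split: prod.split)

lemma word_eval_Cons: "word_eval (l # w) = letter_eval l \<otimes> word_eval w"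
  by (simp add: word_eval_def)

lemma free_eval_word_eval: "free_eval G v u = word_eval (word u)"
  unfolding free_eval_def word_eval_def by (rule arg_cong[where f = "\<lambda>f. foldr f (word u) \<one>"]) auto

lemma word_eval_push: "word_eval (push l w) = letter_eval l \<otimes> word_eval w"
proof (cases w)
  case (Cons m w')
  have "letter_eval l \<otimes> (letter_eval (letter_inv l) \<otimes> word_eval w') = word_eval w'"
    using word_eval_closed[of w'] by (cases l) (auto simp: letter_inv_def simp flip: m_assoc)
  then show ?thesis using Cons by (auto simp: word_eval_Cons)
qed (simp add: word_eval_Cons)

lemma free_eval_closed [simp]: "free_eval G v u \<in> carrier G"
  by (simp add: free_eval_word_eval word_eval_closed)

lemma free_eval_zero [simp]: "free_eval G v 0 = \<one>"
  by (simp add: free_eval_def zero_free_group.rep_eq)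

lemma free_eval_add: "free_eval G v (u + w) = free_eval G v u \<otimes> free_eval G v w"
proof -
  have "word_eval (foldr push u w) = word_eval u \<otimes> word_eval w" for u w
    by (induction u) (auto simp: word_eval_push word_eval_Cons word_eval_closed letter_eval_closed m_assoc
        simp: word_eval_def[of "[]"])
  then show ?thesis by (simp add: free_eval_word_eval plus_free_group.rep_eq)
qed

lemma free_eval_gen [simp]: "free_eval G v (gen i) = v i"
  by (simp add: free_eval_def gen.rep_eq)

lemma free_eval_minus: "free_eval G v (- u) = inv (free_eval G v u)"
  by (rule inv_equality[symmetric]) (simp_all flip: free_eval_add)

lemma free_eval_hom: "free_eval G v \<in> hom \<F> G"
  by (auto simp: hom_def free_eval_add)

lemma free_eval_unique:
  assumes "\<And>u w. f (u + w) = f u \<otimes> f w" "\<And>u. f u \<in> carrier G" "\<And>i. f (gen i) = v i"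
  shows "f u = free_eval G v u"
proof (induction u rule: free_group_induct)
  case zero
  have "f 0 \<otimes> f 0 = f 0" using assms(1)[of 0 0] by simp
  then show ?case using assms(2) by (simp add: l_cancel_one)
next
  case (add l u)
  have f0: "f 0 = \<one>" using assms(1)[of 0 0] assms(2) by (metis add.right_neutral l_cancel_one)
  have "f (- gen i) \<otimes> f (gen i) = \<one>" for i using assms(1)[of "- gen i" "gen i"] f0 by simp
  then have "f (- gen i) = free_eval G v (- gen i)" for i
    using assms inv_equality by (metis assignment_closed free_eval_gen free_eval_minus)
  then have "f (letter_val l) = free_eval G v (letter_val l)"
    using assms(3) by (cases l) (auto simp: letter_val_def)
  then show ?case using add by (simp add: assms(1) free_eval_add)
qed

lemma generate_range: "generate G (range v) = range (free_eval G v)"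
proof
  have "subgroup (range (free_eval G v)) G"
    by (rule subgroupI) (auto simp flip: free_eval_add free_eval_minus)
  then show "generate G (range v) \<subseteq> range (free_eval G v)"
    by (rule generate_subgroup_incl[rotated]) (metis free_eval_gen image_subsetI rangeI)
  have "free_eval G v u \<in> generate G (range v)" for u
  proof (induction u rule: free_group_induct)
    case (add l u)
    have "free_eval G v (letter_val l) \<in> generate G (range v)"
      by (auto simp: letter_val_def free_eval_minus intro: generate.incl generate.inv)
    then show ?case using add by (simp add: free_eval_add generate.eng)
  qed (simp add: generate.one)
  then show "range (free_eval G v) \<subseteq> generate G (range v)" by auto
qed

end

section \<open>The group of the bundle and the freeness of its fiber\<close>

definition permutation_group :: "('a \<Rightarrow> 'a) monoid" where
  "permutation_group = \<lparr>carrier = {f. bij f}, mult = (\<circ>), one = id\<rparr>"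

lemma group_permutation_group: "group permutation_group"
proof (rule groupI)
  fix f :: "'a \<Rightarrow> 'a" assume "f \<in> carrier permutation_group"
  then have "bij (inv_into UNIV f)" "inv_into UNIV f \<circ> f = id"
    by (auto simp: permutation_group_def bij_imp_bij_inv bij_is_inj)
  then show "\<exists>g\<in>carrier permutation_group. g \<otimes>\<^bsub>permutation_group\<^esub> f = \<one>\<^bsub>permutation_group\<^esub>"
    by (auto simp: permutation_group_def)
qed (auto simp: permutation_group_def bij_comp)

locale bundle_group =
  fixes \<Gamma> :: "('g, 'm) monoid_scheme" and v :: "bundle_gen \<Rightarrow> 'g"
    and \<phi> :: "fiber_gen free_group \<Rightarrow> fiber_gen free_group"
  assumes iso: "\<phi> \<in> iso \<F> \<F>"
    and presentation: "group_presentation \<Gamma> bundle_gens v (bundle_relators \<phi>)"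
begin

sublocale group \<Gamma>
  using presentation by (simp add: group_presentation_def)

sublocale total: group_assignment \<Gamma> v
  using presentation by unfold_locales (simp add: group_presentation_def)

sublocale fiber: group_assignment \<Gamma> "\<lambda>j. v (Fiber j)"
  by unfold_locales auto

sublocale free: group_assignment "\<F> :: bundle_gen free_group monoid" "\<lambda>j. gen (Fiber j)"
  by (simp add: group_assignment_def group_assignment_axioms_def group_free_group)

abbreviation "\<iota> \<equiv> free_eval \<Gamma> (\<lambda>j. v (Fiber j))"
abbreviation "emb \<equiv> free_eval \<F> (\<lambda>j. gen (Fiber j) :: bundle_gen free_group)"
abbreviation "x \<equiv> v Meridian"

lemma phi_add: "\<phi> (u + w) = \<phi> u + \<phi> w"
  using iso by (auto simp: iso_def hom_def)

lemma phi_bij: "bij \<phi>"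
  using iso by (auto simp: iso_def)

lemma meridian_cancel [simp]:
  "y \<in> carrier \<Gamma> \<Longrightarrow> x \<otimes>\<^bsub>\<Gamma>\<^esub> (inv\<^bsub>\<Gamma>\<^esub> x \<otimes>\<^bsub>\<Gamma>\<^esub> y) = y"
  "y \<in> carrier \<Gamma> \<Longrightarrow> inv\<^bsub>\<Gamma>\<^esub> x \<otimes>\<^bsub>\<Gamma>\<^esub> (x \<otimes>\<^bsub>\<Gamma>\<^esub> y) = y"
  by (simp_all flip: m_assoc)

lemma emb_add: "emb (u + w) = emb u + emb w"
  using free.free_eval_add by simp

lemma emb_minus: "emb (- u) = - emb u"
  using free.free_eval_minus by simp

lemma emb_gen: "emb (gen j) = gen (Fiber j)"
  using free.free_eval_gen by simp

lemma eval_emb: "free_eval \<Gamma> v (emb u) = \<iota> u"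
  by (rule fiber.free_eval_unique) (simp_all add: emb_add emb_gen total.free_eval_add)

lemma fiber_group_eq: "fiber_group \<Gamma> v = range \<iota>"
  unfolding fiber_group_def using fiber.generate_range by simp

lemma relator_kernel: "free_eval \<Gamma> v (bundle_relator \<phi> i) = \<one>\<^bsub>\<Gamma>\<^esub>"
proof -
  have "bundle_relator \<phi> i \<in> set (bundle_relators \<phi>)"
    by (cases i) (auto simp: bundle_relators_def)
  then have "bundle_relator \<phi> i \<in> kernel \<F> \<Gamma> (free_eval \<Gamma> v)"
    using presentation by (auto simp: group_presentation_def)
  then show ?thesis by (simp add: kernel_def)
qed

lemma monodromy: "\<iota> (\<phi> u) = x \<otimes>\<^bsub>\<Gamma>\<^esub> \<iota> u \<otimes>\<^bsub>\<Gamma>\<^esub> inv\<^bsub>\<Gamma>\<^esub> x"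
proof -
  have gen: "\<iota> (\<phi> (gen i)) = x \<otimes>\<^bsub>\<Gamma>\<^esub> \<iota> (gen i) \<otimes>\<^bsub>\<Gamma>\<^esub> inv\<^bsub>\<Gamma>\<^esub> x" for i
  proof -
    have "\<iota> (\<phi> (gen i)) \<otimes>\<^bsub>\<Gamma>\<^esub> inv\<^bsub>\<Gamma>\<^esub> (x \<otimes>\<^bsub>\<Gamma>\<^esub> \<iota> (gen i) \<otimes>\<^bsub>\<Gamma>\<^esub> inv\<^bsub>\<Gamma>\<^esub> x) = \<one>\<^bsub>\<Gamma>\<^esub>"
      using relator_kernel[of i] unfolding bundle_relator_def diff_conv_add_uminus
      by (simp only: total.free_eval_add total.free_eval_minus eval_emb total.free_eval_gen fiber.free_eval_gen)
    then show ?thesis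
      by (metis inv_closed fiber.free_eval_closed inv_equality inv_inv m_closed total.assignment_closed)
  qed
  \<comment> \<open>The relators give the formula on generators only. Conjugating back yields a
    homomorphism that agrees with \<open>\<iota>\<close> on generators, hence everywhere.\<close>
  define f where "f u = inv\<^bsub>\<Gamma>\<^esub> x \<otimes>\<^bsub>\<Gamma>\<^esub> \<iota> (\<phi> u) \<otimes>\<^bsub>\<Gamma>\<^esub> x" for u
  have "f u = \<iota> u" for u
  proof (rule fiber.free_eval_unique)
    fix u w
    have "\<iota> (\<phi> u) \<otimes>\<^bsub>\<Gamma>\<^esub> \<iota> (\<phi> w) = \<iota> (\<phi> u) \<otimes>\<^bsub>\<Gamma>\<^esub> (x \<otimes>\<^bsub>\<Gamma>\<^esub> inv\<^bsub>\<Gamma>\<^esub> x) \<otimes>\<^bsub>\<Gamma>\<^esub> \<iota> (\<phi> w)" by simp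
    then show "f (u + w) = f u \<otimes>\<^bsub>\<Gamma>\<^esub> f w"
      unfolding f_def phi_add fiber.free_eval_add by (simp add: m_assoc)
    show "f (gen i) = v (Fiber i)" for i
      unfolding f_def gen by (simp add: m_assoc)
  qed (simp add: f_def)
  then have "x \<otimes>\<^bsub>\<Gamma>\<^esub> \<iota> u \<otimes>\<^bsub>\<Gamma>\<^esub> inv\<^bsub>\<Gamma>\<^esub> x = x \<otimes>\<^bsub>\<Gamma>\<^esub> f u \<otimes>\<^bsub>\<Gamma>\<^esub> inv\<^bsub>\<Gamma>\<^esub> x" by simp
  also have "\<dots> = \<iota> (\<phi> u)" unfolding f_def by (simp add: m_assoc)
  finally show ?thesis by simp
qed

text \<open>\<open>\<Gamma>\<close> acts on the set of elements of the free group: the fiber by left translations, the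
  meridian by \<open>\<phi>\<close>.  The relators act trivially, the fiber acts freely.\<close>

lemma inj_fiber: "inj \<iota>"
proof -
  define act :: "bundle_gen \<Rightarrow> fiber_gen free_group \<Rightarrow> fiber_gen free_group"
    where "act g = (case g of Fiber j \<Rightarrow> (+) (gen j) | Meridian \<Rightarrow> \<phi>)" for g
  have act [simp]: "act (Fiber j) = (+) (gen j)" "act Meridian = \<phi>" for j by (simp_all add: act_def)
  have bij_add: "bij ((+) w)" for w :: "fiber_gen free_group"
    by (rule bij_betwI[where g = "(+) (- w)"]) (auto simp flip: add.assoc)
  interpret perm: group_assignment permutation_group act
    using group_permutation_group bij_add phi_bij
    by (auto simp: group_assignment_def group_assignment_axioms_def permutation_group_def act_def split: bundle_gen.split)
  have perm_mult: "f \<otimes>\<^bsub>permutation_group\<^esub> g = f \<circ> g" for f g :: "fiber_gen free_group \<Rightarrow> fiber_gen free_group"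
    by (simp add: permutation_group_def)
  interpret fperm: group_assignment permutation_group "\<lambda>j. (+) (gen j :: fiber_gen free_group)"
    using group_permutation_group bij_add
    by (auto simp: group_assignment_def group_assignment_axioms_def permutation_group_def)
  let ?E = "free_eval permutation_group act"
  have emb: "?E (emb u) = (+) u" for u
  proof -
    have "?E (emb u) = free_eval permutation_group (\<lambda>j. (+) (gen j)) u"
      by (rule fperm.free_eval_unique) (simp_all add: emb_add emb_gen perm.free_eval_add)
    moreover have "(+) u = free_eval permutation_group (\<lambda>j. (+) (gen j)) u"
      by (rule fperm.free_eval_unique)
        (auto simp: perm_mult bij_add permutation_group_def fun_eq_iff add.assoc)
    ultimately show ?thesis by simp
  qed
  have rel: "?E (bundle_relator \<phi> i) = \<one>\<^bsub>permutation_group\<^esub>" for i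
  proof -
    \<comment> \<open>The conjugation is verified after composing with \<open>\<phi>\<close> on the
      right, which cancels the inverse of the meridian.\<close>
    have "?E (gen Meridian + gen (Fiber i) - gen Meridian) \<otimes>\<^bsub>permutation_group\<^esub> \<phi> = \<phi> \<circ> (+) (gen i)"
      using perm.free_eval_add[of "gen Meridian + gen (Fiber i) - gen Meridian" "gen Meridian"]
        perm.free_eval_add[of "gen Meridian" "gen (Fiber i)"]
      by (simp add: perm_mult)
    also have "\<phi> \<circ> (+) (gen i) = ?E (emb (\<phi> (gen i))) \<otimes>\<^bsub>permutation_group\<^esub> \<phi>"
      by (auto simp: emb perm_mult phi_add)
    finally have "?E (gen Meridian + gen (Fiber i) - gen Meridian) = ?E (emb (\<phi> (gen i)))"
      by (rule perm.right_cancel[THEN iffD1, rotated -1]) (auto simp: permutation_group_def phi_bij simp del: perm.free_eval_closed intro: perm.free_eval_closed[unfolded permutation_group_def, simplified])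
    then show ?thesis
      unfolding bundle_relator_def diff_conv_add_uminus[of "emb _"] perm.free_eval_add perm.free_eval_minus by simp
  qed
  interpret hom: group_hom \<F> permutation_group ?E
    using group_free_group group_permutation_group perm.free_eval_hom
    by (simp add: group_hom_def group_hom_axioms_def)
  have "kernel \<F> permutation_group ?E \<lhd> \<F>" by (rule hom.normal_kernel)
  moreover have "set (bundle_relators \<phi>) \<subseteq> kernel \<F> permutation_group ?E"
    using rel by (auto simp: bundle_relators_def kernel_def)
  \<comment> \<open>The kernel of \<open>?E\<close> is one of the normal subgroups that the
    presentation intersects.\<close>
  ultimately have ker: "kernel \<F> \<Gamma> (free_eval \<Gamma> v) \<subseteq> kernel \<F> permutation_group ?E"
    using presentation by (auto simp: group_presentation_def)
  show ?thesis
  proof (rule injI)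
    fix u w assume "\<iota> u = \<iota> w"
    then have "free_eval \<Gamma> v (emb (- w + u)) = \<one>\<^bsub>\<Gamma>\<^esub>"
      unfolding eval_emb by (simp add: fiber.free_eval_add fiber.free_eval_minus)
    then have "emb (- w + u) \<in> kernel \<F> permutation_group ?E" using ker by (auto simp: kernel_def)
    then have "?E (emb (- w + u)) = \<one>\<^bsub>permutation_group\<^esub>" by (simp add: kernel_def)
    then have "(+) (- w + u) = id" unfolding emb by (simp add: permutation_group_def)
    then have "- w + u = 0" by (metis add.right_neutral id_apply)
    then show "u = w" by (metis add.right_neutral add_minus_cancel)
  qed
qed

end

section \<open>The holonomy representation\<close>

lemma matrix_mult_scaleR:
  fixes X :: "real ^ 'n ^ 'm" and Y :: "real ^ 'k ^ 'n"
  shows "(c *\<^sub>R X) ** Y = c *\<^sub>R (X ** Y)" "X ** (c *\<^sub>R Y) = c *\<^sub>R (X ** Y)"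
  by (simp_all add: matrix_matrix_mult_def Finite_Cartesian_Product.vec_eq_iff sum_distrib_left mult_ac)

lemma matrix_mult_scalar: "Finite_Cartesian_Product.mat c ** X = c *\<^sub>R (X :: real ^ 'n ^ 'm)"
  by (simp add: matrix_eq flip: matrix_vector_mul_assoc scaleR_matrix_vector_assoc)
     (simp add: Finite_Cartesian_Product.vec_eq_iff matrix_vector_mult_def Finite_Cartesian_Product.mat_def if_distrib if_distribR cong: if_cong)

lemma group_GL4: "group GL4"
proof (rule groupI)
  fix X assume "X \<in> carrier GL4"
  then obtain Y where "X ** Y = Finite_Cartesian_Product.mat 1" "Y ** X = Finite_Cartesian_Product.mat 1"
    by (auto simp: GL4_def invertible_def)
  then show "\<exists>Y\<in>carrier GL4. Y \<otimes>\<^bsub>GL4\<^esub> X = \<one>\<^bsub>GL4\<^esub>"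
    by (auto simp: GL4_def invertible_def)
qed (auto simp: GL4_def matrix_mul_assoc invertible_mult, simp add: invertible_def)

lemma GL4_simps: "carrier GL4 = {X. invertible X}" "X \<otimes>\<^bsub>GL4\<^esub> Y = X ** Y" "\<one>\<^bsub>GL4\<^esub> = Finite_Cartesian_Product.mat 1"
  by (auto simp: GL4_def)

lemma inv_GL4: "invertible X \<Longrightarrow> inv\<^bsub>GL4\<^esub> X = matrix_inv X"
  by (rule group.inv_equality[OF group_GL4])
    (auto simp: GL4_simps invertible_matrix_inv, metis invertible_def invertible_matrix_inv)

lemma scalars4_iff: "X \<in> scalars4 \<longleftrightarrow> (\<exists>c. c \<noteq> 0 \<and> X = c *\<^sub>R Finite_Cartesian_Product.mat 1)"
  by (auto simp: scalars4_def simp flip: matrix_mult_scalar)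

lemma invertible_scalar: "c \<noteq> 0 \<Longrightarrow> invertible (c *\<^sub>R Finite_Cartesian_Product.mat 1 :: real ^ 4 ^ 4)"
  unfolding invertible_def
  by (rule exI[of _ "(1 / c) *\<^sub>R Finite_Cartesian_Product.mat 1"]) (simp add: matrix_mult_scaleR)

lemma normal_scalars4: "scalars4 \<lhd> GL4"
proof -
  interpret group GL4 by (rule group_GL4)
  have "subgroup scalars4 GL4"
  proof (rule subgroupI)
    show "scalars4 \<subseteq> carrier GL4" by (auto simp: scalars4_iff GL4_simps invertible_scalar)
    show "scalars4 \<noteq> {}" by (auto simp: scalars4_def)
    fix X assume "X \<in> scalars4"
    then obtain c where c: "c \<noteq> 0" "X = c *\<^sub>R Finite_Cartesian_Product.mat 1" by (auto simp: scalars4_iff)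
    have "inv\<^bsub>GL4\<^esub> X = (1 / c) *\<^sub>R Finite_Cartesian_Product.mat 1"
      using c by (intro inv_equality) (auto simp: GL4_simps invertible_scalar matrix_mult_scaleR)
    then show "inv\<^bsub>GL4\<^esub> X \<in> scalars4" using c by (auto simp: scalars4_iff intro!: exI[of _ "1 / c"])
  next
    fix X Y assume "X \<in> scalars4" "Y \<in> scalars4"
    then obtain c d where "c \<noteq> 0" "X = c *\<^sub>R Finite_Cartesian_Product.mat 1" "d \<noteq> 0" "Y = d *\<^sub>R Finite_Cartesian_Product.mat 1"
      by (auto simp: scalars4_iff)
    then show "X \<otimes>\<^bsub>GL4\<^esub> Y \<in> scalars4"
      by (auto simp: scalars4_iff GL4_simps matrix_mult_scaleR intro!: exI[of _ "c * d"])
  qed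
  moreover have "X \<otimes>\<^bsub>GL4\<^esub> Y \<otimes>\<^bsub>GL4\<^esub> inv\<^bsub>GL4\<^esub> X \<in> scalars4" if "X \<in> carrier GL4" "Y \<in> scalars4" for X Y
    using that by (auto simp: scalars4_iff GL4_simps matrix_mult_scaleR inv_GL4 invertible_matrix_inv)
  ultimately show ?thesis by (simp add: normal_inv_iff)
qed

lemma proj4_eq: "proj4 X = {c *\<^sub>R X | c. c \<noteq> 0}"
proof -
  have "proj4 X = (\<lambda>Z. Z ** X) ` scalars4" by (auto simp: proj4_def r_coset_def GL4_simps)
  also have "scalars4 = {c *\<^sub>R Finite_Cartesian_Product.mat 1 | c. c \<noteq> 0}" by (auto simp: scalars4_iff)
  also have "(\<lambda>Z. Z ** X) ` \<dots> = {c *\<^sub>R X | c. c \<noteq> 0}"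
    by (force simp: image_def matrix_mult_scaleR)
  finally show ?thesis .
qed

lemma PGL4_mult: "invertible X \<Longrightarrow> invertible Y \<Longrightarrow> proj4 X \<otimes>\<^bsub>PGL4\<^esub> proj4 Y = proj4 (X ** Y)"
  using normal.rcos_sum[OF normal_scalars4, of X Y]
  by (simp add: PGL4_def FactGroup_def proj4_def GL4_simps)

lemma matrix_inv_unique:
  fixes X :: "real ^ 'n ^ 'n"
  assumes "X ** Y = Finite_Cartesian_Product.mat 1"
  shows "matrix_inv X = Y"
proof -
  have i: "invertible X" using assms invertible_right_inverse by blast
  have "matrix_inv X = matrix_inv X ** (X ** Y)" by (simp add: assms)
  then show ?thesis by (simp add: matrix_mul_assoc invertible_matrix_inv[OF i])
qed

text \<open>Any other representative is a nonzero multiple of \<open>Y\<close>, and the scalar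
  cancels against that of the inverse.\<close>

lemma Ad_proj4: assumes "invertible Y" shows "Ad (proj4 Y) X = Y ** X ** matrix_inv Y"
proof -
  have "Y \<in> proj4 Y" by (auto simp: proj4_eq intro: exI[of _ 1])
  then have "(SOME Z. Z \<in> proj4 Y) \<in> proj4 Y" by (rule someI)
  then obtain c where c: "c \<noteq> 0" "(SOME Z. Z \<in> proj4 Y) = c *\<^sub>R Y" by (auto simp: proj4_eq)
  have "matrix_inv (c *\<^sub>R Y) = (1 / c) *\<^sub>R matrix_inv Y"
    using c by (intro matrix_inv_unique) (simp add: matrix_mult_scaleR invertible_matrix_inv[OF assms])
  then show ?thesis using c by (simp add: Ad_def matrix_mult_scaleR)
qed

section \<open>Time orientation and lifting from projective classes to matrices\<close>

lemma O31_time: assumes "X \<in> O31" shows "1 \<le> (X $ 4 $ 4)\<^sup>2"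
proof -
  define u where "u = X *v axis 4 1"
  have "u \<star> u = - 1" using O31D[OF assms, of "axis 4 1" "axis 4 1"] by (simp add: u_def lorentz_axis)
  then have "(u $ 4)\<^sup>2 = 1 + (u $ 1)\<^sup>2 + (u $ 2)\<^sup>2 + (u $ 3)\<^sup>2"
    by (simp add: lorentz_form_def power2_eq_square)
  moreover have "u $ 4 = X $ 4 $ 4" by (simp add: u_def matrix_vector_mul_component inner_axis)
  ultimately show ?thesis by simp
qed

text \<open>The entry is minus the pairing of two future-directed timelike unit vectors, and by
  Cauchy-Schwarz two such vectors pair negatively.\<close>

lemma O31_time_mult:
  assumes X: "X \<in> O31" "X $ 4 $ 4 > 0" and Y: "Y \<in> O31" "Y $ 4 $ 4 > 0"
  shows "(X ** Y) $ 4 $ 4 > 0"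
proof -
  define p where "p = matrix_inv X *v axis 4 1"
  define q where "q = Y *v axis 4 1"
  have entry: "Z $ 4 $ 4 = - (axis 4 1 \<star> (Z *v axis 4 1))" for Z :: "real ^ 4 ^ 4"
    by (simp add: lorentz_commute[of "axis 4 1"] lorentz_axis matrix_vector_mul_component inner_axis)
  have "p \<star> p = - 1" "q \<star> q = - 1"
    using O31D[OF O31_inv[OF X(1)], of "axis 4 1" "axis 4 1"] O31D[OF Y(1), of "axis 4 1" "axis 4 1"]
    by (simp_all add: p_def q_def lorentz_axis)
  then have p: "(p $ 1)\<^sup>2 + (p $ 2)\<^sup>2 + (p $ 3)\<^sup>2 = (p $ 4)\<^sup>2 - 1"
    and q: "(q $ 1)\<^sup>2 + (q $ 2)\<^sup>2 + (q $ 3)\<^sup>2 = (q $ 4)\<^sup>2 - 1"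
    by (simp_all add: lorentz_form_def power2_eq_square)
  have "p $ 4 = X $ 4 $ 4" using lorentz_inverse[OF X(1), of "axis 4 1" "axis 4 1"]
    unfolding p_def[symmetric] lorentz_axis entry by simp
  then have p4: "p $ 4 > 0" using X by simp
  have q4: "q $ 4 > 0" using Y by (simp add: q_def matrix_vector_mul_component inner_axis)
  have "(p $ 1 * q $ 1 + p $ 2 * q $ 2 + p $ 3 * q $ 3)\<^sup>2 \<le> ((p $ 4)\<^sup>2 - 1) * ((q $ 4)\<^sup>2 - 1)"
    using Cauchy_Schwarz_3[of "p $ 1" "q $ 1" "p $ 2" "q $ 2" "p $ 3" "q $ 3"] unfolding p q .
  also have "\<dots> < (p $ 4 * q $ 4)\<^sup>2"
  proof -
    have "(p $ 4)\<^sup>2 - 1 \<ge> 0" "(q $ 4)\<^sup>2 - 1 \<ge> 0" unfolding p[symmetric] q[symmetric] by auto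
    then show ?thesis by (simp add: algebra_simps power_mult_distrib)
  qed
  finally have "p $ 1 * q $ 1 + p $ 2 * q $ 2 + p $ 3 * q $ 3 < p $ 4 * q $ 4"
    using p4 q4 by (meson power2_less_imp_less mult_nonneg_nonneg less_imp_le)
  then have "p \<star> q < 0" by (simp add: lorentz_form_def)
  moreover have "(X ** Y) $ 4 $ 4 = - (p \<star> q)"
    unfolding entry p_def q_def lorentz_inverse[OF X(1)] by (simp add: matrix_vector_mul_assoc)
  ultimately show ?thesis by simp
qed

lemma SO31_0_O31: "X \<in> SO31_0 \<Longrightarrow> X \<in> O31"
  using connected_component_subset unfolding SO31_0_def by fast

text \<open>The entry never vanishes on \<open>O31\<close>, so it keeps its sign on the connected
  component of the identity.\<close>

lemma SO31_0_time: assumes "X \<in> SO31_0" shows "X $ 4 $ 4 > 0"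
proof (rule ccontr)
  assume neg: "\<not> X $ 4 $ 4 > 0"
  have "connected ((\<lambda>X. X $ 4 $ 4) ` SO31_0)"
    unfolding SO31_0_def by (intro connected_continuous_image connected_connected_component continuous_intros)
  then have int: "c \<in> (\<lambda>X. X $ 4 $ 4) ` SO31_0"
    if "a \<in> (\<lambda>X. X $ 4 $ 4) ` SO31_0" "b \<in> (\<lambda>X. X $ 4 $ 4) ` SO31_0" "a \<le> c" "c \<le> b" for a b c
    using that unfolding connected_iff_interval by blast
  have one: "Finite_Cartesian_Product.mat 1 \<in> SO31_0" by (simp add: SO31_0_def O31_one)
  have "0 \<in> (\<lambda>X. X $ 4 $ 4) ` SO31_0"
    using int[OF imageI[OF assms] imageI[OF one], of 0] neg by (simp add: Finite_Cartesian_Product.mat_def)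
  then obtain Y where "Y \<in> SO31_0" "Y $ 4 $ 4 = 0" by auto
  then show False using O31_time[OF SO31_0_O31, of Y] by simp
qed

text \<open>Only the scalars 1 and -1 preserve the form, and -1 reverses time.\<close>

lemma proj4_O31_inj:
  assumes "X \<in> O31" "X $ 4 $ 4 > 0" "Y \<in> O31" "Y $ 4 $ 4 > 0" "proj4 X = proj4 Y"
  shows "X = Y"
proof -
  have "X \<in> proj4 Y" unfolding assms(5)[symmetric] by (auto simp: proj4_eq intro: exI[of _ 1])
  then obtain c where c: "X = c *\<^sub>R Y" by (auto simp: proj4_eq)
  have "(X *v axis 1 1) \<star> (X *v axis 1 1) = 1" "(Y *v axis 1 1) \<star> (Y *v axis 1 1) = 1"
    using assms(1,3) by (simp_all add: O31D lorentz_axis)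
  then have "c * c = 1" unfolding c by (simp flip: scaleR_matrix_vector_assoc)
  moreover have "c > 0" using assms(2,4) unfolding c by (simp add: zero_less_mult_iff)
  ultimately have "c = 1" by (simp add: square_eq_1_iff)
  then show ?thesis using c by simp
qed

text \<open>The inverse of an isometry is its adjoint. The explicit entries make inversion
  continuous on \<open>O31\<close>.\<close>

lemma O31_inv_entry:
  assumes "X \<in> O31"
  shows "matrix_inv X $ i $ j = (if i = 4 then - 1 else 1) * (if j = 4 then - 1 else 1) * X $ j $ i"
proof -
  have ax: "y \<star> axis k 1 = (if k = 4 then - 1 else 1) * y $ k" for y :: "real ^ 4" and k
    using exhaust_4[of k] by (auto simp: lorentz_axis)
  have col: "(Z *v axis l 1) $ k = Z $ k $ l" for Z :: "real ^ 4 ^ 4" and k l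
    by (simp add: matrix_vector_mul_component inner_axis)
  have "(matrix_inv X *v axis j 1) \<star> axis i 1 = (X *v axis i 1) \<star> axis j 1"
    using lorentz_inverse[OF assms] lorentz_commute by metis
  then show ?thesis unfolding ax col by (auto split: if_splits)
qed

lemma tendsto_matrix_mult:
  fixes f g :: "'k \<Rightarrow> real ^ 4 ^ 4"
  assumes "(f \<longlongrightarrow> a) F" "(g \<longlongrightarrow> b) F"
  shows "((\<lambda>k. f k ** g k) \<longlongrightarrow> a ** b) F"
  unfolding matrix_matrix_mult_def
  by (intro vec_tendstoI) (auto intro!: tendsto_intros tendsto_vec_nth assms)

text \<open>Two close elements of a subgroup differ by an element close to the identity.\<close>

lemma isolated_one_imp_locally_finite:
  fixes S :: "(real ^ 4 ^ 4) set"
  assumes O: "S \<subseteq> O31" and diff: "\<And>X Y. X \<in> S \<Longrightarrow> Y \<in> S \<Longrightarrow> matrix_inv X ** Y \<in> S"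
    and iso: "Finite_Cartesian_Product.mat 1 isolated_in S"
  shows "finite {X \<in> S. norm X \<le> C}"
proof (rule ccontr)
  assume inf: "infinite {X \<in> S. norm X \<le> C}"
  have "bounded {X \<in> S. norm X \<le> C}" by (auto simp: bounded_iff)
  then obtain L where "L islimpt {X \<in> S. norm X \<le> C}"
    using inf bounded_infinite_imp_islimpt[of "{X \<in> S. norm X \<le> C}"] by blast
  then obtain f where f: "\<And>k. f k \<in> S" "\<And>k. f k \<noteq> L" and lim: "f \<longlonglongrightarrow> L"
    unfolding islimpt_sequential by auto
  \<comment> \<open>The adjoint of \<open>L\<close> for the form, which is the limit of the
    inverses.\<close>
  define M :: "real ^ 4 ^ 4" where
    "M = (\<chi> i j. (if i = 4 then - 1 else 1) * (if j = 4 then - 1 else 1) * L $ j $ i)"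
  have "(\<lambda>k. matrix_inv (f k)) \<longlonglongrightarrow> M"
  proof (intro vec_tendstoI)
    fix i j
    have "(\<lambda>k. (if i = 4 then - 1 else 1) * (if j = 4 then - 1 else 1) * f k $ j $ i) \<longlonglongrightarrow> M $ i $ j"
      unfolding M_def vec_lambda_beta by (intro tendsto_intros tendsto_vec_nth lim)
    then show "(\<lambda>k. matrix_inv (f k) $ i $ j) \<longlonglongrightarrow> M $ i $ j"
      using O31_inv_entry f O by (metis (no_types, lifting) subsetD ext)
  qed
  note inv = tendsto_matrix_mult[OF this]
  have "(\<lambda>k. matrix_inv (f k) ** f k) \<longlonglongrightarrow> M ** L" by (rule inv[OF lim])
  moreover have "matrix_inv (f k) ** f k = Finite_Cartesian_Product.mat 1" for k
    using invertible_matrix_inv(2)[OF O31_invertible] f O by blast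
  ultimately have "(\<lambda>k. Finite_Cartesian_Product.mat 1) \<longlonglongrightarrow> M ** L" by simp
  then have left_inv: "M ** L = Finite_Cartesian_Product.mat 1" by (simp add: LIMSEQ_const_iff)
  have 1: "(\<lambda>k. matrix_inv (f k) ** f (Suc k)) \<longlonglongrightarrow> Finite_Cartesian_Product.mat 1"
    using inv[OF LIMSEQ_Suc[OF lim]] by (simp add: left_inv)
  obtain T where T: "open T" "T \<inter> S = {Finite_Cartesian_Product.mat 1}" using iso by (auto simp: isolated_in_def)
  then have "eventually (\<lambda>k. matrix_inv (f k) ** f (Suc k) \<in> T) sequentially"
    using 1 topological_tendstoD by blast
  then obtain N where N: "\<And>k. k \<ge> N \<Longrightarrow> matrix_inv (f k) ** f (Suc k) \<in> T"
    by (auto simp: eventually_sequentially)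
  \<comment> \<open>Quotients of consecutive terms tend to the isolated point 1, hence equal it from
    \<open>N\<close> on. The sequence is then eventually constant, yet it avoids its limit.\<close>
  have "f (Suc k) = f k" if "k \<ge> N" for k
  proof -
    have "matrix_inv (f k) ** f (Suc k) = Finite_Cartesian_Product.mat 1" using N[OF that] T diff f by blast
    then have "f k ** (matrix_inv (f k) ** f (Suc k)) = f k" by simp
    then show ?thesis using invertible_matrix_inv(1)[OF O31_invertible, of "f k"] f O
      by (simp add: matrix_mul_assoc subset_iff)
  qed
  then have "f (N + k) = f N" for k by (induction k) auto
  then have "(\<lambda>k. f (k + N)) \<longlonglongrightarrow> f N" by (simp add: add.commute)
  then have "f N = L" using LIMSEQ_ignore_initial_segment[OF lim, of N] LIMSEQ_unique by blast
  then show False using f by blast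
qed

locale holonomy = bundle_group \<Gamma> v \<phi>
  for \<Gamma> :: "('g, 'm) monoid_scheme" and v :: "bundle_gen \<Rightarrow> 'g" and \<phi> +
  fixes \<rho> :: "'g \<Rightarrow> (real ^ 4 ^ 4) set" and \<alpha> :: "'g \<Rightarrow> int"
  assumes discrete: "discrete_faithful \<Gamma> \<rho>"
    and alpha: "\<alpha> \<in> hom \<Gamma> integer_group"
    and alpha_fiber: "\<And>g. g \<in> fiber_group \<Gamma> v \<Longrightarrow> \<alpha> g = 0" and alpha_meridian: "\<alpha> (v Meridian) = 1"
    and phi_boundary: "\<phi> (gen A + gen B - gen A - gen B) = gen A + gen B - gen A - gen B"
begin

text \<open>The representative in the identity component is unique, so the choice is canonical and
  turns the projective representation into a linear one.\<close>

definition lift :: "'g \<Rightarrow> real ^ 4 ^ 4" where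
  "lift g = (SOME X. X \<in> SO31_0 \<and> proj4 X = \<rho> g)"

lemma lift: assumes "g \<in> carrier \<Gamma>"
  shows lift_SO: "lift g \<in> SO31_0" and proj4_lift: "proj4 (lift g) = \<rho> g"
proof -
  have "\<exists>X. X \<in> SO31_0 \<and> proj4 X = \<rho> g"
  proof -
    have "\<rho> g \<in> proj4 ` SO31_0"
      using discrete assms unfolding discrete_faithful_def PSO31_def by blast
    then show ?thesis by auto
  qed
  from someI_ex[OF this] show "lift g \<in> SO31_0" "proj4 (lift g) = \<rho> g" by (auto simp: lift_def)
qed

lemma lift_O31: "g \<in> carrier \<Gamma> \<Longrightarrow> lift g \<in> O31"
  using lift_SO SO31_0_O31 by blast

lemma lift_invertible: "g \<in> carrier \<Gamma> \<Longrightarrow> invertible (lift g)"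
  using lift_O31 O31_invertible by blast

lemma lift_eqI: "g \<in> carrier \<Gamma> \<Longrightarrow> X \<in> O31 \<Longrightarrow> X $ 4 $ 4 > 0 \<Longrightarrow> proj4 X = \<rho> g \<Longrightarrow> X = lift g"
  by (rule proj4_O31_inj) (auto simp: lift_O31 SO31_0_time lift_SO proj4_lift)

lemma lift_mult: assumes "g \<in> carrier \<Gamma>" "h \<in> carrier \<Gamma>"
  shows "lift (g \<otimes>\<^bsub>\<Gamma>\<^esub> h) = lift g ** lift h"
proof -
  have "proj4 (lift g ** lift h) = \<rho> (g \<otimes>\<^bsub>\<Gamma>\<^esub> h)"
    using assms discrete unfolding discrete_faithful_def hom_def
    by (auto simp: PGL4_mult[symmetric] lift_invertible proj4_lift)
  then show ?thesis
    using assms by (intro lift_eqI[symmetric]) (auto simp: O31_mult lift_O31 O31_time_mult SO31_0_time lift_SO)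
qed

lemma lift_one: "lift \<one>\<^bsub>\<Gamma>\<^esub> = Finite_Cartesian_Product.mat 1"
proof -
  have "lift \<one>\<^bsub>\<Gamma>\<^esub> ** lift \<one>\<^bsub>\<Gamma>\<^esub> = lift \<one>\<^bsub>\<Gamma>\<^esub>" using lift_mult[of "\<one>\<^bsub>\<Gamma>\<^esub>" "\<one>\<^bsub>\<Gamma>\<^esub>"] by simp
  then have "matrix_inv (lift \<one>\<^bsub>\<Gamma>\<^esub>) ** (lift \<one>\<^bsub>\<Gamma>\<^esub> ** lift \<one>\<^bsub>\<Gamma>\<^esub>) = Finite_Cartesian_Product.mat 1"
    by (simp add: invertible_matrix_inv lift_invertible)
  then show ?thesis by (simp add: matrix_mul_assoc invertible_matrix_inv lift_invertible)
qed

lemma lift_inv: "g \<in> carrier \<Gamma> \<Longrightarrow> matrix_inv (lift g) = lift (inv\<^bsub>\<Gamma>\<^esub> g)"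
  by (rule matrix_inv_unique) (simp add: lift_mult[symmetric] lift_one)

lemma lift_inj: "g \<in> carrier \<Gamma> \<Longrightarrow> h \<in> carrier \<Gamma> \<Longrightarrow> lift g = lift h \<Longrightarrow> g = h"
  using discrete unfolding discrete_faithful_def by (metis inj_onD proj4_lift)

lemma Ad_rho: "g \<in> carrier \<Gamma> \<Longrightarrow> Ad (\<rho> g) X = lift g ** X ** lift (inv\<^bsub>\<Gamma>\<^esub> g)"
  using Ad_proj4[OF lift_invertible, of g] by (simp add: proj4_lift lift_inv)

text \<open>Discreteness isolates the identity in the image, and \<open>lift\<close> is injective
  because \<open>\<rho>\<close> is faithful.\<close>

lemma finite_lift: "finite {g \<in> carrier \<Gamma>. norm (lift g) \<le> C}"
proof -
  define S where "S = {X \<in> SO31_0. proj4 X \<in> \<rho> ` carrier \<Gamma>}"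
  have S: "S = lift ` carrier \<Gamma>"
  proof
    show "S \<subseteq> lift ` carrier \<Gamma>"
    proof
      fix X assume "X \<in> S"
      then obtain g where "X \<in> SO31_0" "g \<in> carrier \<Gamma>" "proj4 X = \<rho> g" by (auto simp: S_def)
      then show "X \<in> lift ` carrier \<Gamma>" using lift_eqI SO31_0_O31 SO31_0_time by blast
    qed
    show "lift ` carrier \<Gamma> \<subseteq> S" by (auto simp: S_def lift_SO proj4_lift)
  qed
  have "finite {X \<in> S. norm X \<le> C}"
  proof (rule isolated_one_imp_locally_finite)
    show "S \<subseteq> O31" by (auto simp: S lift_O31)
    show "matrix_inv X ** Y \<in> S" if "X \<in> S" "Y \<in> S" for X Y
      using that by (auto simp: S lift_inv simp flip: lift_mult)
    have "discrete S" using discrete by (simp add: discrete_faithful_def S_def)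
    moreover have "Finite_Cartesian_Product.mat 1 \<in> S" unfolding S by (metis imageI lift_one one_closed)
    ultimately show "Finite_Cartesian_Product.mat 1 isolated_in S" by (rule discreteD)
  qed
  moreover have "lift ` {g \<in> carrier \<Gamma>. norm (lift g) \<le> C} \<subseteq> {X \<in> S. norm X \<le> C}" by (auto simp: S)
  ultimately have "finite (lift ` {g \<in> carrier \<Gamma>. norm (lift g) \<le> C})" using finite_subset by blast
  then show ?thesis by (rule finite_imageD) (auto simp: inj_on_def lift_inj)
qed

lemma carrier_eq: "carrier \<Gamma> = range (free_eval \<Gamma> v)"
  using presentation total.generate_range by (simp add: group_presentation_def)

lemma monodromy': "x \<otimes>\<^bsub>\<Gamma>\<^esub> \<iota> u = \<iota> (\<phi> u) \<otimes>\<^bsub>\<Gamma>\<^esub> x"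
  using monodromy[of u] by (simp add: m_assoc)

text \<open>It suffices to conjugate by letters; for the inverse of the meridian the surjectivity of
  \<open>\<phi>\<close> is used.\<close>

lemma fiber_normal: assumes "g \<in> carrier \<Gamma>" shows "\<exists>w. g \<otimes>\<^bsub>\<Gamma>\<^esub> \<iota> u = \<iota> w \<otimes>\<^bsub>\<Gamma>\<^esub> g"
proof -
  have conj: "\<exists>w. h \<otimes>\<^bsub>\<Gamma>\<^esub> \<iota> u = \<iota> w \<otimes>\<^bsub>\<Gamma>\<^esub> h"
    if h: "h = free_eval \<Gamma> v (letter_val l)" for h u l
  proof (cases "fst l")
    case (Fiber j)
    then have "h = \<iota> (letter_val (j, snd l))"
      by (auto simp: h letter_val_def total.free_eval_minus fiber.free_eval_minus)
    then have "h \<otimes>\<^bsub>\<Gamma>\<^esub> \<iota> u = \<iota> (letter_val (j, snd l) + u - letter_val (j, snd l)) \<otimes>\<^bsub>\<Gamma>\<^esub> h"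
      by (simp flip: fiber.free_eval_add)
    then show ?thesis by blast
  next
    case Meridian
    obtain w where w: "u = \<phi> w" using phi_bij by (metis bij_pointE)
    show ?thesis
    proof (cases "snd l")
      case True
      then have "h = x" using Meridian by (simp add: h letter_val_def)
      then show ?thesis using monodromy' by blast
    next
      case False
      then have h: "h = inv\<^bsub>\<Gamma>\<^esub> x" using Meridian by (simp add: h letter_val_def total.free_eval_minus)
      have "h \<otimes>\<^bsub>\<Gamma>\<^esub> \<iota> u = h \<otimes>\<^bsub>\<Gamma>\<^esub> (\<iota> (\<phi> w) \<otimes>\<^bsub>\<Gamma>\<^esub> (x \<otimes>\<^bsub>\<Gamma>\<^esub> h))" by (simp add: h w)
      also have "\<dots> = h \<otimes>\<^bsub>\<Gamma>\<^esub> ((x \<otimes>\<^bsub>\<Gamma>\<^esub> \<iota> w) \<otimes>\<^bsub>\<Gamma>\<^esub> h)" unfolding monodromy' by (simp add: h m_assoc)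
      also have "\<dots> = \<iota> w \<otimes>\<^bsub>\<Gamma>\<^esub> h" by (simp add: h m_assoc)
      finally show ?thesis by blast
    qed
  qed
  have "\<exists>w. free_eval \<Gamma> v z \<otimes>\<^bsub>\<Gamma>\<^esub> \<iota> u = \<iota> w \<otimes>\<^bsub>\<Gamma>\<^esub> free_eval \<Gamma> v z" for z
  proof (induction z arbitrary: u rule: free_group_induct)
    case zero then show ?case by auto
  next
    case (add l z)
    let ?h = "free_eval \<Gamma> v (letter_val l)" and ?z = "free_eval \<Gamma> v z"
    obtain w where w: "?z \<otimes>\<^bsub>\<Gamma>\<^esub> \<iota> u = \<iota> w \<otimes>\<^bsub>\<Gamma>\<^esub> ?z" using add by blast
    obtain w' where w': "?h \<otimes>\<^bsub>\<Gamma>\<^esub> \<iota> w = \<iota> w' \<otimes>\<^bsub>\<Gamma>\<^esub> ?h" using conj by blast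
    have "?h \<otimes>\<^bsub>\<Gamma>\<^esub> ?z \<otimes>\<^bsub>\<Gamma>\<^esub> \<iota> u = (?h \<otimes>\<^bsub>\<Gamma>\<^esub> \<iota> w) \<otimes>\<^bsub>\<Gamma>\<^esub> ?z" by (simp add: m_assoc w)
    also have "\<dots> = \<iota> w' \<otimes>\<^bsub>\<Gamma>\<^esub> (?h \<otimes>\<^bsub>\<Gamma>\<^esub> ?z)" by (simp add: m_assoc w')
    finally show ?case by (auto simp: total.free_eval_add)
  qed
  then show ?thesis using assms carrier_eq by auto
qed

section \<open>The peripheral subgroup\<close>

abbreviation "c0 \<equiv> gen A + gen B - gen A - gen B :: fiber_gen free_group"

text \<open>The commutator word is cyclically reduced, so its powers are plain
  concatenations.\<close>

lemma boundary_multiple_nonzero: "((+) c0 ^^ Suc k) 0 \<noteq> 0"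
proof -
  have "word (((+) c0 ^^ k) 0) = concat (replicate k [(A, True), (B, True), (A, False), (B, False)])" for k
  proof (induction k)
    case (Suc k)
    then show ?case
      by (cases k) (simp_all add: plus_free_group.rep_eq gen.rep_eq uminus_free_group.rep_eq letter_inv_def
        zero_free_group.rep_eq diff_conv_add_uminus del: add_uminus_conv_diff)
  qed (simp add: zero_free_group.rep_eq)
  from this[of "Suc k"] show ?thesis by (auto simp: zero_free_group.rep_eq)
qed

lemma alpha_int_pow: "g \<in> carrier \<Gamma> \<Longrightarrow> \<alpha> (g [^]\<^bsub>\<Gamma>\<^esub> (j :: int)) = j * \<alpha> g"
proof -
  interpret \<alpha>: group_hom \<Gamma> integer_group \<alpha>
    using alpha group_integer_group by (simp add: group_hom_def group_hom_axioms_def is_group)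
  show "g \<in> carrier \<Gamma> \<Longrightarrow> \<alpha> (g [^]\<^bsub>\<Gamma>\<^esub> (j :: int)) = j * \<alpha> g"
    by (simp add: \<alpha>.hom_int_pow mult.commute)
qed

end

lemma (in group) int_pow_commute:
  assumes "y \<in> carrier G" "z \<in> carrier G" "y \<otimes> z = z \<otimes> y"
  shows "y \<otimes> z [^] (i :: int) = z [^] i \<otimes> y"
proof (induction i rule: int_induct[of _ 0])
  case (step1 i)
  have "y \<otimes> z [^] (i + 1) = (y \<otimes> z [^] i) \<otimes> z" using assms by (simp add: int_pow_mult m_assoc)
  also have "\<dots> = z [^] i \<otimes> (z \<otimes> y)" using assms step1 by (simp add: m_assoc)
  also have "\<dots> = z [^] (i + 1) \<otimes> y" using assms by (simp add: int_pow_mult m_assoc)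
  finally show ?case .
next
  case (step2 i)
  have *: "z [^] i = z [^] (i - 1) \<otimes> z" using assms int_pow_mult[of z "i - 1" 1] by simp
  have "(y \<otimes> z [^] (i - 1)) \<otimes> z = y \<otimes> z [^] i" using assms by (simp add: * m_assoc)
  also have "\<dots> = z [^] (i - 1) \<otimes> (z \<otimes> y)" using assms step2 by (simp add: * m_assoc)
  also have "\<dots> = (z [^] (i - 1) \<otimes> y) \<otimes> z" using assms by (simp add: m_assoc)
  finally show ?case using assms by simp
qed (use assms in simp)

context holonomy
begin

abbreviation "c \<equiv> \<iota> c0"

definition peripheral :: "int \<Rightarrow> int \<Rightarrow> 'g" where
  "peripheral i j = c [^]\<^bsub>\<Gamma>\<^esub> i \<otimes>\<^bsub>\<Gamma>\<^esub> x [^]\<^bsub>\<Gamma>\<^esub> j"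

lemma peripheral_closed [simp]: "peripheral i j \<in> carrier \<Gamma>"
  by (simp add: peripheral_def)

text \<open>Since \<open>\<phi>\<close> fixes \<open>c0\<close>, the meridian commutes with the
  boundary curve.\<close>

lemma peripheral_add: "peripheral (i + k) (j + l) = peripheral i j \<otimes>\<^bsub>\<Gamma>\<^esub> peripheral k l"
proof -
  have "x \<otimes>\<^bsub>\<Gamma>\<^esub> c = c \<otimes>\<^bsub>\<Gamma>\<^esub> x" using monodromy'[of c0] by (simp only: phi_boundary)
  then have "x \<otimes>\<^bsub>\<Gamma>\<^esub> c [^]\<^bsub>\<Gamma>\<^esub> k = c [^]\<^bsub>\<Gamma>\<^esub> k \<otimes>\<^bsub>\<Gamma>\<^esub> x" by (intro int_pow_commute) simp_all
  then have "c [^]\<^bsub>\<Gamma>\<^esub> k \<otimes>\<^bsub>\<Gamma>\<^esub> x [^]\<^bsub>\<Gamma>\<^esub> j = x [^]\<^bsub>\<Gamma>\<^esub> j \<otimes>\<^bsub>\<Gamma>\<^esub> c [^]\<^bsub>\<Gamma>\<^esub> k" by (intro int_pow_commute) simp_all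
  then have *: "x [^]\<^bsub>\<Gamma>\<^esub> j \<otimes>\<^bsub>\<Gamma>\<^esub> (c [^]\<^bsub>\<Gamma>\<^esub> k \<otimes>\<^bsub>\<Gamma>\<^esub> y) = c [^]\<^bsub>\<Gamma>\<^esub> k \<otimes>\<^bsub>\<Gamma>\<^esub> (x [^]\<^bsub>\<Gamma>\<^esub> j \<otimes>\<^bsub>\<Gamma>\<^esub> y)"
    if "y \<in> carrier \<Gamma>" for y
    using that by (simp flip: m_assoc)
  show ?thesis by (simp add: peripheral_def int_pow_mult m_assoc *)
qed

lemma alpha_iota: "\<alpha> (\<iota> u) = 0"
  by (rule alpha_fiber) (simp add: fiber_group_eq)

lemma alpha_mult: "g \<in> carrier \<Gamma> \<Longrightarrow> h \<in> carrier \<Gamma> \<Longrightarrow> \<alpha> (g \<otimes>\<^bsub>\<Gamma>\<^esub> h) = \<alpha> g + \<alpha> h"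
  using alpha by (auto simp: hom_def integer_group_def)

lemma boundary_torsion_free: "c [^]\<^bsub>\<Gamma>\<^esub> (i :: int) = \<one>\<^bsub>\<Gamma>\<^esub> \<Longrightarrow> i = 0"
proof -
  have nat: "c [^]\<^bsub>\<Gamma>\<^esub> n = \<iota> (((+) c0 ^^ n) 0)" for n :: nat
  proof (induction n)
    case (Suc n)
    have "c [^]\<^bsub>\<Gamma>\<^esub> Suc n = c \<otimes>\<^bsub>\<Gamma>\<^esub> c [^]\<^bsub>\<Gamma>\<^esub> n" by (rule nat_pow_Suc2) simp
    then show ?case using Suc by (simp only: funpow.simps o_apply fiber.free_eval_add)
  qed simp
  have pos: "c [^]\<^bsub>\<Gamma>\<^esub> Suc n \<noteq> \<one>\<^bsub>\<Gamma>\<^esub>" for n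
    unfolding nat using inj_fiber boundary_multiple_nonzero[of n] by (metis fiber.free_eval_zero injD)
  show "i = 0" if "c [^]\<^bsub>\<Gamma>\<^esub> i = \<one>\<^bsub>\<Gamma>\<^esub>"
  proof (rule ccontr)
    assume "i \<noteq> 0"
    then obtain n where n: "i = int (Suc n) \<or> i = - int (Suc n)"
      by (cases i rule: int_cases3) (auto simp only: gr0_conv_Suc)
    then have "c [^]\<^bsub>\<Gamma>\<^esub> Suc n = \<one>\<^bsub>\<Gamma>\<^esub>"
    proof
      assume "i = int (Suc n)" then show ?thesis using that by (simp only: int_pow_int)
    next
      assume "i = - int (Suc n)"
      then have "inv\<^bsub>\<Gamma>\<^esub> (c [^]\<^bsub>\<Gamma>\<^esub> Suc n) = \<one>\<^bsub>\<Gamma>\<^esub>" using that by (simp only: int_pow_neg_int fiber.free_eval_closed)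
      then show ?thesis by (metis fiber.free_eval_closed inv_inv inv_one nat_pow_closed)
    qed
    then show False using pos by blast
  qed
qed

text \<open>\<open>\<alpha>\<close> reads off the power of the meridian, and the boundary curve has
  infinite order.\<close>

lemma peripheral_inj: "peripheral i j = peripheral k l \<Longrightarrow> i = k \<and> j = l"
proof -
  assume eq: "peripheral i j = peripheral k l"
  have "\<alpha> (peripheral i j) = j" for i j
    by (simp add: peripheral_def alpha_mult alpha_int_pow alpha_iota alpha_meridian)
  then have jl: "j = l" using eq by metis
  have "peripheral (i - k) 0 \<otimes>\<^bsub>\<Gamma>\<^esub> peripheral k j = peripheral k j"
    using peripheral_add[of "i - k" k 0 j] eq jl by simp
  then have "peripheral (i - k) 0 = \<one>\<^bsub>\<Gamma>\<^esub>" by simp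
  then have "i - k = 0" by (intro boundary_torsion_free) (simp add: peripheral_def)
  then show ?thesis using jl by simp
qed

theorem fiber_no_invariants:
  assumes tr: "Determinants.trace X = 0" and inv: "\<And>u. Ad (\<rho> (\<iota> u)) X = X"
  shows "X = 0"
proof -
  \<comment> \<open>In multiplicative notation these are the commutators [a^2, b^2] and [a^2, b^4],
    which do not commute in the free group.\<close>
  define k l :: "fiber_gen free_group" where
    "k = ((gen A + gen A) + (gen B + gen B)) - ((gen B + gen B) + (gen A + gen A))" and
    "l = ((gen A + gen A) + ((gen B + gen B) + (gen B + gen B))) - (((gen B + gen B) + (gen B + gen B)) + (gen A + gen A))"
  have "word (k + l) \<noteq> word (l + k)"
    by (simp add: k_def l_def plus_free_group.rep_eq gen.rep_eq uminus_free_group.rep_eq letter_inv_def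
        diff_conv_add_uminus del: add_uminus_conv_diff)
  then have "k + l \<noteq> l + k" by metis
  have "\<exists>\<mu>. X = \<mu> *\<^sub>R Finite_Cartesian_Product.mat 1"
  proof (rule commutant_scalar[of "\<lambda>u. lift (\<iota> u)" "\<lambda>i j. lift (peripheral i j)" c0 k "gen A" "gen B" l "gen A" "gen B + gen B"])
    show "lift (\<iota> (u + w)) = lift (\<iota> u) ** lift (\<iota> w)" for u w by (simp add: fiber.free_eval_add lift_mult)
    show "lift (peripheral (i + k) (j + l)) = lift (peripheral i j) ** lift (peripheral k l)" for i j k l
      by (simp add: peripheral_add lift_mult)
    show "lift c = lift (peripheral 1 0)" by (simp add: peripheral_def)
    show "\<exists>w. lift (peripheral i j) ** lift (\<iota> u) = lift (\<iota> w) ** lift (peripheral i j)" for i j u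
      using fiber_normal[of "peripheral i j" u] by (metis fiber.free_eval_closed lift_mult peripheral_closed)
    show "finite {(i, j). norm (lift (peripheral i j)) \<le> C}" for C
    proof -
      have "(\<lambda>(i, j). peripheral i j) ` {(i, j). norm (lift (peripheral i j)) \<le> C} \<subseteq> {g \<in> carrier \<Gamma>. norm (lift g) \<le> C}"
        by auto
      then have "finite ((\<lambda>(i, j). peripheral i j) ` {(i, j). norm (lift (peripheral i j)) \<le> C})"
        using finite_lift finite_subset by blast
      then show ?thesis by (rule finite_imageD) (auto simp: inj_on_def dest: peripheral_inj)
    qed
    show "lift (\<iota> (k + l)) \<noteq> lift (\<iota> (l + k))"
      using \<open>k + l \<noteq> l + k\<close> inj_fiber lift_inj by (metis fiber.free_eval_closed injD)
    show "X ** lift (\<iota> u) = lift (\<iota> u) ** X" for u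
    proof -
      have "X ** lift (\<iota> u) = (lift (\<iota> u) ** X ** lift (inv\<^bsub>\<Gamma>\<^esub> \<iota> u)) ** lift (\<iota> u)"
        using inv[of u] by (simp add: Ad_rho)
      also have "\<dots> = lift (\<iota> u) ** X ** (lift (inv\<^bsub>\<Gamma>\<^esub> \<iota> u) ** lift (\<iota> u))" by (simp only: matrix_mul_assoc)
      finally show ?thesis by (simp add: lift_mult[symmetric] lift_one)
    qed
  qed (simp_all add: lift_O31 k_def l_def)
  then obtain \<mu> where \<mu>: "X = \<mu> *\<^sub>R Finite_Cartesian_Product.mat 1" by blast
  then have "4 * \<mu> = 0" using tr by (simp add: trace_def Finite_Cartesian_Product.mat_def sum_4)
  then show ?thesis using \<mu> by simp
qed

end

section \<open>Coordinates and characteristic polynomials\<close>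

locale coordinate_space = vectorspace class_ring V
  for V :: "('k :: field, 'v, 'm) module_scheme" (structure) and vs :: "'v list" +
  assumes ordered_basis: "ordered_basis V vs"
begin

abbreviation "n \<equiv> length vs"

definition combination :: "'k Matrix.vec \<Rightarrow> 'v" where
  "combination c = (\<Oplus>\<^bsub>V\<^esub>i\<in>{..<n}. vec_index c i \<odot>\<^bsub>V\<^esub> vs ! i)"

lemma basis_closed [simp]: "i < n \<Longrightarrow> vs ! i \<in> carrier V"
  using ordered_basis by (auto simp: ordered_basis_def basis_def)

lemma combination_closed [simp]: "combination c \<in> carrier V"
  unfolding combination_def by (rule finsum_closed) auto

text \<open>Bridge from sums over list positions to linear combinations over the basis as a set. The
  coefficients are restricted because the criterion for a basis asserts uniqueness among extensional
  functions.\<close>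

lemma combination_lincomb:
  "combination c = lincomb (\<lambda>w\<in>set vs. vec_index c (inv_into {..<n} ((!) vs) w)) (set vs)"
proof -
  have bij: "bij_betw ((!) vs) {..<n} (set vs)"
    using ordered_basis by (intro bij_betw_nth) (auto simp: ordered_basis_def)
  have inj: "inj_on ((!) vs) {..<n}" using bij by (simp add: bij_betw_def)
  have "lincomb (\<lambda>w\<in>set vs. vec_index c (inv_into {..<n} ((!) vs) w)) (set vs) =
      (\<Oplus>\<^bsub>V\<^esub>w\<in>(!) vs ` {..<n}. vec_index c (inv_into {..<n} ((!) vs) w) \<odot>\<^bsub>V\<^esub> w)"
    unfolding lincomb_def bij_betw_imp_surj_on[OF bij]
    by (rule finsum_cong) (use ordered_basis in \<open>auto simp: ordered_basis_def basis_def\<close>)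
  also have "\<dots> = (\<Oplus>\<^bsub>V\<^esub>i\<in>{..<n}. vec_index c (inv_into {..<n} ((!) vs) (vs ! i)) \<odot>\<^bsub>V\<^esub> vs ! i)"
    by (rule finsum_reindex) (auto simp: inj)
  also have "\<dots> = combination c"
    unfolding combination_def by (rule finsum_cong) (auto simp: inv_into_f_f[OF inj])
  finally show ?thesis by simp
qed

lemma ex1_combination:
  assumes "u \<in> carrier V" shows "\<exists>!c. c \<in> carrier_vec n \<and> u = combination c"
proof -
  have bij: "bij_betw ((!) vs) {..<n} (set vs)"
    using ordered_basis by (intro bij_betw_nth) (auto simp: ordered_basis_def)
  then have inj: "inj_on ((!) vs) {..<n}" by (simp add: bij_betw_def)
  have "basis (set vs)" "set vs \<subseteq> carrier V" using ordered_basis by (auto simp: ordered_basis_def basis_def)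
  then have ex1: "\<exists>!a. a \<in> set vs \<rightarrow>\<^sub>E UNIV \<and> lincomb a (set vs) = u"
    using basis_criterion[of "set vs"] assms by (simp add: class_ring_simps)
  show ?thesis
  proof (rule ex_ex1I)
    obtain a where a: "a \<in> set vs \<rightarrow>\<^sub>E UNIV" "lincomb a (set vs) = u" using ex1 by blast
    have "(\<lambda>w\<in>set vs. vec_index (Matrix.vec n (\<lambda>i. a (vs ! i))) (inv_into {..<n} ((!) vs) w)) = a"
    proof
      fix w
      show "(\<lambda>w\<in>set vs. vec_index (Matrix.vec n (\<lambda>i. a (vs ! i))) (inv_into {..<n} ((!) vs) w)) w = a w"
      proof (cases "w \<in> set vs")
        case True
        then have "vs ! inv_into {..<n} ((!) vs) w = w" "inv_into {..<n} ((!) vs) w < n"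
          using f_inv_into_f[of w "(!) vs" "{..<n}"] inv_into_into[of w "(!) vs" "{..<n}"] bij
          by (auto simp: bij_betw_def)
        then show ?thesis using True by simp
      qed (use a(1) in auto)
    qed
    then have "combination (Matrix.vec n (\<lambda>i. a (vs ! i))) = u"
      unfolding combination_lincomb a(2)[symmetric] by simp
    then show "\<exists>c. c \<in> carrier_vec n \<and> u = combination c" by (metis vec_carrier)
  next
    fix c d assume cd: "c \<in> carrier_vec n \<and> u = combination c" "d \<in> carrier_vec n \<and> u = combination d"
    define r where "r c = (\<lambda>w\<in>set vs. vec_index c (inv_into {..<n} ((!) vs) w))" for c :: "'k Matrix.vec"
    have "r c = r d" using ex1 cd unfolding combination_lincomb r_def by (metis (no_types, lifting) PiE_iff UNIV_I restrict_extensional)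
    have "vec_index c i = vec_index d i" if "i < n" for i
      using fun_cong[OF \<open>r c = r d\<close>, of "vs ! i"] that by (simp add: r_def inv_into_f_f[OF inj])
    then show "c = d" using cd by (intro eq_vecI) auto
  qed
qed

lemma coordinates:
  assumes "u \<in> carrier V"
  shows coordinates_carrier: "coordinates V vs u \<in> carrier_vec n" and combination_coordinates: "combination (coordinates V vs u) = u"
  using theI'[OF ex1_combination[OF assms]] unfolding coordinates_def combination_def by auto

lemma coordinates_combination: "c \<in> carrier_vec n \<Longrightarrow> coordinates V vs (combination c) = c"
  using ex1_combination[OF combination_closed] coordinates[OF combination_closed, of c] by metis

lemma coordinates_inj:
  "u \<in> carrier V \<Longrightarrow> w \<in> carrier V \<Longrightarrow> coordinates V vs u = coordinates V vs w \<Longrightarrow> u = w"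
  by (metis combination_coordinates)

lemma coordinates_add:
  assumes "u \<in> carrier V" "w \<in> carrier V"
  shows "coordinates V vs (u \<oplus>\<^bsub>V\<^esub> w) = coordinates V vs u + coordinates V vs w"
proof -
  have "combination (coordinates V vs u + coordinates V vs w) =
      (\<Oplus>\<^bsub>V\<^esub>i\<in>{..<n}. vec_index (coordinates V vs u) i \<odot>\<^bsub>V\<^esub> vs ! i \<oplus>\<^bsub>V\<^esub> vec_index (coordinates V vs w) i \<odot>\<^bsub>V\<^esub> vs ! i)"
    unfolding combination_def
    by (rule finsum_cong') (use coordinates_carrier[OF assms(1)] coordinates_carrier[OF assms(2)] smult_l_distr in \<open>auto simp: class_ring_simps\<close>)
  also have "\<dots> = u \<oplus>\<^bsub>V\<^esub> w"
    by (subst finsum_addf) (auto simp: combination_coordinates[OF assms(1), unfolded combination_def]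
      combination_coordinates[OF assms(2), unfolded combination_def])
  finally show ?thesis
    using coordinates_combination[of "coordinates V vs u + coordinates V vs w"] coordinates_carrier assms by simp
qed

lemma coordinates_smult:
  assumes "u \<in> carrier V"
  shows "coordinates V vs (c \<odot>\<^bsub>V\<^esub> u) = c \<cdot>\<^sub>v coordinates V vs u"
proof -
  have "combination (c \<cdot>\<^sub>v coordinates V vs u) =
      (\<Oplus>\<^bsub>V\<^esub>i\<in>{..<n}. c \<odot>\<^bsub>V\<^esub> (vec_index (coordinates V vs u) i \<odot>\<^bsub>V\<^esub> vs ! i))"
    unfolding combination_def
    by (rule finsum_cong') (use coordinates_carrier[OF assms(1)] smult_assoc1 in \<open>auto simp: class_ring_simps\<close>)
  also have "\<dots> = c \<odot>\<^bsub>V\<^esub> combination (coordinates V vs u)"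
    unfolding combination_def by (rule finsum_smult[symmetric]) auto
  also have "\<dots> = c \<odot>\<^bsub>V\<^esub> u" using assms by (simp add: combination_coordinates)
  finally show ?thesis
    using coordinates_combination[of "c \<cdot>\<^sub>v coordinates V vs u"] coordinates_carrier assms by simp
qed

lemma coordinates_zero: "coordinates V vs \<zero>\<^bsub>V\<^esub> = 0\<^sub>v n"
proof -
  have "coordinates V vs \<zero>\<^bsub>V\<^esub> = 0 \<cdot>\<^sub>v coordinates V vs \<zero>\<^bsub>V\<^esub>"
    using coordinates_smult[of "\<zero>\<^bsub>V\<^esub>" 0] by simp
  also have "\<dots> = 0\<^sub>v n" using coordinates_carrier[of "\<zero>\<^bsub>V\<^esub>"] by auto
  finally show ?thesis .
qed

lemma coordinates_basis: assumes "i < n" shows "coordinates V vs (vs ! i) = unit_vec n i"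
proof -
  have "combination (unit_vec n i) = (\<Oplus>\<^bsub>V\<^esub>j\<in>{..<n}. if i = j then vs ! j else \<zero>\<^bsub>V\<^esub>)"
    unfolding combination_def
    by (rule finsum_cong') (use assms smult_l_null smult_one in \<open>auto simp: class_ring_simps\<close>)
  also have "\<dots> = vs ! i" using assms by (subst add.finprod_singleton) auto
  finally show ?thesis using coordinates_combination[of "unit_vec n i"] by simp
qed

lemma coordinates_matrix_of:
  assumes T: "\<And>u. u \<in> carrier V \<Longrightarrow> T u \<in> carrier V"
    and add: "\<And>u w. u \<in> carrier V \<Longrightarrow> w \<in> carrier V \<Longrightarrow> T (u \<oplus>\<^bsub>V\<^esub> w) = T u \<oplus>\<^bsub>V\<^esub> T w"
    and smult: "\<And>c u. u \<in> carrier V \<Longrightarrow> T (c \<odot>\<^bsub>V\<^esub> u) = c \<odot>\<^bsub>V\<^esub> T u"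
    and u: "u \<in> carrier V"
  shows "coordinates V vs (T u) = matrix_of V vs T *\<^sub>v coordinates V vs u"
proof -
  define c where "c = coordinates V vs u"
  have c: "c \<in> carrier_vec n" using u by (simp add: c_def coordinates_carrier)
  have T0: "T \<zero>\<^bsub>V\<^esub> = \<zero>\<^bsub>V\<^esub>" using add[of "\<zero>\<^bsub>V\<^esub>" "\<zero>\<^bsub>V\<^esub>"] T[of "\<zero>\<^bsub>V\<^esub>"] by (metis add.l_cancel_one zero_closed l_zero)
  have fin: "J \<subseteq> {..<n} \<Longrightarrow> coordinates V vs (T (\<Oplus>\<^bsub>V\<^esub>j\<in>J. vec_index c j \<odot>\<^bsub>V\<^esub> vs ! j)) =
      Matrix.vec n (\<lambda>i. \<Sum>j\<in>J. vec_index c j * vec_index (coordinates V vs (T (vs ! j))) i)" if "finite J" for J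
    using that
  proof (induction J)
    case empty then show ?case using coordinates_zero by (auto simp: T0)
  next
    case (insert j J)
    have "(\<Oplus>\<^bsub>V\<^esub>j\<in>insert j J. vec_index c j \<odot>\<^bsub>V\<^esub> vs ! j) =
        vec_index c j \<odot>\<^bsub>V\<^esub> vs ! j \<oplus>\<^bsub>V\<^esub> (\<Oplus>\<^bsub>V\<^esub>j\<in>J. vec_index c j \<odot>\<^bsub>V\<^esub> vs ! j)"
      using insert by (intro finsum_insert) auto
    moreover have "(\<Oplus>\<^bsub>V\<^esub>j\<in>J. vec_index c j \<odot>\<^bsub>V\<^esub> vs ! j) \<in> carrier V" using insert by (intro finsum_closed) auto
    ultimately show ?case
      using insert coordinates_carrier[OF T[of "vs ! j"]]
      by (simp add: add smult T coordinates_add coordinates_smult) auto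
  qed
  have "u = (\<Oplus>\<^bsub>V\<^esub>j\<in>{..<n}. vec_index c j \<odot>\<^bsub>V\<^esub> vs ! j)"
    using combination_coordinates[OF u] by (simp add: c_def combination_def)
  then have "coordinates V vs (T u) = Matrix.vec n (\<lambda>i. \<Sum>j<n. vec_index c j * vec_index (coordinates V vs (T (vs ! j))) i)"
    using fin[of "{..<n}"] by simp
  also have "\<dots> = matrix_of V vs T *\<^sub>v c"
    using c by (intro eq_vecI) (auto simp: matrix_of_def scalar_prod_def lessThan_atLeast0 mult.commute)
  finally show ?thesis by (simp add: c_def)
qed

lemma matrix_of_carrier: "matrix_of V vs T \<in> carrier_mat n n"
  by (simp add: matrix_of_def)

end

section \<open>Exact sequences and reciprocal characteristic polynomials\<close>

lemma diff_add_vec: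
  fixes v w :: "'a :: group_add Matrix.vec"
  assumes "v \<in> carrier_vec n" "w \<in> carrier_vec n"
  shows "v - w + w = v"
  using assms by (intro eq_vecI) auto

lemma mult_mat_zero_vec:
  fixes P :: "'a :: semiring_0 mat"
  assumes "P \<in> carrier_mat m n"
  shows "P *\<^sub>v 0\<^sub>v n = 0\<^sub>v m"
  using assms by (intro eq_vecI) auto

lemma mat_unit_vec_col:
  fixes P :: "'a :: comm_ring_1 mat"
  assumes "P \<in> carrier_mat m n" "i < n"
  shows "P *\<^sub>v unit_vec n i = Matrix.col P i"
  using assms by (intro eq_vecI) auto

lemma eq_mat_unit_vecI:
  assumes P: "P \<in> carrier_mat m n" and Q: "Q \<in> carrier_mat m n"
    and eq: "\<And>i. i < n \<Longrightarrow> P *\<^sub>v unit_vec n i = Q *\<^sub>v (unit_vec n i :: 'a :: comm_ring_1 Matrix.vec)"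
  shows "P = Q"
proof (rule eq_matI)
  fix i j assume "i < dim_row Q" "j < dim_col Q"
  moreover from this have "Matrix.col P j = Matrix.col Q j"
    using eq[of j] P Q by (simp add: mat_unit_vec_col[of _ m n])
  ultimately show "P $$ (i, j) = Q $$ (i, j)"
    using P Q by (metis carrier_matD index_col)
qed (use P Q in auto)

lemma mat_of_unit_vec_images:
  assumes "\<And>i. i < k \<Longrightarrow> y i \<in> carrier_vec n"
  obtains Y where "Y \<in> carrier_mat n k" "\<And>i. i < k \<Longrightarrow> Y *\<^sub>v unit_vec k i = (y i :: 'a :: comm_ring_1 Matrix.vec)"
proof (rule that[of "Matrix.mat n k (\<lambda>(i, j). vec_index (y j) i)"])
  fix i assume "i < k"
  moreover have "Matrix.col (Matrix.mat n k (\<lambda>(i, j). vec_index (y j) i)) i = y i"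
    using assms[OF \<open>i < k\<close>] \<open>i < k\<close> by (intro eq_vecI) auto
  ultimately show "Matrix.mat n k (\<lambda>(i, j). vec_index (y j) i) *\<^sub>v unit_vec k i = y i"
    by (subst mat_unit_vec_col[of _ n k]) auto
qed simp

text \<open>With fewer rows than columns, padding by zero rows gives a singular square matrix with
  the same kernel.\<close>

lemma injective_mat_dim_le:
  fixes P :: "'a :: field mat"
  assumes P: "P \<in> carrier_mat r s" and inj: "\<And>v. v \<in> carrier_vec s \<Longrightarrow> P *\<^sub>v v = 0\<^sub>v r \<Longrightarrow> v = 0\<^sub>v s"
  shows "s \<le> r"
proof (rule ccontr)
  assume "\<not> s \<le> r"
  then have rs: "r < s" by simp
  define Q where "Q = Matrix.mat s s (\<lambda>(i, j). if i < r then P $$ (i, j) else 0)"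
  have Q: "Q \<in> carrier_mat s s" by (simp add: Q_def)
  have "Q\<^sup>T *\<^sub>v unit_vec s r = 0\<^sub>v s"
    using rs by (intro eq_vecI) (auto simp: Q_def mat_unit_vec_col[of _ s s] row_def)
  moreover have "unit_vec s r \<noteq> (0\<^sub>v s :: 'a Matrix.vec)" using rs by (simp add: unit_vec_nonzero)
  ultimately have "Determinant.det Q\<^sup>T = 0"
    using det_0_iff_vec_prod_zero_field[of "Q\<^sup>T" s] Q by (metis transpose_carrier_mat unit_vec_carrier)
  then have "Determinant.det Q = 0" using Determinant.det_transpose[OF Q] by simp
  then obtain v where v: "v \<in> carrier_vec s" "v \<noteq> 0\<^sub>v s" "Q *\<^sub>v v = 0\<^sub>v s"
    using det_0_iff_vec_prod_zero_field[OF Q] by blast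
  have "P *\<^sub>v v = 0\<^sub>v r"
  proof (rule eq_vecI)
    fix i assume i: "i < dim_vec (0\<^sub>v r :: 'a Matrix.vec)"
    then have "vec_index (Q *\<^sub>v v) i = 0" using v rs by simp
    moreover have "Matrix.row Q i = Matrix.row P i" using i rs P by (intro eq_vecI) (auto simp: Q_def)
    ultimately show "vec_index (P *\<^sub>v v) i = vec_index (0\<^sub>v r) i" using i rs P Q by simp
  qed (use P in auto)
  then show False using inj v by blast
qed

text \<open>A short exact sequence of finite-dimensional spaces with compatible endomorphisms, in
  coordinates: \<open>I\<close> is the inclusion, \<open>P\<close> the projection.\<close>

lemma char_poly_exact_sequence:
  fixes M :: "'a :: field mat"
  assumes I: "I \<in> carrier_mat m n" and P: "P \<in> carrier_mat k m"
    and M: "M \<in> carrier_mat m m" and X: "X \<in> carrier_mat n n" and H: "H \<in> carrier_mat k k"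
    and MI: "M * I = I * X" and PM: "P * M = H * P"
    and inj: "\<And>v. v \<in> carrier_vec n \<Longrightarrow> I *\<^sub>v v = 0\<^sub>v m \<Longrightarrow> v = 0\<^sub>v n"
    and surj: "\<And>w. w \<in> carrier_vec k \<Longrightarrow> \<exists>v\<in>carrier_vec m. P *\<^sub>v v = w"
    and PI: "\<And>v. v \<in> carrier_vec n \<Longrightarrow> P *\<^sub>v (I *\<^sub>v v) = 0\<^sub>v k"
    and exact: "\<And>w. w \<in> carrier_vec m \<Longrightarrow> P *\<^sub>v w = 0\<^sub>v k \<Longrightarrow> \<exists>v\<in>carrier_vec n. w = I *\<^sub>v v"
  shows "char_poly M = char_poly X * char_poly H"
proof -
  have "\<forall>i. \<exists>v. i < k \<longrightarrow> v \<in> carrier_vec m \<and> P *\<^sub>v v = unit_vec k i" using surj by (metis unit_vec_carrier)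
  \<comment> \<open>Preimages of the unit vectors form the columns of a linear section
    \<open>S\<close> of \<open>P\<close>.\<close>
  then obtain s where s: "\<And>i. i < k \<Longrightarrow> s i \<in> carrier_vec m \<and> P *\<^sub>v s i = unit_vec k i" by metis
  then obtain S where S: "S \<in> carrier_mat m k" "\<And>i. i < k \<Longrightarrow> S *\<^sub>v unit_vec k i = s i"
    using mat_of_unit_vec_images[of k s m] by blast
  have PS: "P * S = 1\<^sub>m k"
    by (rule eq_mat_unit_vecI[of _ k k]) (use P S s in auto)
  have PSv: "P *\<^sub>v (S *\<^sub>v w) = w" if "w \<in> carrier_vec k" for w
    using that P S PS by (metis assoc_mult_mat_vec one_mult_mat_vec)
  \<comment> \<open>The failure of \<open>S\<close> to intertwine \<open>H\<close> and
    \<open>M\<close> lies in the kernel of \<open>P\<close>, hence in the image of \<open>I\<close>.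
    It becomes the corner block \<open>Y\<close>.\<close>
  have MS: "\<exists>y. y \<in> carrier_vec n \<and> M *\<^sub>v (S *\<^sub>v w) = I *\<^sub>v y + S *\<^sub>v (H *\<^sub>v w)" if w: "w \<in> carrier_vec k" for w
  proof -
    have c: "M *\<^sub>v (S *\<^sub>v w) \<in> carrier_vec m" "S *\<^sub>v (H *\<^sub>v w) \<in> carrier_vec m" using M S H w by auto
    have "P *\<^sub>v (M *\<^sub>v (S *\<^sub>v w)) = (P * M) *\<^sub>v (S *\<^sub>v w)" using P M S w by (subst assoc_mult_mat_vec) auto
    also have "\<dots> = H *\<^sub>v w" unfolding PM using P H S w PSv by (subst assoc_mult_mat_vec) auto
    finally have "P *\<^sub>v (M *\<^sub>v (S *\<^sub>v w) - S *\<^sub>v (H *\<^sub>v w)) = 0\<^sub>v k"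
      using PSv[of "H *\<^sub>v w"] H w c P by (simp add: mult_minus_distrib_mat_vec[OF P])
    then obtain y where y: "y \<in> carrier_vec n" "M *\<^sub>v (S *\<^sub>v w) - S *\<^sub>v (H *\<^sub>v w) = I *\<^sub>v y"
      using exact c by (metis minus_carrier_vec)
    show ?thesis using y diff_add_vec[OF c] by metis
  qed
  then have "\<forall>i. \<exists>y. i < k \<longrightarrow> y \<in> carrier_vec n \<and>
      M *\<^sub>v (S *\<^sub>v unit_vec k i) = I *\<^sub>v y + S *\<^sub>v (H *\<^sub>v unit_vec k i)" by auto
  then obtain y where y: "\<And>i. i < k \<Longrightarrow> y i \<in> carrier_vec n \<and>
      M *\<^sub>v (S *\<^sub>v unit_vec k i) = I *\<^sub>v y i + S *\<^sub>v (H *\<^sub>v unit_vec k i)" by metis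
  then obtain Y where Y: "Y \<in> carrier_mat n k" "\<And>i. i < k \<Longrightarrow> Y *\<^sub>v unit_vec k i = y i"
    using mat_of_unit_vec_images[of k y n] by blast
  have MSY: "M * S = I * Y + S * H"
  proof (rule eq_mat_unit_vecI[of _ m k])
    fix i assume i: "i < k"
    have "(I * Y + S * H) *\<^sub>v unit_vec k i = (I * Y) *\<^sub>v unit_vec k i + (S * H) *\<^sub>v unit_vec k i"
      using I Y S H by (intro add_mult_distrib_mat_vec) auto
    then show "(M * S) *\<^sub>v unit_vec k i = (I * Y + S * H) *\<^sub>v unit_vec k i"
      using i M S I Y H y[OF i] by (simp add: assoc_mult_mat_vec[of _ m])
  qed (use M S I Y H in auto)
  \<comment> \<open>\<open>I\<close> and \<open>S\<close> side by side, as a block matrix with empty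
    lower half; it is the change of basis adapted to the sequence.\<close>
  define F where "F = four_block_mat I S (0\<^sub>m 0 n) (0\<^sub>m 0 k)"
  have F: "F \<in> carrier_mat m (n + k)" using I S by (auto simp: F_def)
  have Fv: "F *\<^sub>v (a @\<^sub>v d) = I *\<^sub>v a + S *\<^sub>v d" if "a \<in> carrier_vec n" "d \<in> carrier_vec k" for a d
    unfolding F_def using four_block_mat_mult_vec[OF I S(1) zero_carrier_mat zero_carrier_mat that] I S that
    by (auto intro!: eq_vecI)
  have split: "\<exists>a d. a \<in> carrier_vec n \<and> d \<in> carrier_vec k \<and> w = a @\<^sub>v d" if "w \<in> carrier_vec (n + k)" for w :: "'a Matrix.vec"
    using that by (metis vec_first_carrier vec_last_carrier vec_first_last_append)
  have F_inj: "w = 0\<^sub>v (n + k)" if w: "w \<in> carrier_vec (n + k)" "F *\<^sub>v w = 0\<^sub>v m" for w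
  proof -
    obtain a d where ad: "a \<in> carrier_vec n" "d \<in> carrier_vec k" "w = a @\<^sub>v d" using split w by blast
    have 0: "I *\<^sub>v a + S *\<^sub>v d = 0\<^sub>v m" using w Fv ad by simp
    have "P *\<^sub>v (I *\<^sub>v a + S *\<^sub>v d) = P *\<^sub>v (I *\<^sub>v a) + P *\<^sub>v (S *\<^sub>v d)"
      using P I S ad by (intro mult_add_distrib_mat_vec) auto
    then have "d = 0\<^sub>v k" using 0 PI PSv ad P by (auto simp: PI)
    moreover from this have "a = 0\<^sub>v n" using 0 inj ad I mult_mat_zero_vec[OF S(1)] by auto
    ultimately show ?thesis using ad by auto
  qed
  have F_surj: "\<exists>v\<in>carrier_vec (n + k). F *\<^sub>v v = w" if w: "w \<in> carrier_vec m" for w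
  proof -
    have c: "P *\<^sub>v w \<in> carrier_vec k" "S *\<^sub>v (P *\<^sub>v w) \<in> carrier_vec m" using P S w by auto
    have "P *\<^sub>v (w - S *\<^sub>v (P *\<^sub>v w)) = 0\<^sub>v k"
      using c w PSv[of "P *\<^sub>v w"] by (simp add: mult_minus_distrib_mat_vec[OF P])
    then obtain a where a: "a \<in> carrier_vec n" "w - S *\<^sub>v (P *\<^sub>v w) = I *\<^sub>v a" using exact w c by (metis minus_carrier_vec)
    have "w = (w - S *\<^sub>v (P *\<^sub>v w)) + S *\<^sub>v (P *\<^sub>v w)" using diff_add_vec[OF w c(2)] by simp
    then have "F *\<^sub>v (a @\<^sub>v (P *\<^sub>v w)) = w" using Fv[OF a(1) c(1)] a(2) by simp
    moreover have "a @\<^sub>v (P *\<^sub>v w) \<in> carrier_vec (n + k)" using a c by auto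
    ultimately show ?thesis by blast
  qed
  have "\<forall>i. \<exists>v. i < m \<longrightarrow> v \<in> carrier_vec (n + k) \<and> F *\<^sub>v v = unit_vec m i" using F_surj by (metis unit_vec_carrier)
  then obtain g where g: "\<And>i. i < m \<Longrightarrow> g i \<in> carrier_vec (n + k) \<and> F *\<^sub>v g i = unit_vec m i" by metis
  then obtain G where G: "G \<in> carrier_mat (n + k) m" "\<And>i. i < m \<Longrightarrow> G *\<^sub>v unit_vec m i = g i"
    using mat_of_unit_vec_images[of m g "n + k"] by blast
  have FG: "F * G = 1\<^sub>m m"
    by (rule eq_mat_unit_vecI[of _ m m]) (use F G g in auto)
  \<comment> \<open>Injectivity of \<open>G\<close> and of \<open>F\<close> compares the dimensions
    both ways. Once \<open>F\<close> is known to be square, its right inverse is also a left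
    inverse.\<close>
  have "m \<le> n + k"
  proof (rule injective_mat_dim_le[OF G(1)])
    fix v assume "v \<in> carrier_vec m" "G *\<^sub>v v = 0\<^sub>v (n + k)"
    then show "v = 0\<^sub>v m" using FG F G mult_mat_zero_vec[OF F] by (metis assoc_mult_mat_vec one_mult_mat_vec)
  qed
  moreover have "n + k \<le> m" by (rule injective_mat_dim_le[OF F F_inj])
  ultimately have m: "m = n + k" by simp
  have GF: "G * F = 1\<^sub>m m" using mat_mult_left_right_inverse[of F m G] F G FG m by simp
  define N where "N = four_block_mat X Y (0\<^sub>m k n) H"
  have N: "N \<in> carrier_mat m m" using X Y H m by (auto simp: N_def)
  have "M * F = F * N"
  proof (rule eq_mat_unit_vecI[of _ m m])
    fix i assume i: "i < m"
    obtain a d where ad: "a \<in> carrier_vec n" "d \<in> carrier_vec k" "(unit_vec m i :: 'a Matrix.vec) = a @\<^sub>v d"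
      using split m by (metis unit_vec_carrier)
    have "(M * F) *\<^sub>v (a @\<^sub>v d) = M *\<^sub>v (I *\<^sub>v a + S *\<^sub>v d)"
      using M F ad m Fv by (subst assoc_mult_mat_vec[of _ m m _ m]) auto
    also have "\<dots> = (M * I) *\<^sub>v a + (M * S) *\<^sub>v d"
      using M I S ad by (simp add: mult_add_distrib_mat_vec[of _ m m] assoc_mult_mat_vec[of _ m m])
    also have "\<dots> = I *\<^sub>v (X *\<^sub>v a) + (I *\<^sub>v (Y *\<^sub>v d) + S *\<^sub>v (H *\<^sub>v d))"
      unfolding MI MSY using I X Y S H ad
      by (simp add: add_mult_distrib_mat_vec[of _ m k] assoc_mult_mat_vec[of _ m])
    also have "\<dots> = I *\<^sub>v (X *\<^sub>v a + Y *\<^sub>v d) + S *\<^sub>v (H *\<^sub>v d)"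
    proof -
      have "I *\<^sub>v (X *\<^sub>v a + Y *\<^sub>v d) = I *\<^sub>v (X *\<^sub>v a) + I *\<^sub>v (Y *\<^sub>v d)"
        using I X Y ad by (intro mult_add_distrib_mat_vec) auto
      then show ?thesis using I X Y S H ad
        by (simp add: assoc_add_vec[of "I *\<^sub>v (X *\<^sub>v a)" m "I *\<^sub>v (Y *\<^sub>v d)" "S *\<^sub>v (H *\<^sub>v d)"])
    qed
    also have "\<dots> = F *\<^sub>v ((X *\<^sub>v a + Y *\<^sub>v d) @\<^sub>v (H *\<^sub>v d))" using Fv X Y H ad by simp
    also have "(X *\<^sub>v a + Y *\<^sub>v d) @\<^sub>v (H *\<^sub>v d) = N *\<^sub>v (a @\<^sub>v d)"
    proof -
      have "0\<^sub>m k n *\<^sub>v a = 0\<^sub>v k" using ad by (intro eq_vecI) auto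
      then show ?thesis
        unfolding N_def using four_block_mat_mult_vec[OF X Y(1) zero_carrier_mat H ad(1,2)] H ad by simp
    qed
    also have "F *\<^sub>v (N *\<^sub>v (a @\<^sub>v d)) = (F * N) *\<^sub>v (a @\<^sub>v d)"
      using F N ad m by (subst assoc_mult_mat_vec[of _ m m _ m]) auto
    finally show "(M * F) *\<^sub>v unit_vec m i = (F * N) *\<^sub>v unit_vec m i" unfolding ad(3) .
  qed (use M F N m in auto)
  moreover have "M * F * G = M"
    using assoc_mult_mat[OF M F G(1)] FG M by simp
  ultimately have "M = F * N * G" by simp
  then have "similar_mat M N"
    unfolding similar_mat_def similar_mat_wit_def Let_def using M N F G FG GF m by (intro exI[of _ F] exI[of _ G]) auto
  then have "char_poly M = char_poly N" by (rule char_poly_similar)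
  also have "\<dots> = char_poly X * char_poly H"
  proof -
    have "char_poly_matrix N = four_block_mat (char_poly_matrix X) (map_mat (\<lambda>a. [:- a:]) Y) (0\<^sub>m k n) (char_poly_matrix H)"
      unfolding N_def char_poly_matrix_def using X Y H by (intro eq_matI) auto
    then show ?thesis
      unfolding char_poly_def using X Y H det_four_block_mat_lower_left_zero[of "char_poly_matrix X" n "map_mat (\<lambda>a. [:- a:]) Y" k]
      by simp
  qed
  finally show ?thesis .
qed

abbreviation const_mat :: "'a :: comm_ring_1 mat \<Rightarrow> 'a poly mat" where
  "const_mat \<equiv> map_mat (\<lambda>a. [:a:])"

lemma comm_ring_hom_const: "comm_ring_hom (\<lambda>a :: 'a :: comm_ring_1. [:a:])"
  by unfold_locales (auto simp: one_pCons)

lemma det_const_mat: "Determinant.det (const_mat M) = [:Determinant.det M:]"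
  by (rule comm_ring_hom.hom_det[OF comm_ring_hom_const])

text \<open>The isometries \<open>M\<close> of a nondegenerate bilinear form \<open>W\<close> have a reciprocal characteristic
  polynomial, as \<open>W\<close> conjugates \<open>M\<close> to the inverse of its transpose.\<close>

lemma char_poly_isometry:
  fixes M W :: "'a :: field mat"
  assumes M: "M \<in> carrier_mat n n" and W: "W \<in> carrier_mat n n"
    and iso: "M\<^sup>T * W * M = W" and det: "Determinant.det W \<noteq> 0"
  obtains c where "c \<noteq> 0" "Determinant.det (1\<^sub>m n - [:0, 1:] \<cdot>\<^sub>m const_mat M) = [:c:] * char_poly M"
proof -
  define d where "d = Determinant.det M"
  have "Determinant.det (M\<^sup>T * W * M) = d * Determinant.det W * d"
    using M W by (simp add: det_mult[of _ n] d_def Determinant.det_transpose)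
  then have d0: "d \<noteq> 0" using iso det by auto
  \<comment> \<open>By \<open>M\<^sup>T * W * M = W\<close>, multiplying 1 - t M by
    \<open>M\<^sup>T * W\<close> gives \<open>M\<^sup>T\<close> minus t, times
    \<open>W\<close>.\<close>
  have "const_mat (M\<^sup>T * W) * (1\<^sub>m n - [:0, 1:] \<cdot>\<^sub>m const_mat M) = - char_poly_matrix (M\<^sup>T) * const_mat W"
  proof -
    have "const_mat (M\<^sup>T * W) * (1\<^sub>m n - [:0, 1:] \<cdot>\<^sub>m const_mat M) =
        const_mat (M\<^sup>T * W) - [:0, 1:] \<cdot>\<^sub>m (const_mat (M\<^sup>T * W) * const_mat M)"
      using M W mult_minus_distrib_mat[of "const_mat (M\<^sup>T * W)" n n "1\<^sub>m n" n "[:0, 1:] \<cdot>\<^sub>m const_mat M"]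
        mult_smult_distrib[of "const_mat (M\<^sup>T * W)" n n "const_mat M" n]
        right_mult_one_mat[of "const_mat (M\<^sup>T * W)" n n]
      by (simp del: right_mult_one_mat)
    also have "const_mat (M\<^sup>T * W) * const_mat M = const_mat W"
      using M W by (subst map_poly_mult(1)[of _ n n _ n, symmetric]) (auto simp: iso)
    also have split: "const_mat (M\<^sup>T * W) = const_mat (M\<^sup>T) * const_mat W"
      using M W by (intro map_poly_mult(1)[of _ n n _ n]) auto
    also have "const_mat (M\<^sup>T) * const_mat W - [:0, 1:] \<cdot>\<^sub>m const_mat W = - char_poly_matrix (M\<^sup>T) * const_mat W"
    proof -
      have "- char_poly_matrix (M\<^sup>T) = const_mat (M\<^sup>T) - [:0, 1:] \<cdot>\<^sub>m 1\<^sub>m n"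
        using M by (intro eq_matI) (auto simp: char_poly_matrix_def)
      then show ?thesis using M W
        using minus_mult_distrib_mat[of "const_mat (M\<^sup>T)" n n "[:0, 1:] \<cdot>\<^sub>m 1\<^sub>m n" "const_mat W" n]
          mult_smult_assoc_mat[of "1\<^sub>m n" n n "const_mat W" n "[:0, 1:]"] by simp
    qed
    finally show ?thesis unfolding split .
  qed
  from arg_cong[OF this, of Determinant.det]
  have "[:d * Determinant.det W:] * Determinant.det (1\<^sub>m n - [:0, 1:] \<cdot>\<^sub>m const_mat M) =
      Determinant.det (- char_poly_matrix (M\<^sup>T)) * [:Determinant.det W:]"
    using M W det_mult[of "const_mat (M\<^sup>T * W)" n "1\<^sub>m n - [:0, 1:] \<cdot>\<^sub>m const_mat M"]
      det_mult[of "M\<^sup>T" n W] det_mult[of "- char_poly_matrix (M\<^sup>T)" n "const_mat W"]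
    by (simp add: det_const_mat d_def Determinant.det_transpose[OF M] char_poly_matrix_closed[of _ n] minus_carrier_mat[of _ n n] mult.commute)
  also have "Determinant.det (- char_poly_matrix (M\<^sup>T)) = (- 1) ^ n * char_poly M"
  proof -
    have "- char_poly_matrix (M\<^sup>T) = (- 1) \<cdot>\<^sub>m char_poly_matrix (M\<^sup>T)" by (intro eq_matI) auto
    moreover have "dim_col (char_poly_matrix (M\<^sup>T)) = n" using M by (simp add: char_poly_matrix_def)
    ultimately show ?thesis
      using char_poly_transpose_mat[OF M] by (simp add: det_smult char_poly_def)
  qed
  finally have eq: "[:d * Determinant.det W:] * Determinant.det (1\<^sub>m n - [:0, 1:] \<cdot>\<^sub>m const_mat M) =
      (- 1) ^ n * char_poly M * [:Determinant.det W:]" .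
  \<comment> \<open>The sign comes from exchanging t - M with M - t, the divisor from the
    determinant of the factor \<open>M\<^sup>T\<close>.\<close>
  define c where "c = (- 1) ^ n / d"
  have "Determinant.det (1\<^sub>m n - [:0, 1:] \<cdot>\<^sub>m const_mat M) =
     [:1 / (d * Determinant.det W):] * ([:d * Determinant.det W:] * Determinant.det (1\<^sub>m n - [:0, 1:] \<cdot>\<^sub>m const_mat M))"
    using d0 det by simp
  also have "\<dots> = [:c:] * char_poly M"
  proof -
    have "(- 1) ^ n = [:(- 1 :: 'a) ^ n:]" by (induction n) (simp_all add: one_pCons)
    then show ?thesis unfolding eq using d0 det by (simp add: c_def field_simps)
  qed
  finally show thesis using that[of c] d0 by (simp add: c_def)
qed

section \<open>Cocycles on the fiber\<close>

locale quotient_vectorspace = vectorspace class_ring V + submodule class_ring W V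
  for V :: "('k :: field, 'v, 'm) module_scheme" (structure) and W :: "'v set"
begin

lemma subspace_minus: assumes "w \<in> W" shows "\<ominus>\<^bsub>V\<^esub> w \<in> W"
proof -
  have w: "w \<in> carrier V" using assms subset by auto
  have "(- 1) \<odot>\<^bsub>V\<^esub> w = \<ominus>\<^bsub>V\<^esub> w"
    using smult_l_minus[of 1 w] w smult_one[OF w] by (simp add: class_ring_simps)
  then show ?thesis using submodule.smult_closed[OF submodule_axioms, of "- 1" w] assms by simp
qed

sublocale quotient: abelian_subgroup W V
proof (rule abelian_subgroupI3)
  have "subgroup W (add_monoid V)"
  proof (rule add.subgroupI)
    show "W \<noteq> {}" using submodule.zero_closed[OF submodule_axioms] by blast
  qed (use subset m_closed subspace_minus in \<open>auto simp flip: a_inv_def\<close>)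
  then show "additive_subgroup W V" by (rule additive_subgroup.intro)
qed (rule abelian_group_axioms)

abbreviation "Q \<equiv> quotient_space V W"

definition coset :: "'v \<Rightarrow> 'v set" where "coset u = W +>\<^bsub>V\<^esub> u"

lemma carrier_quotient: "carrier Q = coset ` carrier V"
  by (auto simp: quotient_space_def A_RCOSETS_def' coset_def)

lemma coset_add: "u \<in> carrier V \<Longrightarrow> w \<in> carrier V \<Longrightarrow> coset u \<oplus>\<^bsub>Q\<^esub> coset w = coset (u \<oplus>\<^bsub>V\<^esub> w)"
  by (simp add: quotient_space_def coset_def quotient.a_rcos_sum)

lemma mem_coset: "u \<in> carrier V \<Longrightarrow> w \<in> coset u \<longleftrightarrow> (\<exists>h\<in>W. w = h \<oplus>\<^bsub>V\<^esub> u)"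
  by (auto simp: coset_def a_r_coset_def')

lemma coset_eqI: "u \<in> carrier V \<Longrightarrow> w \<in> coset u \<Longrightarrow> coset w = coset u"
  unfolding coset_def using quotient.a_repr_independence' by blast

lemma coset_self: "u \<in> carrier V \<Longrightarrow> u \<in> coset u"
  unfolding coset_def by (rule quotient.a_rcos_self)

lemma smult_carrier [simp]: "u \<in> carrier V \<Longrightarrow> c \<odot>\<^bsub>V\<^esub> u \<in> carrier V"
  by (rule module.smult_closed) auto

lemma smult_mem_coset:
  assumes u: "u \<in> carrier V" and w: "w \<in> coset u"
  shows "r \<odot>\<^bsub>V\<^esub> w \<in> coset (r \<odot>\<^bsub>V\<^esub> u)"
proof -
  obtain h where h: "h \<in> W" "w = h \<oplus>\<^bsub>V\<^esub> u" using w unfolding mem_coset[OF u] by (elim bexE)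
  then have hV: "h \<in> carrier V" using subset by blast
  have "r \<odot>\<^bsub>V\<^esub> w = r \<odot>\<^bsub>V\<^esub> h \<oplus>\<^bsub>V\<^esub> r \<odot>\<^bsub>V\<^esub> u"
    unfolding h(2) by (rule smult_r_distr[OF _ hV u]) simp
  moreover have "r \<odot>\<^bsub>V\<^esub> h \<in> W" by (rule submodule.smult_closed[OF submodule_axioms _ h(1)]) simp
  ultimately show ?thesis unfolding mem_coset[OF smult_carrier[OF u]] by (intro bexI)
qed

text \<open>Scalar multiplication on the quotient is a union over all representatives, and each of
  them contributes the same coset.\<close>

lemma coset_smult: assumes u: "u \<in> carrier V" shows "r \<odot>\<^bsub>Q\<^esub> coset u = coset (r \<odot>\<^bsub>V\<^esub> u)"
proof -
  have eq: "coset (r \<odot>\<^bsub>V\<^esub> w) = coset (r \<odot>\<^bsub>V\<^esub> u)" if "w \<in> coset u" for w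
    by (rule coset_eqI[OF smult_carrier[OF u] smult_mem_coset[OF u that]])
  have "(\<Union>w\<in>coset u. coset (r \<odot>\<^bsub>V\<^esub> w)) = (\<Union>w\<in>coset u. coset (r \<odot>\<^bsub>V\<^esub> u))"
    by (rule SUP_cong[OF refl eq])
  also have "\<dots> = coset (r \<odot>\<^bsub>V\<^esub> u)" using coset_self[OF u] by blast
  finally show ?thesis by (simp add: quotient_space_def coset_def)
qed

lemma zero_quotient: "\<zero>\<^bsub>Q\<^esub> = W" by (simp add: quotient_space_def)

lemma coset_eq_zero_iff: assumes "u \<in> carrier V" shows "coset u = W \<longleftrightarrow> u \<in> W"
proof
  assume "coset u = W" then show "u \<in> W" using coset_self[OF assms] by simp
next
  assume "u \<in> W"
  then show "coset u = W" unfolding coset_def using quotient.a_rcos_const by simp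
qed

lemma coset_zero: "coset \<zero>\<^bsub>V\<^esub> = \<zero>\<^bsub>Q\<^esub>"
  unfolding zero_quotient using coset_eq_zero_iff[of "\<zero>\<^bsub>V\<^esub>"] submodule.zero_closed[OF submodule_axioms] by simp

lemma quotient_module: "module class_ring Q"
proof (rule module_criteria)
  show "cring (class_ring :: 'k ring)" by (rule class_cring.cring_axioms)
  show "\<zero>\<^bsub>Q\<^esub> \<in> carrier Q" unfolding coset_zero[symmetric] carrier_quotient by simp
  show "\<forall>v w. v \<in> carrier Q \<and> w \<in> carrier Q \<longrightarrow> v \<oplus>\<^bsub>Q\<^esub> w \<in> carrier Q"
    by (auto simp: carrier_quotient coset_add)
  show "\<forall>v\<in>carrier Q. \<exists>neg_v\<in>carrier Q. v \<oplus>\<^bsub>Q\<^esub> neg_v = \<zero>\<^bsub>Q\<^esub>"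
  proof
    fix v assume "v \<in> carrier Q"
    then obtain u where u: "u \<in> carrier V" "v = coset u" by (auto simp: carrier_quotient)
    then have "v \<oplus>\<^bsub>Q\<^esub> coset (\<ominus>\<^bsub>V\<^esub> u) = \<zero>\<^bsub>Q\<^esub>" by (simp add: coset_add r_neg coset_zero)
    then show "\<exists>neg_v\<in>carrier Q. v \<oplus>\<^bsub>Q\<^esub> neg_v = \<zero>\<^bsub>Q\<^esub>" using u by (auto simp: carrier_quotient)
  qed
  show "\<forall>c v. c \<in> carrier class_ring \<and> v \<in> carrier Q \<longrightarrow> c \<odot>\<^bsub>Q\<^esub> v \<in> carrier Q"
    by (auto simp: carrier_quotient coset_smult)
  show "\<forall>v w. v \<in> carrier Q \<and> w \<in> carrier Q \<longrightarrow> v \<oplus>\<^bsub>Q\<^esub> w = w \<oplus>\<^bsub>Q\<^esub> v"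
    by (auto simp: carrier_quotient coset_add a_comm)
  show "\<forall>v w x. v \<in> carrier Q \<and> w \<in> carrier Q \<and> x \<in> carrier Q \<longrightarrow> v \<oplus>\<^bsub>Q\<^esub> w \<oplus>\<^bsub>Q\<^esub> x = v \<oplus>\<^bsub>Q\<^esub> (w \<oplus>\<^bsub>Q\<^esub> x)"
    by (auto simp: carrier_quotient coset_add a_assoc)
  show "\<forall>v\<in>carrier Q. v \<oplus>\<^bsub>Q\<^esub> \<zero>\<^bsub>Q\<^esub> = v"
    unfolding coset_zero[symmetric] by (auto simp: carrier_quotient coset_add)
  show "\<forall>a b v. a \<in> carrier class_ring \<and> b \<in> carrier class_ring \<and> v \<in> carrier Q \<longrightarrow>
      (a \<otimes>\<^bsub>class_ring\<^esub> b) \<odot>\<^bsub>Q\<^esub> v = a \<odot>\<^bsub>Q\<^esub> (b \<odot>\<^bsub>Q\<^esub> v)"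
    using smult_assoc1 by (auto simp: carrier_quotient coset_smult)
  show "\<forall>v\<in>carrier Q. \<one>\<^bsub>class_ring\<^esub> \<odot>\<^bsub>Q\<^esub> v = v"
    using smult_one by (auto simp: carrier_quotient coset_smult)
  show "\<forall>a b v. a \<in> carrier class_ring \<and> b \<in> carrier class_ring \<and> v \<in> carrier Q \<longrightarrow>
      (a \<oplus>\<^bsub>class_ring\<^esub> b) \<odot>\<^bsub>Q\<^esub> v = a \<odot>\<^bsub>Q\<^esub> v \<oplus>\<^bsub>Q\<^esub> b \<odot>\<^bsub>Q\<^esub> v"
    using smult_l_distr by (auto simp: carrier_quotient coset_smult coset_add)
  show "\<forall>a v w. a \<in> carrier class_ring \<and> v \<in> carrier Q \<and> w \<in> carrier Q \<longrightarrow>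
      a \<odot>\<^bsub>Q\<^esub> (v \<oplus>\<^bsub>Q\<^esub> w) = a \<odot>\<^bsub>Q\<^esub> v \<oplus>\<^bsub>Q\<^esub> a \<odot>\<^bsub>Q\<^esub> w"
    using smult_r_distr by (auto simp: carrier_quotient coset_smult coset_add)
qed

lemma quotient_is_vectorspace: "vectorspace class_ring Q"
  using quotient_module class_field by (simp add: vectorspace_def)

end

lemma trace_scaleR: "Determinants.trace (c *\<^sub>R X) = c * Determinants.trace (X :: real ^ 'n ^ 'n)"
  by (simp add: Determinants.trace_def sum_distrib_left)

lemma trace_minus: "Determinants.trace (- X) = - Determinants.trace (X :: real ^ 'n ^ 'n)"
  by (simp add: Determinants.trace_def sum_negf)

lemma matrix_mult_add_left: "(X + Y) ** Z = X ** Z + Y ** (Z :: real ^ 'k ^ 'n)"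
  by (simp add: matrix_matrix_mult_def Finite_Cartesian_Product.vec_eq_iff sum.distrib distrib_right)

lemma sl4_simps [simp]:
  "u \<oplus>\<^bsub>sl4\<^esub> w = u + w" "c \<odot>\<^bsub>sl4\<^esub> u = c *\<^sub>R u" "\<zero>\<^bsub>sl4\<^esub> = 0"
  "u \<in> carrier sl4 \<longleftrightarrow> Determinants.trace u = 0"
  by (auto simp: sl4_def)

lemma trace_zero [simp]: "Determinants.trace (0 :: real ^ 'n ^ 'n) = 0"
  by (simp add: Determinants.trace_def)

lemma vectorspace_sl4: "vectorspace class_ring sl4"
proof -
  have "module class_ring sl4"
    by (rule module_criteria)
      (auto simp: trace_add trace_scaleR algebra_simps class_cring.cring_axioms trace_minus intro!: bexI[of _ "- v" for v])
  then show ?thesis using class_field by (simp add: vectorspace_def)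
qed

lemma minus_sl4: assumes "Determinants.trace u = 0" "Determinants.trace w = 0" shows "u \<ominus>\<^bsub>sl4\<^esub> w = u - w"
proof -
  interpret vectorspace class_ring sl4 by (rule vectorspace_sl4)
  have w: "Determinants.trace (- w) = 0" using assms by (simp add: trace_minus)
  have "\<ominus>\<^bsub>sl4\<^esub> w = - w" by (rule minus_equality) (use assms w in auto)
  then show ?thesis by (simp add: a_minus_def)
qed

lemma finsum_sl4:
  assumes "\<And>i. i \<in> I \<Longrightarrow> Determinants.trace (f i) = 0"
  shows "(\<Oplus>\<^bsub>sl4\<^esub>i\<in>I. f i) = sum f I"
proof -
  interpret vectorspace class_ring sl4 by (rule vectorspace_sl4)
  show ?thesis using assms
  proof (induction I rule: infinite_finite_induct)
    case (insert i I)
    then have "(\<Oplus>\<^bsub>sl4\<^esub>i\<in>insert i I. f i) = f i \<oplus>\<^bsub>sl4\<^esub> (\<Oplus>\<^bsub>sl4\<^esub>i\<in>I. f i)" by (intro finsum_insert) auto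
    then show ?case using insert by simp
  qed (simp_all)
qed

section \<open>The adjoint module and cocycles on the fiber group\<close>

context holonomy
begin

abbreviation "ad g \<equiv> Ad (\<rho> g)"
abbreviation "Fib \<equiv> fiber_group \<Gamma> v"
abbreviation "Z1 \<equiv> cocycle_space \<Gamma> Fib sl4 ad"
abbreviation "B1 \<equiv> coboundaries Fib sl4 ad"

lemma ad_add: "g \<in> carrier \<Gamma> \<Longrightarrow> ad g (X + Y) = ad g X + ad g Y"
  by (simp add: Ad_rho matrix_add_ldistrib matrix_mult_add_left)

lemma ad_scaleR: "g \<in> carrier \<Gamma> \<Longrightarrow> ad g (r *\<^sub>R X) = r *\<^sub>R ad g X"
  by (simp add: Ad_rho matrix_mult_scaleR)

lemma ad_zero: "g \<in> carrier \<Gamma> \<Longrightarrow> ad g 0 = 0"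
  using ad_scaleR[of g 0 0] by simp

lemma ad_minus: "g \<in> carrier \<Gamma> \<Longrightarrow> ad g (- X) = - ad g X"
  using ad_scaleR[of g "- 1" X] by simp

lemma ad_diff: "g \<in> carrier \<Gamma> \<Longrightarrow> ad g (X - Y) = ad g X - ad g Y"
  using ad_add[of g X "- Y"] ad_minus[of g Y] by simp

lemma ad_sum: "g \<in> carrier \<Gamma> \<Longrightarrow> ad g (\<Sum>i\<in>I. f i) = (\<Sum>i\<in>I. ad g (f i))"
  by (induction I rule: infinite_finite_induct) (auto simp: ad_zero ad_add)

lemma ad_mult: assumes "g \<in> carrier \<Gamma>" "h \<in> carrier \<Gamma>" shows "ad (g \<otimes>\<^bsub>\<Gamma>\<^esub> h) X = ad g (ad h X)"
  using assms by (simp add: Ad_rho lift_mult inv_mult_group matrix_mul_assoc)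

lemma ad_one: "ad \<one>\<^bsub>\<Gamma>\<^esub> X = X"
  by (simp add: Ad_rho lift_one)

lemma trace_lift_conj: "g \<in> carrier \<Gamma> \<Longrightarrow> Determinants.trace (lift g ** X ** lift (inv\<^bsub>\<Gamma>\<^esub> g)) = Determinants.trace X"
  by (subst trace_mul_sym) (simp add: matrix_mul_assoc lift_mult[symmetric] lift_one)

lemma trace_ad: "g \<in> carrier \<Gamma> \<Longrightarrow> Determinants.trace (ad g X) = Determinants.trace X"
  by (simp add: Ad_rho trace_lift_conj)

text \<open>On traceless matrices this is the Killing form up to the factor 8.\<close>

definition form :: "real ^ 4 ^ 4 \<Rightarrow> real ^ 4 ^ 4 \<Rightarrow> real" where
  "form X Y = Determinants.trace (X ** Y)"

lemma form_ad: "g \<in> carrier \<Gamma> \<Longrightarrow> form (ad g X) (ad g Y) = form X Y"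
proof -
  assume g: "g \<in> carrier \<Gamma>"
  have "ad g X ** ad g Y = lift g ** X ** (lift (inv\<^bsub>\<Gamma>\<^esub> g) ** lift g) ** Y ** lift (inv\<^bsub>\<Gamma>\<^esub> g)"
    by (simp only: Ad_rho[OF g] matrix_mul_assoc)
  also have "\<dots> = lift g ** (X ** Y) ** lift (inv\<^bsub>\<Gamma>\<^esub> g)"
    using g by (simp add: lift_mult[symmetric] lift_one matrix_mul_assoc)
  finally show ?thesis using g by (simp add: form_def trace_lift_conj)
qed

lemma form_simps:
  "form (X + Y) Z = form X Z + form Y Z" "form X (Y + Z) = form X Y + form X Z"
  "form (X - Y) Z = form X Z - form Y Z" "form X (Y - Z) = form X Y - form X Z"
  "form (r *\<^sub>R X) Y = r * form X Y" "form X (r *\<^sub>R Y) = r * form X Y"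
  "form 0 Y = 0" "form X 0 = 0" "form (- X) Y = - form X Y" "form X (- Y) = - form X Y"
proof -
  show *: "form (X + Y) Z = form X Z + form Y Z" "form X (Y + Z) = form X Y + form X Z"
    "form (r *\<^sub>R X) Y = r * form X Y" "form X (r *\<^sub>R Y) = r * form X Y" for X Y Z r
    by (simp_all add: form_def matrix_add_ldistrib matrix_mult_add_left trace_add matrix_mult_scaleR trace_scaleR)
  show 0: "form 0 Y = 0" "form X 0 = 0" for X Y using *(3)[of 0 0 Y] *(4)[of X 0 0] by simp_all
  show m: "form (- X) Y = - form X Y" "form X (- Y) = - form X Y" for X Y
    using *(3)[of "- 1" X Y] *(4)[of X "- 1" Y] by simp_all
  show "form (X - Y) Z = form X Z - form Y Z" "form X (Y - Z) = form X Y - form X Z"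
    using *(1)[of X "- Y" Z] *(2)[of X Y "- Z"] m by simp_all
qed

text \<open>Pairing \<open>X\<close> with its transpose, which is traceless as well, gives the sum
  of the squares of its entries.\<close>

lemma form_nondegenerate:
  assumes "\<And>Y. Determinants.trace Y = 0 \<Longrightarrow> form X Y = 0" "Determinants.trace X = 0"
  shows "X = 0"
proof -
  have "Determinants.trace (Finite_Cartesian_Product.transpose X) = 0"
    using assms(2) by (simp add: Determinants.trace_def Finite_Cartesian_Product.transpose_def)
  then have "form X (Finite_Cartesian_Product.transpose X) = 0" by (rule assms(1))
  then have "(\<Sum>i\<in>UNIV. \<Sum>j\<in>UNIV. (X $ i $ j)\<^sup>2) = 0"
    by (simp add: form_def Determinants.trace_def matrix_matrix_mult_def Finite_Cartesian_Product.transpose_def power2_eq_square)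
  then have "\<forall>i j. X $ i $ j = 0" by (simp add: sum_nonneg_eq_0_iff sum_nonneg)
  then show ?thesis by (simp add: Finite_Cartesian_Product.vec_eq_iff)
qed

lemma iota_closed: "g \<in> Fib \<Longrightarrow> g \<in> carrier \<Gamma>"
  by (auto simp: fiber_group_eq)

lemma Fib_mult: "g \<in> Fib \<Longrightarrow> h \<in> Fib \<Longrightarrow> g \<otimes>\<^bsub>\<Gamma>\<^esub> h \<in> Fib"
  by (auto simp: fiber_group_eq simp flip: fiber.free_eval_add)

lemma Z1_carrier: "f \<in> carrier Z1 \<longleftrightarrow> f \<in> extensional Fib \<and> (\<forall>g\<in>Fib. Determinants.trace (f g) = 0) \<and>
    (\<forall>g\<in>Fib. \<forall>h\<in>Fib. f (g \<otimes>\<^bsub>\<Gamma>\<^esub> h) = f g + ad g (f h))"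
  by (auto simp: cocycle_space_def cocycles_def PiE_iff)

lemma Z1_simps:
  "\<zero>\<^bsub>Z1\<^esub> = (\<lambda>g\<in>Fib. 0)" "f \<oplus>\<^bsub>Z1\<^esub> f' = (\<lambda>g\<in>Fib. f g + f' g)" "r \<odot>\<^bsub>Z1\<^esub> f = (\<lambda>g\<in>Fib. r *\<^sub>R f g)"
  by (simp_all add: cocycle_space_def)

lemma module_Z1: "module class_ring Z1"
proof (rule module_criteria)
  show "\<forall>f\<in>carrier Z1. \<exists>f'\<in>carrier Z1. f \<oplus>\<^bsub>Z1\<^esub> f' = \<zero>\<^bsub>Z1\<^esub>"
  proof
    fix f assume "f \<in> carrier Z1"
    then show "\<exists>f'\<in>carrier Z1. f \<oplus>\<^bsub>Z1\<^esub> f' = \<zero>\<^bsub>Z1\<^esub>"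
      by (intro bexI[of _ "\<lambda>g\<in>Fib. - f g"])
        (auto simp: Z1_carrier Z1_simps Fib_mult ad_minus iota_closed trace_minus fun_eq_iff)
  qed
  show "\<forall>f\<in>carrier Z1. f \<oplus>\<^bsub>Z1\<^esub> \<zero>\<^bsub>Z1\<^esub> = f" "\<forall>f\<in>carrier Z1. \<one>\<^bsub>class_ring\<^esub> \<odot>\<^bsub>Z1\<^esub> f = f"
    by (auto simp: Z1_carrier Z1_simps extensional_def fun_eq_iff)
qed (auto simp: Z1_carrier Z1_simps Fib_mult ad_zero ad_add ad_scaleR iota_closed trace_add trace_scaleR
      fun_eq_iff algebra_simps class_cring.cring_axioms)

lemma vectorspace_Z1: "vectorspace class_ring Z1"
  using module_Z1 class_field by (simp add: vectorspace_def)

definition \<delta> :: "real ^ 4 ^ 4 \<Rightarrow> 'g \<Rightarrow> real ^ 4 ^ 4" where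
  "\<delta> X = (\<lambda>g\<in>Fib. ad g X - X)"

lemma B1_eq: "B1 = \<delta> ` {X. Determinants.trace X = 0}"
proof -
  have "(\<lambda>g\<in>Fib. ad g X \<ominus>\<^bsub>sl4\<^esub> X) = \<delta> X" if "Determinants.trace X = 0" for X
    using that by (auto simp: \<delta>_def fun_eq_iff minus_sl4 trace_ad iota_closed)
  then show ?thesis unfolding coboundaries_def by (auto simp: image_iff)
qed

lemma delta_Z1: "Determinants.trace X = 0 \<Longrightarrow> \<delta> X \<in> carrier Z1"
  by (auto simp: Z1_carrier \<delta>_def Fib_mult iota_closed trace_sub trace_ad ad_mult ad_diff)

lemma submodule_B1: "submodule class_ring B1 Z1"
proof (rule submodule.intro)
  show "B1 \<subseteq> carrier Z1" using delta_Z1 by (auto simp: B1_eq)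
  show "\<zero>\<^bsub>Z1\<^esub> \<in> B1" unfolding B1_eq
    by (rule image_eqI[of _ _ 0]) (auto simp: Z1_simps \<delta>_def ad_zero iota_closed fun_eq_iff)
  fix f f' assume "f \<in> B1" "f' \<in> B1"
  then obtain X Y where XY: "f = \<delta> X" "f' = \<delta> Y" "Determinants.trace X = 0" "Determinants.trace Y = 0" by (auto simp: B1_eq)
  then show "f \<oplus>\<^bsub>Z1\<^esub> f' \<in> B1" unfolding B1_eq
    by (intro image_eqI[of _ _ "X + Y"]) (auto simp: Z1_simps \<delta>_def ad_add iota_closed fun_eq_iff trace_add)
next
  fix r f assume "f \<in> B1"
  then obtain X where "f = \<delta> X" "Determinants.trace X = 0" by (auto simp: B1_eq)
  then show "r \<odot>\<^bsub>Z1\<^esub> f \<in> B1" unfolding B1_eq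
    by (intro image_eqI[of _ _ "r *\<^sub>R X"]) (auto simp: Z1_simps \<delta>_def ad_scaleR iota_closed fun_eq_iff trace_scaleR algebra_simps)
qed (rule module_Z1)

lemma quotient_vectorspace_H1: "quotient_vectorspace Z1 B1"
  using vectorspace_Z1 submodule_B1 by (simp add: quotient_vectorspace_def)

end

section \<open>Crossed homomorphisms on a free group\<close>

locale free_group_action =
  fixes act :: "'i free_group \<Rightarrow> 'v :: ab_group_add \<Rightarrow> 'v"
  assumes act_add: "act (u + w) X = act u (act w X)" and act_zero: "act 0 X = X"
    and act_plus: "act u (X + Y) = act u X + act u Y"
begin

lemma act_0: "act u 0 = 0"
  using act_plus[of u 0 0] by simp

lemma act_uminus: "act u (- X) = - act u X"
  using act_plus[of u X "- X"] act_0 by (simp add: eq_neg_iff_add_eq_0 add.commute)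

definition crossed :: "('i free_group \<Rightarrow> 'v) \<Rightarrow> bool" where
  "crossed d \<longleftrightarrow> (\<forall>u w. d (u + w) = d u + act u (d w))"

lemma crossed_zero: "crossed d \<Longrightarrow> d 0 = 0"
  unfolding crossed_def by (metis act_zero add.right_neutral add_left_imp_eq)

lemma crossed_minus: assumes "crossed d" shows "d (- u) = - act (- u) (d u)"
proof -
  have "d (- u + u) = d (- u) + act (- u) (d u)" using assms unfolding crossed_def by blast
  then show ?thesis using crossed_zero[OF assms] by (simp add: eq_neg_iff_add_eq_0)
qed

lemma crossed_unique:
  assumes "crossed d" "crossed d'" "\<And>i. d (gen i) = d' (gen i)"
  shows "d u = d' u"
proof (induction u rule: free_group_induct)
  case zero then show ?case using crossed_zero[OF assms(1)] crossed_zero[OF assms(2)] by simp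
next
  case (add l u)
  have "d (letter_val l) = d' (letter_val l)"
    using assms(3) by (cases l) (auto simp: letter_val_def crossed_minus[OF assms(1)] crossed_minus[OF assms(2)])
  then show ?case using add assms(1,2) by (simp add: crossed_def)
qed

text \<open>The values on letters are extended to words by the product rule, and the result is
  unchanged by the cancellation in \<open>push\<close>. The module is left general since the lemma
  is applied to matrices and again to pairs of a matrix and a real number.\<close>

lemma crossed_exists: obtains d where "crossed d" "\<And>i. d (gen i) = e i"
proof -
  define dl where "dl l = (if snd l then e (fst l) else - act (- gen (fst l)) (e (fst l)))" for l
  define dw where "dw w = foldr (\<lambda>l X. dl l + act (letter_val l) X) w 0" for w
  have dw_simps: "dw [] = 0" "dw (l # w) = dl l + act (letter_val l) (dw w)" for l w
    by (simp_all add: dw_def)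
  have cancel: "act u (act (- u) X) = X" "act (- u) (act u X) = X" for u X
    by (simp_all add: act_zero flip: act_add)
  have inv: "dl l + act (letter_val l) (dl (letter_inv l)) = 0" for l
    by (cases l) (auto simp: dl_def letter_val_def letter_inv_def act_uminus cancel)
  have push: "dw (push l w) = dw (l # w)" for l w
  proof (cases w)
    case (Cons m w')
    have "dl l + act (letter_val l) (dl (letter_inv l) + act (- letter_val l) (dw w')) = dw w'"
      using inv[of l] by (simp add: act_plus cancel flip: add.assoc)
    with Cons show ?thesis by (auto simp: dw_simps letter_val_inv)
  qed (simp add: dw_simps)
  have foldr: "dw (foldr push u w) = dw u + act (sum_list (map letter_val u)) (dw w)" for u w
    by (induction u) (auto simp: push dw_simps act_plus act_zero act_add add.assoc)
  show thesis
  proof (rule that[of "\<lambda>u. dw (word u)"])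
    show "crossed (\<lambda>u. dw (word u))"
      unfolding crossed_def by (simp add: plus_free_group.rep_eq foldr sum_letter_val_word)
    show "dw (word (gen i)) = e i" for i by (simp add: gen.rep_eq dw_simps dl_def act_0)
  qed
qed

end

section \<open>The space of cocycles in coordinates\<close>

lemma sum_lessThan_double:
  fixes F :: "nat \<Rightarrow> 'v :: comm_monoid_add"
  shows "(\<Sum>q<N * 2. F q) = (\<Sum>r<N. F r) + (\<Sum>r<N. F (N + r))"
  using sum.atLeastLessThan_concat[of 0 N "N + N" F] sum.shift_bounds_nat_ivl[of F 0 N N]
  by (simp add: lessThan_atLeast0 mult_2_right add.commute)

lemma trace_sum: "Determinants.trace (\<Sum>i\<in>I. f i) = (\<Sum>i\<in>I. Determinants.trace (f i :: real ^ 'n ^ 'n))"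
  by (induction I rule: infinite_finite_induct) (auto simp: trace_add)

locale cohomology = holonomy \<Gamma> v \<phi> \<rho> \<alpha>
  for \<Gamma> :: "('g, 'm) monoid_scheme" and v :: "bundle_gen \<Rightarrow> 'g" and \<phi> \<rho> \<alpha> +
  fixes Xs :: "(real ^ 4 ^ 4) list"
  assumes basis: "ordered_basis sl4 Xs"
begin

sublocale sl: coordinate_space sl4 Xs
  using vectorspace_sl4 basis by (simp add: coordinate_space_def coordinate_space_axioms_def)

abbreviation "N \<equiv> length Xs"
abbreviation "co \<equiv> coordinates sl4 Xs"

lemma trace_Xs: "r < N \<Longrightarrow> Determinants.trace (Xs ! r) = 0"
  using sl.basis_closed[of r] by simp

lemma co_carrier: "Determinants.trace X = 0 \<Longrightarrow> co X \<in> carrier_vec N"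
  using sl.coordinates_carrier by simp

lemma co_zero: "co 0 = 0\<^sub>v N"
  using sl.coordinates_zero by simp

lemma co_expansion: assumes "Determinants.trace X = 0" shows "X = (\<Sum>r<N. vec_index (co X) r *\<^sub>R Xs ! r)"
proof -
  have "X = (\<Oplus>\<^bsub>sl4\<^esub>r\<in>{..<N}. vec_index (co X) r *\<^sub>R Xs ! r)"
    using sl.combination_coordinates[of X] assms by (simp add: sl.combination_def)
  then show ?thesis using finsum_sl4[of "{..<N}" "\<lambda>r. vec_index (co X) r *\<^sub>R Xs ! r"]
    by (simp add: trace_scaleR trace_Xs)
qed

lemma co_sum:
  assumes "\<And>i. i \<in> I \<Longrightarrow> Determinants.trace (f i) = 0" "r < N"
  shows "vec_index (co (\<Sum>i\<in>I. a i *\<^sub>R f i)) r = (\<Sum>i\<in>I. a i * vec_index (co (f i)) r)"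
  using assms
proof (induction I rule: infinite_finite_induct)
  case (insert i I)
  have "co (a i *\<^sub>R f i + (\<Sum>i\<in>I. a i *\<^sub>R f i)) = a i \<cdot>\<^sub>v co (f i) + co (\<Sum>i\<in>I. a i *\<^sub>R f i)"
    using sl.coordinates_add[of "a i *\<^sub>R f i" "\<Sum>i\<in>I. a i *\<^sub>R f i"] sl.coordinates_smult[of "f i" "a i"] insert
    by (simp add: trace_scaleR trace_sum)
  moreover have "co (\<Sum>i\<in>I. a i *\<^sub>R f i) \<in> carrier_vec N" "co (f i) \<in> carrier_vec N"
    using insert by (simp_all add: co_carrier trace_sum trace_scaleR)
  ultimately show ?case using insert by simp
qed (auto simp: co_zero)

definition Ad_mat :: "'g \<Rightarrow> real mat" where
  "Ad_mat g = matrix_of sl4 Xs (ad g)"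

lemma Ad_mat_carrier [simp]: "Ad_mat g \<in> carrier_mat N N"
  by (simp add: Ad_mat_def sl.matrix_of_carrier)

lemma co_ad: "g \<in> carrier \<Gamma> \<Longrightarrow> Determinants.trace X = 0 \<Longrightarrow> co (ad g X) = Ad_mat g *\<^sub>v co X"
  unfolding Ad_mat_def by (rule sl.coordinates_matrix_of) (auto simp: trace_ad ad_add ad_scaleR)

lemma Ad_mat_entry: "r < N \<Longrightarrow> k < N \<Longrightarrow> Ad_mat g $$ (r, k) = vec_index (co (ad g (Xs ! k))) r"
  by (simp add: Ad_mat_def matrix_of_def)

abbreviation "act u \<equiv> ad (\<iota> u)"

sublocale fga: free_group_action act
  by unfold_locales (simp_all add: fiber.free_eval_add ad_mult ad_one ad_add)

text \<open>Cocycles are handled on the abstract free group, where the generators are available.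
  Injectivity of \<open>\<iota>\<close> lets \<open>toZ\<close> carry them over to the
  subgroup.\<close>

definition deriv :: "(fiber_gen free_group \<Rightarrow> real ^ 4 ^ 4) \<Rightarrow> bool" where
  "deriv f \<longleftrightarrow> fga.crossed f \<and> (\<forall>u. Determinants.trace (f u) = 0)"

lemma deriv_trace: "deriv f \<Longrightarrow> Determinants.trace (f u) = 0"
  by (simp add: deriv_def)

lemma deriv_add: "deriv f \<Longrightarrow> f (u + w) = f u + act u (f w)"
  by (simp add: deriv_def fga.crossed_def)

lemma deriv_exists: assumes "\<And>i. Determinants.trace (e i) = 0" obtains d where "deriv d" "\<And>i. d (gen i) = e i"
proof -
  obtain d where d: "fga.crossed d" "\<And>i. d (gen i) = e i" using fga.crossed_exists by blast
  have "Determinants.trace (d u) = 0" for u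
  proof (induction u rule: free_group_induct)
    case zero then show ?case using fga.crossed_zero[OF d(1)] by simp
  next
    case (add l u)
    have "Determinants.trace (d (letter_val l)) = 0"
      using d assms fga.crossed_minus[OF d(1)] by (cases l) (auto simp: letter_val_def trace_minus trace_ad)
    then show ?case using add d(1) by (simp add: fga.crossed_def trace_add trace_ad)
  qed
  then show thesis using that[of d] d by (simp add: deriv_def)
qed

lemma deriv_eqI: "deriv f \<Longrightarrow> deriv f' \<Longrightarrow> (\<And>i. f (gen i) = f' (gen i)) \<Longrightarrow> f = f'"
  using fga.crossed_unique unfolding deriv_def by blast

lemma deriv_combination:
  assumes "\<And>p. p \<in> I \<Longrightarrow> deriv (h p)"
  shows "deriv (\<lambda>u. \<Sum>p\<in>I. a p *\<^sub>R h p u)"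
  using assms unfolding deriv_def fga.crossed_def
  by (simp add: trace_sum trace_scaleR ad_sum ad_scaleR scaleR_add_right sum.distrib)

text \<open>Position \<open>q\<close> belongs to block \<open>q div N\<close>, with
  \<open>q mod N\<close> inside the block: the layout of the Alexander matrix.\<close>

definition gidx :: "nat \<Rightarrow> fiber_gen" where "gidx q = [A, B] ! (q div N)"

definition vecg :: "(fiber_gen \<Rightarrow> real ^ 4 ^ 4) \<Rightarrow> real Matrix.vec" where
  "vecg h = Matrix.vec (N * 2) (\<lambda>q. vec_index (co (h (gidx q))) (q mod N))"

abbreviation "vecd f \<equiv> vecg (\<lambda>i. f (gen i))"

lemma dim_vecg [simp]: "dim_vec (vecg h) = N * 2" by (simp add: vecg_def)

lemma vecg_carrier [simp]: "vecg h \<in> carrier_vec (N * 2)" by (simp add: vecg_def)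

lemma gidx: "r < N \<Longrightarrow> gidx r = A" "r < N \<Longrightarrow> gidx (N + r) = B"
proof -
  show "gidx r = A" if "r < N" using that by (simp add: gidx_def)
  show "gidx (N + r) = B" if r: "r < N"
  proof -
    have "(N + r) div N = 1" using r by (intro div_nat_eqI) auto
    then show ?thesis by (simp add: gidx_def)
  qed
qed

lemma mod_less_N: "q < N * 2 \<Longrightarrow> q mod N < N"
  by (cases "N = 0") auto

lemma vecg_inj:
  assumes "\<And>i. Determinants.trace (h i) = 0" "\<And>i. Determinants.trace (h' i) = 0" "vecg h = vecg h'"
  shows "h = h'"
proof
  fix i
  have "vec_index (co (h i)) r = vec_index (co (h' i)) r" if r: "r < N" for r
  proof (cases i)
    case A
    then show ?thesis using arg_cong[OF assms(3), of "\<lambda>w. vec_index w r"] r by (simp add: vecg_def gidx)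
  next
    case B
    then show ?thesis using arg_cong[OF assms(3), of "\<lambda>w. vec_index w (N + r)"] r by (simp add: vecg_def gidx)
  qed
  then have "co (h i) = co (h' i)" using co_carrier[of "h i"] co_carrier[of "h' i"] assms by (intro eq_vecI) auto
  then show "h i = h' i" using sl.coordinates_inj assms by simp
qed

text \<open>The crossed homomorphisms whose coordinates are unit vectors. Their values will turn out
  to be columns of the Fox derivatives evaluated in the adjoint representation.\<close>

definition zb :: "nat \<Rightarrow> fiber_gen free_group \<Rightarrow> real ^ 4 ^ 4" where
  "zb q = (SOME d. deriv d \<and> (\<forall>i. d (gen i) = (if i = gidx q then Xs ! (q mod N) else 0)))"

lemma zb: assumes "q < N * 2"
  shows deriv_zb: "deriv (zb q)" and zb_gen: "zb q (gen i) = (if i = gidx q then Xs ! (q mod N) else 0)"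
proof -
  have tr: "Determinants.trace (if i = gidx q then Xs ! (q mod N) else 0) = 0" for i
    using trace_Xs[OF mod_less_N[OF assms]] by simp
  obtain d where "deriv d" "\<And>i. d (gen i) = (if i = gidx q then Xs ! (q mod N) else 0)"
    using deriv_exists[of "\<lambda>i. if i = gidx q then Xs ! (q mod N) else 0", OF tr] by blast
  then have "\<exists>d. deriv d \<and> (\<forall>i. d (gen i) = (if i = gidx q then Xs ! (q mod N) else 0))" by blast
  from someI_ex[OF this] show "deriv (zb q)" "zb q (gen i) = (if i = gidx q then Xs ! (q mod N) else 0)"
    by (auto simp: zb_def)
qed

lemma deriv_expansion:
  assumes "deriv f" shows "f u = (\<Sum>q<N * 2. vec_index (vecd f) q *\<^sub>R zb q u)"
proof -
  have "f = (\<lambda>u. \<Sum>q<N * 2. vec_index (vecd f) q *\<^sub>R zb q u)"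
  proof (rule deriv_eqI[OF assms])
    show "deriv (\<lambda>u. \<Sum>q<N * 2. vec_index (vecd f) q *\<^sub>R zb q u)"
      by (rule deriv_combination) (simp add: deriv_zb)
    fix i
    have "(\<Sum>q<N * 2. vec_index (vecd f) q *\<^sub>R zb q (gen i)) =
        (\<Sum>q<N * 2. vec_index (co (f (gen (gidx q)))) (q mod N) *\<^sub>R (if i = gidx q then Xs ! (q mod N) else 0))"
      by (rule sum.cong) (simp_all add: zb_gen vecg_def)
    also have "\<dots> = (\<Sum>r<N. vec_index (co (f (gen i))) r *\<^sub>R Xs ! r)"
      unfolding sum_lessThan_double by (cases i) (simp_all add: gidx)
    also have "\<dots> = f (gen i)" using co_expansion[OF deriv_trace[OF assms]] by simp
    finally show "f (gen i) = (\<Sum>q<N * 2. vec_index (vecd f) q *\<^sub>R zb q (gen i))" by simp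
  qed
  then show ?thesis by metis
qed

lemma vecd_surj: assumes "w \<in> carrier_vec (N * 2)" obtains f where "deriv f" "vecd f = w"
proof -
  have "deriv (\<lambda>u. \<Sum>q<N * 2. vec_index w q *\<^sub>R zb q u)"
    by (rule deriv_combination) (simp add: deriv_zb)
  moreover have "vecd (\<lambda>u. \<Sum>q<N * 2. vec_index w q *\<^sub>R zb q u) = w"
  proof (rule eq_vecI)
    fix p assume "p < dim_vec w"
    then have p: "p < N * 2" using assms by simp
    then have m: "p mod N < N" by (cases "N = 0") auto
    have "vec_index (vecd (\<lambda>u. \<Sum>q<N * 2. vec_index w q *\<^sub>R zb q u)) p =
        (\<Sum>q<N * 2. vec_index w q * vec_index (co (zb q (gen (gidx p)))) (p mod N))"
      unfolding vecg_def index_vec[OF p] by (rule co_sum) (use m in \<open>auto simp: deriv_trace[OF deriv_zb]\<close>)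
    also have "\<dots> = (\<Sum>q<N * 2. if q = p then vec_index w q else 0)"
    proof (rule sum.cong)
      fix q assume "q \<in> {..<N * 2}"
      then have q: "q < N * 2" by simp
      then have mq: "q mod N < N" by (cases "N = 0") auto
      have "gidx p = gidx q \<longleftrightarrow> p div N = q div N"
      proof -
        have "p div N < 2" "q div N < 2" using p q by (simp_all add: less_mult_imp_div_less mult.commute)
        then show ?thesis unfolding gidx_def by (auto simp: less_2_cases_iff)
      qed
      moreover have eq: "p = q" if "p div N = q div N" "p mod N = q mod N"
      proof -
        have "p div N * N + p mod N = q div N * N + q mod N" by (simp only: that)
        then show ?thesis unfolding div_mult_mod_eq .
      qed
      ultimately have pq: "p = q \<longleftrightarrow> gidx p = gidx q \<and> p mod N = q mod N" by blast
      show "vec_index w q * vec_index (co (zb q (gen (gidx p)))) (p mod N) = (if q = p then vec_index w q else 0)"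
      proof (cases "gidx p = gidx q")
        case True
        then have "co (zb q (gen (gidx p))) = unit_vec N (q mod N)"
          using sl.coordinates_basis[OF mq] by (simp add: zb_gen[OF q])
        then show ?thesis using m mq pq True by (simp add: eq_commute[of q p])
      next
        case False
        then have "p \<noteq> q" by blast
        then show ?thesis using m False by (simp add: zb_gen[OF q] co_zero)
      qed
    qed simp
    also have "\<dots> = vec_index w p" using p by simp
    finally show "vec_index (vecd (\<lambda>u. \<Sum>q<N * 2. vec_index w q *\<^sub>R zb q u)) p = vec_index w p" .
  qed (use assms in simp)
  ultimately show thesis using that by blast
qed

lemma vecd_zb: assumes "q < N * 2" shows "vecd (zb q) = unit_vec (N * 2) q"
proof -
  obtain f where f: "deriv f" "vecd f = unit_vec (N * 2) q" using vecd_surj[of "unit_vec (N * 2) q"] by auto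
  have "f u = zb q u" for u
  proof -
    have "f u = (\<Sum>p<N * 2. (if p = q then 1 else 0) *\<^sub>R zb p u)"
      unfolding deriv_expansion[OF f(1), of u] f(2) by (rule sum.cong) (use assms in \<open>auto\<close>)
    also have "\<dots> = (\<Sum>p<N * 2. if p = q then zb p u else 0)" by (rule sum.cong) auto
    finally show ?thesis using assms by simp
  qed
  then have "f = zb q" by blast
  then show ?thesis using f by simp
qed

text \<open>The results of \<open>T\<close> are values at the generators and not cocycles, because
  \<open>f \<circ> \<phi>\<close> and \<open>ad x \<circ> f\<close> obey the product rule only for
  the action twisted by \<open>\<phi>\<close>.\<close>

definition lin_mat :: "((fiber_gen free_group \<Rightarrow> real ^ 4 ^ 4) \<Rightarrow> fiber_gen \<Rightarrow> real ^ 4 ^ 4) \<Rightarrow> real mat" where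
  "lin_mat T = Matrix.mat (N * 2) (N * 2) (\<lambda>(q, p). vec_index (vecg (T (zb p))) q)"

lemma lin_mat_carrier [simp]: "lin_mat T \<in> carrier_mat (N * 2) (N * 2)" by (simp add: lin_mat_def)

lemma lin_mat:
  assumes f: "deriv f" and tr: "\<And>p i. p < N * 2 \<Longrightarrow> Determinants.trace (T (zb p) i) = 0"
    and T: "\<And>i. T f i = (\<Sum>p<N * 2. vec_index (vecd f) p *\<^sub>R T (zb p) i)"
  shows "lin_mat T *\<^sub>v vecd f = vecg (T f)"
proof (rule eq_vecI)
  fix q assume "q < dim_vec (vecg (T f))"
  then have q: "q < N * 2" by (simp add: vecg_def)
  then have m: "q mod N < N" by (cases "N = 0") auto
  have "vec_index (vecg (T f)) q = (\<Sum>p<N * 2. vec_index (vecd f) p * vec_index (co (T (zb p) (gidx q))) (q mod N))"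
    unfolding vecg_def[of "T f"] index_vec[OF q] T by (rule co_sum) (use m tr in auto)
  also have "\<dots> = vec_index (lin_mat T *\<^sub>v vecd f) q"
    using q by (simp add: lin_mat_def scalar_prod_def vecg_def[of "T _"] lessThan_atLeast0 mult.commute)
  finally show "vec_index (lin_mat T *\<^sub>v vecd f) q = vec_index (vecg (T f)) q" by simp
qed (simp add: vecg_def lin_mat_def)

text \<open>The action of the meridian on cocycles: the conjugation in its argument is the inverse
  of \<open>\<phi>\<close>.\<close>

definition shift :: "(fiber_gen free_group \<Rightarrow> real ^ 4 ^ 4) \<Rightarrow> fiber_gen free_group \<Rightarrow> real ^ 4 ^ 4" where
  "shift f u = ad x (f (inv_into UNIV \<phi> u))"

lemma phi_inv [simp]: "\<phi> (inv_into UNIV \<phi> u) = u" "inv_into UNIV \<phi> (\<phi> u) = u"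
  using phi_bij by (auto simp: bij_is_surj surj_f_inv_f bij_is_inj)

lemma phi_inv_add: "inv_into UNIV \<phi> (u + w) = inv_into UNIV \<phi> u + inv_into UNIV \<phi> w"
  by (metis phi_add phi_inv)

lemma ad_x_act: "ad x (act u X) = act (\<phi> u) (ad x X)"
  using monodromy'[of u] by (simp flip: ad_mult)

lemma deriv_shift: assumes "deriv f" shows "deriv (shift f)"
proof -
  have "shift f (u + w) = shift f u + act u (shift f w)" for u w
    unfolding shift_def phi_inv_add deriv_add[OF assms] by (simp add: ad_add ad_x_act)
  then show ?thesis using assms by (simp add: deriv_def fga.crossed_def shift_def trace_ad)
qed

definition M_mat :: "real mat" where "M_mat = lin_mat (\<lambda>f i. shift f (gen i))"
definition J_mat :: "real mat" where "J_mat = lin_mat (\<lambda>f i. f (\<phi> (gen i)))"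
definition X2_mat :: "real mat" where "X2_mat = lin_mat (\<lambda>f i. ad x (f (gen i)))"

lemma mats_carrier [simp]: "M_mat \<in> carrier_mat (N * 2) (N * 2)" "J_mat \<in> carrier_mat (N * 2) (N * 2)"
  "X2_mat \<in> carrier_mat (N * 2) (N * 2)"
  by (simp_all add: M_mat_def J_mat_def X2_mat_def)

lemma M_mat: "deriv f \<Longrightarrow> M_mat *\<^sub>v vecd f = vecd (shift f)"
  unfolding M_mat_def
  by (rule lin_mat) (simp_all add: deriv_trace[OF deriv_shift[OF deriv_zb]], simp add: shift_def,
    subst deriv_expansion, simp_all add: ad_sum ad_scaleR)

lemma J_mat: "deriv f \<Longrightarrow> J_mat *\<^sub>v vecd f = vecg (\<lambda>i. f (\<phi> (gen i)))"
  unfolding J_mat_def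
  by (rule lin_mat) (simp_all add: deriv_trace[OF deriv_zb], subst deriv_expansion, simp_all)

lemma X2_mat: "deriv f \<Longrightarrow> X2_mat *\<^sub>v vecd f = vecg (\<lambda>i. ad x (f (gen i)))"
  unfolding X2_mat_def
  by (rule lin_mat) (simp_all add: deriv_trace[OF deriv_zb] trace_ad, subst deriv_expansion, simp_all add: ad_sum ad_scaleR)

text \<open>Precomposition with \<open>\<phi>\<close> undoes the inverse of \<open>\<phi>\<close>
  inside \<open>shift\<close>, and \<open>ad x\<close> remains.\<close>

lemma J_M: "J_mat * M_mat = X2_mat"
proof (rule eq_mat_unit_vecI[of _ "N * 2" "N * 2"])
  fix q assume q: "q < N * 2"
  note d = deriv_zb[OF q]
  have "(J_mat * M_mat) *\<^sub>v vecd (zb q) = J_mat *\<^sub>v (M_mat *\<^sub>v vecd (zb q))"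
    by (rule assoc_mult_mat_vec[of _ "N * 2" "N * 2" _ "N * 2"]) auto
  also have "\<dots> = X2_mat *\<^sub>v vecd (zb q)"
    unfolding M_mat[OF d] J_mat[OF deriv_shift[OF d]] X2_mat[OF d] by (simp add: shift_def)
  finally show "(J_mat * M_mat) *\<^sub>v unit_vec (N * 2) q = X2_mat *\<^sub>v unit_vec (N * 2) q"
    by (simp add: vecd_zb[OF q])
qed (auto intro: mult_carrier_mat[of _ _ "N * 2"])

lemma X2_entry:
  assumes "q < N * 2" "p < N * 2"
  shows "X2_mat $$ (q, p) = (if gidx q = gidx p then Ad_mat x $$ (q mod N, p mod N) else 0)"
proof -
  note m = mod_less_N[OF assms(1)] mod_less_N[OF assms(2)]
  have "X2_mat $$ (q, p) = vec_index (co (ad x (zb p (gen (gidx q))))) (q mod N)"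
    using assms by (simp add: X2_mat_def lin_mat_def vecg_def)
  then show ?thesis
    using m by (simp only: zb_gen[OF assms(2)] Ad_mat_entry split: if_split) (simp add: ad_zero co_zero)
qed

definition \<delta>d :: "real ^ 4 ^ 4 \<Rightarrow> fiber_gen free_group \<Rightarrow> real ^ 4 ^ 4" where
  "\<delta>d X u = act u X - X"

lemma deriv_\<delta>d: "Determinants.trace X = 0 \<Longrightarrow> deriv (\<delta>d X)"
  by (simp add: deriv_def fga.crossed_def \<delta>d_def trace_sub trace_ad fga.act_add ad_diff)

lemma shift_\<delta>d: "shift (\<delta>d X) = \<delta>d (ad x X)"
  by (simp add: fun_eq_iff shift_def \<delta>d_def ad_diff ad_x_act)

definition I_mat :: "real mat" where
  "I_mat = Matrix.mat (N * 2) N (\<lambda>(q, k). vec_index (vecd (\<delta>d (Xs ! k))) q)"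

lemma I_mat_carrier [simp]: "I_mat \<in> carrier_mat (N * 2) N" by (simp add: I_mat_def)

lemma I_mat: assumes X: "Determinants.trace X = 0" shows "I_mat *\<^sub>v co X = vecd (\<delta>d X)"
proof (rule eq_vecI)
  fix q assume "q < dim_vec (vecd (\<delta>d X))"
  then have q: "q < N * 2" by (simp add: vecg_def)
  then have m: "q mod N < N" by (cases "N = 0") auto
  have "\<delta>d X u = (\<Sum>r<N. vec_index (co X) r *\<^sub>R \<delta>d (Xs ! r) u)" for u
  proof -
    have e: "act u X = (\<Sum>r<N. vec_index (co X) r *\<^sub>R act u (Xs ! r))"
      using arg_cong[OF co_expansion[OF X], of "act u"] by (simp only: ad_sum ad_scaleR fiber.free_eval_closed)
    show ?thesis
      by (simp only: \<delta>d_def scaleR_diff_right sum_subtractf e[symmetric] co_expansion[OF X, symmetric])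
  qed
  then have dx: "vec_index (vecd (\<delta>d X)) q = (\<Sum>r<N. vec_index (co X) r * vec_index (co (\<delta>d (Xs ! r) (gen (gidx q)))) (q mod N))"
    unfolding vecg_def index_vec[OF q] by (simp only:) (rule co_sum, use m in \<open>auto simp: deriv_trace[OF deriv_\<delta>d[OF trace_Xs]]\<close>)
  note dx
  also have "(\<Sum>r<N. vec_index (co X) r * vec_index (co (\<delta>d (Xs ! r) (gen (gidx q)))) (q mod N)) = vec_index (I_mat *\<^sub>v co X) q"
    using q co_carrier[OF X] by (simp add: I_mat_def scalar_prod_def vecg_def lessThan_atLeast0 mult.commute)
  finally show "vec_index (I_mat *\<^sub>v co X) q = vec_index (vecd (\<delta>d X)) q" by simp
qed (simp add: vecg_def I_mat_def)

lemma vecd_inj: "deriv f \<Longrightarrow> deriv f' \<Longrightarrow> vecd f = vecd f' \<Longrightarrow> f = f'"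
  using vecg_inj[of "\<lambda>i. f (gen i)" "\<lambda>i. f' (gen i)"] by (intro deriv_eqI) (auto simp: deriv_trace dest: fun_cong)

lemma co_surj: assumes "w \<in> carrier_vec N" obtains X where "Determinants.trace X = 0" "co X = w"
  using that[of "sl.combination w"] sl.coordinates_combination[OF assms] sl.combination_closed[of w] by simp

lemma deriv_zero: "deriv (\<lambda>u. 0)"
  by (simp add: deriv_def fga.crossed_def ad_zero)

lemma vecd_zero: "vecd (\<lambda>u. 0) = 0\<^sub>v (N * 2)"
proof (rule eq_vecI)
  fix q assume "q < dim_vec (0\<^sub>v (N * 2) :: real Matrix.vec)"
  moreover from this have "q mod N < N" by (cases "N = 0") auto
  ultimately show "vec_index (vecd (\<lambda>u. 0)) q = vec_index (0\<^sub>v (N * 2)) q" by (simp add: vecg_def co_zero)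
qed (simp add: vecg_def)

text \<open>A coboundary that vanishes comes from an invariant of the fiber; this is where
  \<open>fiber_no_invariants\<close> enters.\<close>

lemma I_mat_inj: assumes "w \<in> carrier_vec N" "I_mat *\<^sub>v w = 0\<^sub>v (N * 2)" shows "w = 0\<^sub>v N"
proof -
  obtain X where X: "Determinants.trace X = 0" "co X = w" using co_surj[OF assms(1)] by blast
  have "vecd (\<delta>d X) = vecd (\<lambda>u. 0)" using I_mat[OF X(1)] assms X by (simp add: vecd_zero)
  then have "\<delta>d X = (\<lambda>u. 0)" using vecd_inj deriv_\<delta>d[OF X(1)] deriv_zero by blast
  then have "act u X = X" for u by (metis \<delta>d_def eq_iff_diff_eq_0)
  then have "X = 0" using fiber_no_invariants X by blast
  then show ?thesis using X co_zero by simp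
qed

text \<open>The coboundary map is equivariant for the meridian, by
  \<open>shift_\<delta>d\<close>.\<close>

lemma M_I: "M_mat * I_mat = I_mat * Ad_mat x"
proof (rule eq_mat_unit_vecI[of _ "N * 2" N])
  fix k assume k: "k < N"
  have u: "unit_vec N k = co (Xs ! k)" using sl.coordinates_basis[OF k] by simp
  note tr = trace_Xs[OF k]
  have "(M_mat * I_mat) *\<^sub>v co (Xs ! k) = M_mat *\<^sub>v (I_mat *\<^sub>v co (Xs ! k))"
    by (rule assoc_mult_mat_vec[of _ "N * 2" "N * 2" _ N]) (auto simp: co_carrier tr)
  also have "\<dots> = I_mat *\<^sub>v co (ad x (Xs ! k))"
    using tr by (simp add: I_mat M_mat deriv_\<delta>d shift_\<delta>d trace_ad)
  also have "\<dots> = (I_mat * Ad_mat x) *\<^sub>v co (Xs ! k)"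
    using tr by (simp add: co_ad) (rule assoc_mult_mat_vec[symmetric, of _ "N * 2" N _ N], auto simp: co_carrier)
  finally show "(M_mat * I_mat) *\<^sub>v unit_vec N k = (I_mat * Ad_mat x) *\<^sub>v unit_vec N k" unfolding u .
qed (auto intro: mult_carrier_mat[of _ _ "N * 2"] mult_carrier_mat[of _ _ N])

end

lemma congruence_entry:
  fixes M W :: "'a :: comm_semiring_0 mat"
  assumes M: "M \<in> carrier_mat n n" and W: "W \<in> carrier_mat n n" and "p < n" "q < n"
  shows "(M\<^sup>T * W * M) $$ (p, q) = (\<Sum>r<n. \<Sum>s<n. M $$ (r, p) * (M $$ (s, q) * W $$ (r, s)))"
proof -
  have "(M\<^sup>T * W * M) $$ (p, q) = (\<Sum>r<n. M $$ (r, p) * (\<Sum>s<n. W $$ (r, s) * M $$ (s, q)))"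
    using assms by (simp add: scalar_prod_def lessThan_atLeast0)
  then show ?thesis by (simp add: sum_distrib_left ac_simps)
qed

context cohomology
begin

section \<open>The duality pairing\<close>

lemma form_sum:
  "form (\<Sum>i\<in>I. f i) Y = (\<Sum>i\<in>I. form (f i) Y)" "form Y (\<Sum>i\<in>I. f i) = (\<Sum>i\<in>I. form Y (f i))"
  by (induction I rule: infinite_finite_induct) (auto simp: form_simps)

lemma form_commute: "form X Y = form Y X"
  unfolding form_def by (rule trace_mul_sym)

lemma act_inverse: "act u (act (- u) X) = X" "act (- u) (act u X) = X"
  by (simp_all add: ad_one flip: fga.act_add)

lemma form_act: "form X (act u Y) = form (act (- u) X) Y"
  using form_ad[of "\<iota> u" "act (- u) X" Y] by (simp add: act_inverse)

text \<open>Solved from the relation \<open>boundary_relation\<close>: expanding a potential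
  (defined below) on both sides leaves its value at \<open>c0\<close>. The formula shows
  bilinearity, while the potential shows invariance.\<close>

definition om :: "(fiber_gen free_group \<Rightarrow> real ^ 4 ^ 4) \<Rightarrow> (fiber_gen free_group \<Rightarrow> real ^ 4 ^ 4) \<Rightarrow> real" where
  "om f g = form (f (gen B)) (act (gen B) (g (gen A))) - form (f (gen A)) (act (gen A) (g (gen B)))
     + form (f c0) (act c0 (g (gen B + gen A)))"

text \<open>A potential of the cup product of \<open>f\<close> and \<open>g\<close>, which is a coboundary as the fiber is free.
  It is determined up to homomorphisms to the reals, which vanish on the boundary curve, so its value there is
  a canonical pairing.\<close>

definition potential where
  "potential f g h \<longleftrightarrow> (\<forall>u w. (h (u + w) :: real) = h u + h w - form (f u) (act u (g w)))"

text \<open>\<open>f\<close> twists the direct sum of the adjoint module and the trivial module of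
  reals: \<open>ext\<close> acts on it with a shear given by \<open>f\<close>. A crossed
  homomorphism into this module with first component \<open>g\<close> has a potential as second
  component, and on a free group it exists.\<close>

lemma potential_exists:
  assumes f: "deriv f" and g: "deriv g"
  obtains h where "potential f g h"
proof -
  define ext where "ext u Y = (act u (fst Y), snd Y - form (f u) (act u (fst Y)))"
    for u :: "fiber_gen free_group" and Y :: "(real ^ 4 ^ 4) \<times> real"
  interpret E: free_group_action ext
  proof
    show "ext (u + w) Y = ext u (ext w Y)" for u w Y
      using form_ad[of "\<iota> u" "f w" "act w (fst Y)"]
      by (simp add: ext_def fga.act_add deriv_add[OF f] form_simps)
    show "ext 0 Y = Y" for Y
      using f fga.crossed_zero[of f] by (simp add: ext_def ad_one deriv_def form_simps)
    show "ext u (Y + Y') = ext u Y + ext u Y'" for u Y Y'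
      by (simp add: ext_def fga.act_plus form_simps plus_prod_def)
  qed
  obtain D where D: "E.crossed D" "\<And>i. D (gen i) = (g (gen i), 0)" using E.crossed_exists[of "\<lambda>i. (g (gen i), 0)"] by blast
  have add: "D (u + w) = (fst (D u) + act u (fst (D w)), snd (D u) + (snd (D w) - form (f u) (act u (fst (D w)))))" for u w
  proof -
    have "D (u + w) = D u + ext u (D w)" using D(1) unfolding E.crossed_def by blast
    then show ?thesis by (simp only: plus_prod_def ext_def fst_conv snd_conv)
  qed
  have "fga.crossed (\<lambda>u. fst (D u))" by (simp add: fga.crossed_def add)
  then have "fst (D u) = g u" for u
    using fga.crossed_unique[of "\<lambda>u. fst (D u)" g u] g D(2) by (simp add: deriv_def)
  then have "potential f g (\<lambda>u. snd (D u))" unfolding potential_def by (simp add: add)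
  then show thesis using that by blast
qed

lemma boundary_relation: "c0 + (gen B + gen A) = gen A + gen B"
proof -
  have "c0 + (gen B + gen A) = c0 + gen B + gen A" by (rule add.assoc[symmetric])
  then show ?thesis unfolding diff_add_cancel .
qed

lemma om_potential: assumes "potential f g h" shows "om f g = h c0"
proof -
  note h = assms[unfolded potential_def, rule_format]
  have "h (c0 + (gen B + gen A)) = h c0 + h (gen B + gen A) - form (f c0) (act c0 (g (gen B + gen A)))"
    by (rule h)
  then have "h (gen A + gen B) = h c0 + h (gen B + gen A) - form (f c0) (act c0 (g (gen B + gen A)))"
    by (simp only: boundary_relation)
  then show ?thesis using h[of "gen A" "gen B"] h[of "gen B" "gen A"] unfolding om_def by linarith
qed

text \<open>A potential of the pair, composed with the inverse of \<open>\<phi>\<close>, is a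
  potential of the shifted pair, and \<open>\<phi>\<close> fixes \<open>c0\<close>.\<close>

lemma om_shift: assumes "deriv f" "deriv g" shows "om (shift f) (shift g) = om f g"
proof -
  obtain h where h: "potential f g h" using potential_exists assms by blast
  have "form (shift f u) (act u (shift g w)) = form (f (inv_into UNIV \<phi> u)) (act (inv_into UNIV \<phi> u) (g (inv_into UNIV \<phi> w)))" for u w
  proof -
    have "act u (shift g w) = ad x (act (inv_into UNIV \<phi> u) (g (inv_into UNIV \<phi> w)))"
      by (simp add: shift_def ad_x_act)
    then show ?thesis by (simp only:) (simp add: shift_def form_ad)
  qed
  then have "potential (shift f) (shift g) (\<lambda>u. h (inv_into UNIV \<phi> u))"
    using h by (simp add: potential_def phi_inv_add)
  moreover have "inv_into UNIV \<phi> c0 = c0" using phi_inv(2)[of c0] by (simp only: phi_boundary)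
  ultimately show ?thesis using om_potential h by metis
qed

lemma om_sum:
  "om (\<lambda>u. \<Sum>p\<in>I. a p *\<^sub>R F p u) g = (\<Sum>p\<in>I. a p * om (F p) g)"
  "om f (\<lambda>u. \<Sum>p\<in>I. a p *\<^sub>R F p u) = (\<Sum>p\<in>I. a p * om f (F p))"
  by (simp_all add: om_def form_sum form_simps ad_sum ad_scaleR sum.distrib sum_subtractf distrib_left right_diff_distrib)

lemma om_expansion:
  assumes "deriv f" "deriv g"
  shows "om f g = (\<Sum>r<N * 2. \<Sum>s<N * 2. vec_index (vecd f) r * (vec_index (vecd g) s * om (zb r) (zb s)))"
proof -
  have "om f g = om (\<lambda>u. \<Sum>q<N * 2. vec_index (vecd f) q *\<^sub>R zb q u) (\<lambda>u. \<Sum>q<N * 2. vec_index (vecd g) q *\<^sub>R zb q u)"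
    by (simp only: deriv_expansion[OF assms(1), symmetric] deriv_expansion[OF assms(2), symmetric])
  then show ?thesis by (simp only: om_sum sum_distrib_left)
qed

text \<open>Testing with cocycles that vanish on one generator determines \<open>f\<close> on both
  generators by the single element \<open>z\<close>, which encodes the value of \<open>f\<close> on
  the boundary curve. The relation between the boundary curve and the generators then forces
  \<open>z = 0\<close>.\<close>

lemma om_nondegenerate:
  assumes f: "deriv f" and om: "\<And>g. deriv g \<Longrightarrow> om f g = 0"
  shows "f = (\<lambda>u. 0)"
proof -
  define z where "z = act (- c0) (f c0)"
  have tr: "Determinants.trace z = 0" by (simp add: z_def trace_ad deriv_trace[OF f])
  have fc: "f c0 = act c0 z" unfolding z_def by (rule act_inverse(1)[symmetric])
  have fcz: "form (f c0) (act c0 Y) = form z Y" for Y by (simp only: form_act z_def)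
  have "act (- gen A) (f (gen A)) - z = 0"
  proof (rule form_nondegenerate)
    fix Y :: "real ^ 4 ^ 4" assume Y: "Determinants.trace Y = 0"
    have tr0: "Determinants.trace (if i = B then Y else 0) = 0" for i using Y by simp
    obtain g where g: "deriv g" "\<And>i. g (gen i) = (if i = B then Y else 0)"
      using deriv_exists[of "\<lambda>i. if i = B then Y else 0", OF tr0] by blast
    have "om f g = form z Y - form (act (- gen A) (f (gen A))) Y"
    proof -
      have e: "g (gen A) = 0" "g (gen B) = Y" "g (gen B + gen A) = Y"
        by (simp_all add: g(2) deriv_add[OF g(1)] ad_zero)
      show ?thesis unfolding om_def fcz e form_act[of "f (gen A)"] by (simp add: ad_zero form_simps)
    qed
    then show "form (act (- gen A) (f (gen A)) - z) Y = 0" using om[OF g(1)] by (simp add: form_simps)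
  qed (simp add: trace_sub trace_ad deriv_trace[OF f] tr)
  then have fA: "f (gen A) = act (gen A) z" by (metis act_inverse(1) eq_iff_diff_eq_0)
  have "f (gen B) + z = 0"
  proof (rule form_nondegenerate)
    fix Y :: "real ^ 4 ^ 4" assume Y: "Determinants.trace Y = 0"
    \<comment> \<open>Chosen so that the test cocycle takes the value \<open>Y\<close> on
      \<open>gen B + gen A\<close>.\<close>
    define Y' where "Y' = act (- gen B) Y"
    have Y': "Determinants.trace Y' = 0" "act (gen B) Y' = Y" unfolding Y'_def using Y by (simp add: trace_ad, intro act_inverse(1))
    have tr0: "Determinants.trace (if i = A then Y' else 0) = 0" for i using Y' by simp
    obtain g where g: "deriv g" "\<And>i. g (gen i) = (if i = A then Y' else 0)"
      using deriv_exists[of "\<lambda>i. if i = A then Y' else 0", OF tr0] by blast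
    have "om f g = form (f (gen B)) Y + form z Y"
    proof -
      have e: "g (gen A) = Y'" "g (gen B) = 0" by (simp_all add: g(2))
      have e': "g (gen B + gen A) = Y"
        by (simp only: deriv_add[OF g(1), of "gen B" "gen A"] e Y'(2) add_0)
      show ?thesis unfolding om_def e' e Y'(2) fcz by (simp add: ad_zero form_simps)
    qed
    then show "form (f (gen B) + z) Y = 0" using om[OF g(1)] by (simp add: form_simps)
  qed (simp add: trace_add trace_ad deriv_trace[OF f] tr)
  then have fB: "f (gen B) = - z" by (simp add: eq_neg_iff_add_eq_0)
  \<comment> \<open>On the right side the two terms cancel; on the left side only a translate of
    \<open>z\<close> survives.\<close>
  have "f (c0 + (gen B + gen A)) = f (gen A + gen B)" by (simp only: boundary_relation)
  then have "act c0 z + act c0 (- z + act (gen B) (act (gen A) z)) = act (gen A) z + act (gen A) (- z)"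
    by (simp only: deriv_add[OF f] fc fA fB)
  then have "act c0 (act (gen B) (act (gen A) z)) = 0"
    by (simp add: ad_diff ad_minus)
  moreover have inj: "Y = 0" if "act u Y = 0" for u Y using act_inverse(2)[of u Y] that fga.act_0 by simp
  ultimately have z: "z = 0" by blast
  have "f (gen A) = 0" "f (gen B) = 0" unfolding fA fB z by (simp_all add: ad_zero)
  then have "f (gen i) = 0" for i by (cases i) simp_all
  then show ?thesis by (intro deriv_eqI[OF f deriv_zero])
qed

definition om_mat :: "real mat" where "om_mat = Matrix.mat (N * 2) (N * 2) (\<lambda>(p, q). om (zb p) (zb q))"

lemma om_mat_carrier [simp]: "om_mat \<in> carrier_mat (N * 2) (N * 2)" by (simp add: om_mat_def)

lemma M_isometry: "M_mat\<^sup>T * om_mat * M_mat = om_mat"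
proof (rule eq_matI)
  fix p q assume "p < dim_row om_mat" "q < dim_col om_mat"
  then have pq: "p < N * 2" "q < N * 2" by (simp_all add: om_mat_def)
  have "(M_mat\<^sup>T * om_mat * M_mat) $$ (p, q) =
      (\<Sum>r<N * 2. \<Sum>s<N * 2. M_mat $$ (r, p) * (M_mat $$ (s, q) * om_mat $$ (r, s)))"
    by (rule congruence_entry) (use pq in auto)
  also have "\<dots> = (\<Sum>r<N * 2. \<Sum>s<N * 2. vec_index (vecd (shift (zb p))) r * (vec_index (vecd (shift (zb q))) s * om (zb r) (zb s)))"
    using pq by (intro sum.cong refl) (simp add: M_mat_def lin_mat_def om_mat_def)
  also have "\<dots> = om (shift (zb p)) (shift (zb q))"
    using pq by (intro om_expansion[symmetric] deriv_shift deriv_zb)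
  also have "\<dots> = om_mat $$ (p, q)" using pq by (simp add: om_shift deriv_zb om_mat_def)
  finally show "(M_mat\<^sup>T * om_mat * M_mat) $$ (p, q) = om_mat $$ (p, q)" .
qed (auto simp: M_mat_def lin_mat_def om_mat_def)

text \<open>A kernel vector of the transpose is the coordinate vector of a cocycle that pairs to
  zero, as left argument, with every basis cocycle.\<close>

lemma det_om_mat: "Determinant.det om_mat \<noteq> 0"
proof
  assume "Determinant.det om_mat = 0"
  then have "Determinant.det om_mat\<^sup>T = 0" by (simp add: Determinant.det_transpose[OF om_mat_carrier])
  then obtain w where w: "w \<in> carrier_vec (N * 2)" "w \<noteq> 0\<^sub>v (N * 2)" "om_mat\<^sup>T *\<^sub>v w = 0\<^sub>v (N * 2)"
    using det_0_iff_vec_prod_zero_field[of "om_mat\<^sup>T" "N * 2"] by auto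
  obtain f where f: "deriv f" "vecd f = w" using vecd_surj[OF w(1)] by blast
  have 0: "(\<Sum>r<N * 2. vec_index w r * om (zb r) (zb s)) = 0" if s: "s < N * 2" for s
  proof -
    have "vec_index (om_mat\<^sup>T *\<^sub>v w) s = (\<Sum>r<N * 2. vec_index w r * om (zb r) (zb s))"
      using s w(1) by (simp add: om_mat_def scalar_prod_def lessThan_atLeast0 mult.commute)
    then show ?thesis using w(3) s by simp
  qed
  have "om f g = 0" if g: "deriv g" for g
  proof -
    have "om f g = (\<Sum>s<N * 2. \<Sum>r<N * 2. vec_index w r * (vec_index (vecd g) s * om (zb r) (zb s)))"
      unfolding om_expansion[OF f(1) g] f(2) by (rule sum.swap)
    also have "\<dots> = (\<Sum>s<N * 2. vec_index (vecd g) s * (\<Sum>r<N * 2. vec_index w r * om (zb r) (zb s)))"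
      by (simp add: sum_distrib_left ac_simps)
    also have "\<dots> = 0" by (rule sum.neutral) (simp add: 0)
    finally show ?thesis .
  qed
  then have "f = (\<lambda>u. 0)" using om_nondegenerate f(1) by blast
  then show False using f(2) w(2) vecd_zero by simp
qed

definition gram :: "real mat" where "gram = Matrix.mat N N (\<lambda>(p, q). form (Xs ! p) (Xs ! q))"

lemma gram_carrier [simp]: "gram \<in> carrier_mat N N" by (simp add: gram_def)

lemma form_expansion:
  assumes "Determinants.trace X = 0" "Determinants.trace Y = 0"
  shows "form X Y = (\<Sum>r<N. \<Sum>s<N. vec_index (co X) r * (vec_index (co Y) s * form (Xs ! r) (Xs ! s)))"
proof -
  have "form X Y = form (\<Sum>r<N. vec_index (co X) r *\<^sub>R Xs ! r) (\<Sum>r<N. vec_index (co Y) r *\<^sub>R Xs ! r)"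
    by (simp only: co_expansion[OF assms(1), symmetric] co_expansion[OF assms(2), symmetric])
  then show ?thesis
    by (simp only: form_sum(1) form_simps(5)) (simp only: form_sum(2) form_simps(6) sum_distrib_left)
qed

lemma Ad_mat_isometry: assumes "g \<in> carrier \<Gamma>" shows "(Ad_mat g)\<^sup>T * gram * Ad_mat g = gram"
proof (rule eq_matI)
  fix p q assume "p < dim_row gram" "q < dim_col gram"
  then have pq: "p < N" "q < N" by (simp_all add: gram_def)
  have "((Ad_mat g)\<^sup>T * gram * Ad_mat g) $$ (p, q) =
      (\<Sum>r<N. \<Sum>s<N. Ad_mat g $$ (r, p) * (Ad_mat g $$ (s, q) * gram $$ (r, s)))"
    by (rule congruence_entry) (use pq in auto)
  also have "\<dots> = (\<Sum>r<N. \<Sum>s<N. vec_index (co (ad g (Xs ! p))) r * (vec_index (co (ad g (Xs ! q))) s * form (Xs ! r) (Xs ! s)))"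
    using pq by (intro sum.cong refl) (simp add: Ad_mat_entry gram_def)
  also have "\<dots> = form (ad g (Xs ! p)) (ad g (Xs ! q))"
    using pq assms by (intro form_expansion[symmetric]) (simp_all add: trace_ad trace_Xs)
  also have "\<dots> = gram $$ (p, q)" using pq assms by (simp add: form_ad gram_def)
  finally show "((Ad_mat g)\<^sup>T * gram * Ad_mat g) $$ (p, q) = gram $$ (p, q)" .
qed (auto simp: gram_def Ad_mat_def matrix_of_def)

lemma det_gram: "Determinant.det gram \<noteq> 0"
proof
  assume "Determinant.det gram = 0"
  then obtain w where w: "w \<in> carrier_vec N" "w \<noteq> 0\<^sub>v N" "gram *\<^sub>v w = 0\<^sub>v N"
    using det_0_iff_vec_prod_zero_field[of gram N] by auto
  obtain X where X: "Determinants.trace X = 0" "co X = w" using co_surj[OF w(1)] by blast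
  have 0: "(\<Sum>s<N. vec_index w s * form (Xs ! r) (Xs ! s)) = 0" if r: "r < N" for r
  proof -
    have "vec_index (gram *\<^sub>v w) r = (\<Sum>s<N. vec_index w s * form (Xs ! r) (Xs ! s))"
      using r w(1) by (simp add: gram_def scalar_prod_def lessThan_atLeast0 mult.commute)
    then show ?thesis using w(3) r by simp
  qed
  have "X = 0"
  proof (rule form_nondegenerate)
    fix Y :: "real ^ 4 ^ 4" assume Y: "Determinants.trace Y = 0"
    have "form Y X = 0"
      unfolding form_expansion[OF Y X(1)] X(2) by (rule sum.neutral) (auto simp: 0 simp flip: sum_distrib_left)
    then show "form X Y = 0" by (simp add: form_commute)
  qed (rule X(1))
  then show False using X(2) w(2) co_zero by simp
qed

section \<open>Cohomology classes and the action of the quotient group\<close>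

definition toZ :: "(fiber_gen free_group \<Rightarrow> real ^ 4 ^ 4) \<Rightarrow> 'g \<Rightarrow> real ^ 4 ^ 4" where
  "toZ f = (\<lambda>g\<in>Fib. f (inv_into UNIV \<iota> g))"

lemma iota_Fib [simp]: "\<iota> u \<in> Fib" by (simp add: fiber_group_eq)

lemma toZ_iota [simp]: "toZ f (\<iota> u) = f u"
  by (simp add: toZ_def inj_fiber)

lemma Fib_ext: "F \<in> extensional Fib \<Longrightarrow> F' \<in> extensional Fib \<Longrightarrow> (\<And>u. F (\<iota> u) = F' (\<iota> u)) \<Longrightarrow> F = F'"
  by (rule extensionalityI) (auto simp: fiber_group_eq)

lemma toZ_ext: "toZ f \<in> extensional Fib" by (simp add: toZ_def)

lemma toZ_closed: "deriv f \<Longrightarrow> toZ f \<in> carrier Z1"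
proof -
  assume f: "deriv f"
  have "Determinants.trace (toZ f g) = 0" if "g \<in> Fib" for g
    using that deriv_trace[OF f] by (auto simp: toZ_def)
  moreover have "toZ f (g \<otimes>\<^bsub>\<Gamma>\<^esub> h) = toZ f g + ad g (toZ f h)" if gh: "g \<in> Fib" "h \<in> Fib" for g h
  proof -
    obtain u w where uw: "g = \<iota> u" "h = \<iota> w" using gh unfolding fiber_group_eq by blast
    show ?thesis unfolding uw fiber.free_eval_add[symmetric] toZ_iota by (rule deriv_add[OF f])
  qed
  ultimately show ?thesis unfolding Z1_carrier using toZ_ext by blast
qed

lemma toZ_surj: assumes "F \<in> carrier Z1" obtains f where "deriv f" "F = toZ f"
proof -
  have F: "F \<in> extensional Fib" "\<And>g. g \<in> Fib \<Longrightarrow> Determinants.trace (F g) = 0"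
    "\<And>g h. g \<in> Fib \<Longrightarrow> h \<in> Fib \<Longrightarrow> F (g \<otimes>\<^bsub>\<Gamma>\<^esub> h) = F g + ad g (F h)"
    using assms by (auto simp: Z1_carrier)
  have "deriv (\<lambda>u. F (\<iota> u))" unfolding deriv_def fga.crossed_def fiber.free_eval_add using F by simp
  moreover have "F = toZ (\<lambda>u. F (\<iota> u))" by (rule Fib_ext) (simp_all add: F toZ_ext)
  ultimately show thesis using that by blast
qed

lemma toZ_add: "toZ f \<oplus>\<^bsub>Z1\<^esub> toZ f' = toZ (\<lambda>u. f u + f' u)"
  by (rule Fib_ext) (simp_all add: Z1_simps toZ_ext)

lemma toZ_scale: "r \<odot>\<^bsub>Z1\<^esub> toZ f = toZ (\<lambda>u. r *\<^sub>R f u)"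
  by (rule Fib_ext) (simp_all add: Z1_simps toZ_ext)

lemma toZ_inj: "toZ f = toZ f' \<Longrightarrow> f = f'"
  by (metis ext toZ_iota)

lemma toZ_\<delta>d: "\<delta> X = toZ (\<delta>d X)"
  by (rule Fib_ext) (simp_all add: \<delta>_def \<delta>d_def toZ_ext)

sublocale qv: quotient_vectorspace Z1 B1
  by (rule quotient_vectorspace_H1)

abbreviation "HH \<equiv> H1 \<Gamma> Fib sl4 ad"
abbreviation "cls f \<equiv> qv.coset (toZ f)"

lemma HH_eq: "HH = qv.Q" by (simp add: H1_def)

lemma carrier_HH: "carrier HH = cls ` {f. deriv f}"
  unfolding HH_eq qv.carrier_quotient using toZ_closed toZ_surj by (auto simp: image_iff) metis

lemma cls_add: "deriv f \<Longrightarrow> deriv f' \<Longrightarrow> cls f \<oplus>\<^bsub>HH\<^esub> cls f' = cls (\<lambda>u. f u + f' u)"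
  unfolding HH_eq by (simp add: qv.coset_add toZ_closed toZ_add)

lemma cls_scale: "deriv f \<Longrightarrow> r \<odot>\<^bsub>HH\<^esub> cls f = cls (\<lambda>u. r *\<^sub>R f u)"
  unfolding HH_eq by (simp add: qv.coset_smult toZ_closed toZ_scale)

lemma bex_B1: "(\<exists>F\<in>B1. R F) \<longleftrightarrow> (\<exists>X. Determinants.trace X = 0 \<and> R (toZ (\<delta>d X)))"
  by (auto simp: B1_eq toZ_\<delta>d)

lemma mem_cls:
  assumes "deriv f"
  shows "F \<in> cls f \<longleftrightarrow> (\<exists>X. Determinants.trace X = 0 \<and> F = toZ (\<lambda>u. \<delta>d X u + f u))"
  unfolding qv.mem_coset[OF toZ_closed[OF assms]] bex_B1 toZ_add ..

lemma cls_eq_zero: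
  assumes "deriv f"
  shows "cls f = \<zero>\<^bsub>HH\<^esub> \<longleftrightarrow> (\<exists>X. Determinants.trace X = 0 \<and> f = \<delta>d X)"
proof -
  have "cls f = \<zero>\<^bsub>HH\<^esub> \<longleftrightarrow> (\<exists>F\<in>B1. toZ f = F)"
    unfolding HH_eq qv.zero_quotient qv.coset_eq_zero_iff[OF toZ_closed[OF assms]] by blast
  then show ?thesis unfolding bex_B1 using toZ_inj by blast
qed

lemma deriv_plus: "deriv f \<Longrightarrow> deriv f' \<Longrightarrow> deriv (\<lambda>u. f u + f' u)"
  by (simp add: deriv_def fga.crossed_def trace_add ad_add)

lemma deriv_scale: "deriv f \<Longrightarrow> deriv (\<lambda>u. r *\<^sub>R f u)"
  by (simp add: deriv_def fga.crossed_def trace_scaleR ad_scaleR scaleR_add_right)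

lemma shift_plus: "shift (\<lambda>u. f u + f' u) = (\<lambda>u. shift f u + shift f' u)"
  by (rule ext) (simp add: shift_def ad_add)

lemma shift_scale: "shift (\<lambda>u. r *\<^sub>R f u) = (\<lambda>u. r *\<^sub>R shift f u)"
  by (rule ext) (simp add: shift_def ad_scaleR)

text \<open>The fiber acts trivially on its own cohomology, here with an explicit coboundary:
  replacing the meridian by \<open>\<iota> w\<close> times the meridian adds the coboundary of
  \<open>shift f w\<close>.\<close>

lemma cocycle_action_toZ:
  assumes f: "deriv f"
  shows "cocycle_action \<Gamma> Fib ad (\<iota> w \<otimes>\<^bsub>\<Gamma>\<^esub> x) (toZ f) = toZ (\<lambda>u. \<delta>d (shift f w) u + shift f u)"
proof (rule Fib_ext)
  fix u
  define s where "s = shift f"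
  have s: "deriv s" unfolding s_def by (rule deriv_shift[OF f])
  \<comment> \<open>Conjugating by this representative means conjugating by \<open>w\<close> and
    then applying the inverse of \<open>\<phi>\<close>.\<close>
  define t where "t = inv_into UNIV \<phi> (- w + u + w)"
  have t: "\<phi> t = - w + u + w" by (simp add: t_def)
  have "\<iota> u \<otimes>\<^bsub>\<Gamma>\<^esub> (\<iota> w \<otimes>\<^bsub>\<Gamma>\<^esub> x) = (\<iota> w \<otimes>\<^bsub>\<Gamma>\<^esub> x) \<otimes>\<^bsub>\<Gamma>\<^esub> \<iota> t"
  proof -
    have "\<iota> w \<otimes>\<^bsub>\<Gamma>\<^esub> (x \<otimes>\<^bsub>\<Gamma>\<^esub> \<iota> t) = \<iota> (w + (- w + u + w)) \<otimes>\<^bsub>\<Gamma>\<^esub> x"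
      unfolding monodromy' t fiber.free_eval_add[of w] by (simp add: m_assoc)
    also have "w + (- w + u + w) = u + w" by (simp flip: add.assoc)
    finally show ?thesis by (simp add: m_assoc fiber.free_eval_add)
  qed
  then have conj: "inv\<^bsub>\<Gamma>\<^esub> (\<iota> w \<otimes>\<^bsub>\<Gamma>\<^esub> x) \<otimes>\<^bsub>\<Gamma>\<^esub> \<iota> u \<otimes>\<^bsub>\<Gamma>\<^esub> (\<iota> w \<otimes>\<^bsub>\<Gamma>\<^esub> x) = \<iota> t"
  proof -
    assume eq: "\<iota> u \<otimes>\<^bsub>\<Gamma>\<^esub> (\<iota> w \<otimes>\<^bsub>\<Gamma>\<^esub> x) = (\<iota> w \<otimes>\<^bsub>\<Gamma>\<^esub> x) \<otimes>\<^bsub>\<Gamma>\<^esub> \<iota> t"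
    define y where "y = \<iota> w \<otimes>\<^bsub>\<Gamma>\<^esub> x"
    have y: "y \<in> carrier \<Gamma>" by (simp add: y_def)
    have "inv\<^bsub>\<Gamma>\<^esub> y \<otimes>\<^bsub>\<Gamma>\<^esub> \<iota> u \<otimes>\<^bsub>\<Gamma>\<^esub> y = inv\<^bsub>\<Gamma>\<^esub> y \<otimes>\<^bsub>\<Gamma>\<^esub> (y \<otimes>\<^bsub>\<Gamma>\<^esub> \<iota> t)"
      using y eq[folded y_def] by (simp add: m_assoc)
    then show ?thesis using y by (simp add: y_def[symmetric]) (simp flip: m_assoc)
  qed
  have "s (- w + (u + w)) = s (- w) + act (- w) (s u + act u (s w))"
    by (simp only: deriv_add[OF s])
  moreover have "act w (s (- w)) = - s w"
    using s fga.crossed_minus[of s w] by (simp add: deriv_def fga.act_uminus act_inverse)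
  ultimately have "act w (s (- w + u + w)) = - s w + s u + act u (s w)"
    by (simp add: add.assoc fga.act_plus act_inverse)
  then have "act w (ad x (f t)) = \<delta>d (s w) u + s u"
    by (simp add: s_def shift_def t_def \<delta>d_def)
  then show "cocycle_action \<Gamma> Fib ad (\<iota> w \<otimes>\<^bsub>\<Gamma>\<^esub> x) (toZ f) (\<iota> u) = toZ (\<lambda>u. \<delta>d (shift f w) u + shift f u) (\<iota> u)"
    by (simp add: cocycle_action_def conj ad_mult s_def)
qed (simp_all add: cocycle_action_def toZ_ext)

abbreviation "T \<equiv> H1_action \<Gamma> Fib ad (Fib #>\<^bsub>\<Gamma>\<^esub> x)"

lemma \<delta>d_plus: "\<delta>d (X + Y) u = \<delta>d X u + \<delta>d Y u"
  by (simp add: \<delta>d_def ad_add)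

lemma H1_action_cls: assumes f: "deriv f" shows "T (cls f) = cls (shift f)"
proof
  have s: "deriv (shift f)" by (rule deriv_shift[OF f])
  have Q: "Fib #>\<^bsub>\<Gamma>\<^esub> x = (\<lambda>w. \<iota> w \<otimes>\<^bsub>\<Gamma>\<^esub> x) ` UNIV" by (auto simp: r_coset_def fiber_group_eq)
  show "T (cls f) \<subseteq> cls (shift f)"
  proof
    fix F assume "F \<in> T (cls f)"
    then obtain y F' where y: "y \<in> Fib #>\<^bsub>\<Gamma>\<^esub> x" and F': "F' \<in> cls f" "F = cocycle_action \<Gamma> Fib ad y F'"
      unfolding H1_action_def by (elim UN_E imageE)
    obtain w where w: "y = \<iota> w \<otimes>\<^bsub>\<Gamma>\<^esub> x" using y unfolding Q by (elim imageE)
    obtain Y where Y: "Determinants.trace Y = 0" "F' = toZ (\<lambda>u. \<delta>d Y u + f u)"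
      using F'(1) unfolding mem_cls[OF f] by (elim exE conjE)
    define X where "X = Y"
    have X: "Determinants.trace X = 0" "F = cocycle_action \<Gamma> Fib ad (\<iota> w \<otimes>\<^bsub>\<Gamma>\<^esub> x) (toZ (\<lambda>u. \<delta>d X u + f u))"
      using Y F'(2) by (simp_all add: X_def w)
    define f' where "f' u = \<delta>d X u + f u" for u
    have f': "deriv f'" unfolding f'_def by (rule deriv_plus[OF deriv_\<delta>d[OF X(1)] f])
    have "F = toZ (\<lambda>u. \<delta>d (shift f' w) u + shift f' u)" unfolding X(2) f'_def[symmetric] by (rule cocycle_action_toZ[OF f'])
    also have "(\<lambda>u. \<delta>d (shift f' w) u + shift f' u) = (\<lambda>u. \<delta>d (shift f' w + ad x X) u + shift f u)"
      unfolding f'_def shift_plus shift_\<delta>d by (simp add: \<delta>d_plus add.assoc)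
    finally have "F = toZ (\<lambda>u. \<delta>d (shift f' w + ad x X) u + shift f u)" .
    moreover have "Determinants.trace (shift f' w + ad x X) = 0"
      using X deriv_trace[OF deriv_shift[OF f']] by (simp add: trace_add trace_ad)
    ultimately show "F \<in> cls (shift f)" unfolding mem_cls[OF s] by (intro exI conjI)
  qed
  show "cls (shift f) \<subseteq> T (cls f)"
  proof
    fix F assume "F \<in> cls (shift f)"
    then obtain Y where Y: "Determinants.trace Y = 0" "F = toZ (\<lambda>u. \<delta>d Y u + shift f u)"
      unfolding mem_cls[OF s] by (elim exE conjE)
    \<comment> \<open>The representative with \<open>w = 0\<close> suffices, since
      \<open>ad x\<close> maps onto the traceless matrices and so reaches every coboundary.\<close>
    define X where "X = ad (inv\<^bsub>\<Gamma>\<^esub> x) Y"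
    have X: "Determinants.trace X = 0" "ad x X = Y"
      using Y by (simp_all add: X_def trace_ad ad_one flip: ad_mult)
    have f': "deriv (\<lambda>u. \<delta>d X u + f u)" by (rule deriv_plus[OF deriv_\<delta>d[OF X(1)] f])
    have "cocycle_action \<Gamma> Fib ad (\<iota> 0 \<otimes>\<^bsub>\<Gamma>\<^esub> x) (toZ (\<lambda>u. \<delta>d X u + f u)) = F"
      unfolding cocycle_action_toZ[OF f'] shift_plus shift_\<delta>d X(2) Y(2)
      using fga.crossed_zero[of "\<lambda>u. \<delta>d Y u + shift f u"] deriv_plus[OF deriv_\<delta>d[OF Y(1)] s]
      by (simp add: deriv_def \<delta>d_def ad_zero)
    moreover have "toZ (\<lambda>u. \<delta>d X u + f u) \<in> cls f" unfolding mem_cls[OF f] by (intro exI[of _ X] conjI X(1) refl)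
    ultimately have "F \<in> cocycle_action \<Gamma> Fib ad (\<iota> 0 \<otimes>\<^bsub>\<Gamma>\<^esub> x) ` cls f" by (intro image_eqI[OF sym])
    moreover have "\<iota> 0 \<otimes>\<^bsub>\<Gamma>\<^esub> x \<in> Fib #>\<^bsub>\<Gamma>\<^esub> x" unfolding Q by (rule rangeI)
    ultimately show "F \<in> T (cls f)" unfolding H1_action_def by (intro UN_I)
  qed
qed

end

lemma comm_ring_hom_to_fract: "comm_ring_hom (to_fract :: 'a :: idom \<Rightarrow> 'a fract)"
  by unfold_locales simp_all

lemma det_map_to_fract: "Determinant.det (map_mat to_fract Q) = to_fract (Determinant.det Q)"
  by (rule comm_ring_hom.hom_det[OF comm_ring_hom_to_fract])

section \<open>The exact sequence of coboundaries, cocycles and classes\<close>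

context cohomology
begin

lemma vectorspace_HH: "vectorspace class_ring HH"
  unfolding HH_eq by (rule qv.quotient_is_vectorspace)

text \<open>\<open>char_poly_endo\<close> picks a basis by \<open>SOME\<close>, so one must exist:
  cohomology is a linear image of the coordinate space of cocycles, hence
  finite-dimensional.\<close>

lemma ex_ordered_basis_HH: "\<exists>hs. ordered_basis HH hs"
proof -
  interpret W: vectorspace class_ring HH by (rule vectorspace_HH)
  interpret E: vec_space "TYPE(real)" "N * 2" .
  define S where "S w = cls (\<lambda>u. \<Sum>q<N * 2. vec_index w q *\<^sub>R zb q u)" for w :: "real Matrix.vec"
  have d: "deriv (\<lambda>u. \<Sum>q<N * 2. vec_index w q *\<^sub>R zb q u)" for w :: "real Matrix.vec"
    by (rule deriv_combination) (simp add: deriv_zb)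
  have S_carrier: "S w \<in> carrier HH" for w unfolding S_def carrier_HH using d by blast
  have S_add: "S (w + w') = S w \<oplus>\<^bsub>HH\<^esub> S w'" if "w \<in> carrier_vec (N * 2)" "w' \<in> carrier_vec (N * 2)" for w w'
  proof -
    have "(\<lambda>u. \<Sum>q<N * 2. vec_index (w + w') q *\<^sub>R zb q u) =
        (\<lambda>u. (\<Sum>q<N * 2. vec_index w q *\<^sub>R zb q u) + (\<Sum>q<N * 2. vec_index w' q *\<^sub>R zb q u))"
      using that by (simp add: sum.distrib[symmetric] scaleR_left.add[symmetric])
    then show ?thesis by (simp only: S_def cls_add[OF d d])
  qed
  have S_smult: "S (r \<cdot>\<^sub>v w) = r \<odot>\<^bsub>HH\<^esub> S w" if "w \<in> carrier_vec (N * 2)" for r w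
  proof -
    have "(\<lambda>u. \<Sum>q<N * 2. vec_index (r \<cdot>\<^sub>v w) q *\<^sub>R zb q u) = (\<lambda>u. r *\<^sub>R (\<Sum>q<N * 2. vec_index w q *\<^sub>R zb q u))"
      using that by (simp add: scaleR_sum_right)
    then show ?thesis by (simp only: S_def cls_scale[OF d])
  qed
  have hom: "S \<in> module_hom class_ring E.V HH"
    unfolding module_hom_def using S_carrier S_add S_smult by (auto simp: module_vec_simps)
  have lin: "linear_map class_ring E.V HH S"
    unfolding linear_map_def mod_hom_def mod_hom_axioms_def
    using hom E.vectorspace_axioms W.vectorspace_axioms E.module_axioms W.module_axioms by blast
  have "carrier HH \<subseteq> S ` carrier E.V"
  proof
    fix C assume "C \<in> carrier HH"
    then obtain f where f: "deriv f" "C = cls f" unfolding carrier_HH by blast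
    have "f = (\<lambda>u. \<Sum>q<N * 2. vec_index (vecd f) q *\<^sub>R zb q u)" using deriv_expansion[OF f(1)] by blast
    then have "C = S (vecd f)" unfolding S_def f(2) by metis
    then show "C \<in> S ` carrier E.V" by (simp add: module_vec_simps)
  qed
  then have "S ` carrier E.V = carrier HH" using S_carrier by blast
  then have "W.fin_dim" using linear_map.surj_fin_dim[OF lin E.fin_dim] by blast
  then obtain \<beta> where b: "finite \<beta>" "W.basis \<beta>" using W.finite_basis_exists by blast
  obtain hs where "distinct hs" "set hs = \<beta>" using finite_distinct_list[OF b(1)] by blast
  then show ?thesis using b by (auto simp: ordered_basis_def)
qed

text \<open>An instance of \<open>char_poly_exact_sequence\<close>, with the coboundary map as
  inclusion and the coordinates \<open>cc\<close> of the class as projection.\<close>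

lemma char_poly_M:
  assumes hs: "ordered_basis HH hs"
  shows "char_poly M_mat = char_poly (Ad_mat x) * char_poly (matrix_of HH hs T)"
proof -
  interpret W: vectorspace class_ring HH by (rule vectorspace_HH)
  interpret hc: coordinate_space HH hs
    using hs vectorspace_HH by (simp add: coordinate_space_def coordinate_space_axioms_def)
  define k where "k = length hs"
  define cc where "cc f = coordinates HH hs (cls f)" for f
  have cl: "cls f \<in> carrier HH" if "deriv f" for f using that unfolding carrier_HH by blast
  have cc_carrier: "cc f \<in> carrier_vec k" if "deriv f" for f
    unfolding cc_def k_def by (rule hc.coordinates_carrier[OF cl[OF that]])
  have cc_add: "cc (\<lambda>u. f u + f' u) = cc f + cc f'" if "deriv f" "deriv f'" for f f'
    unfolding cc_def cls_add[OF that, symmetric] by (rule hc.coordinates_add) (simp_all add: cl that)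
  have cc_scale: "cc (\<lambda>u. r *\<^sub>R f u) = r \<cdot>\<^sub>v cc f" if "deriv f" for f r
    unfolding cc_def cls_scale[OF that, symmetric] by (rule hc.coordinates_smult) (simp add: cl that)
  have cc_zero: "cc f = 0\<^sub>v k \<longleftrightarrow> (\<exists>X. Determinants.trace X = 0 \<and> f = \<delta>d X)" if "deriv f" for f
  proof -
    have "cc f = 0\<^sub>v k \<longleftrightarrow> cls f = \<zero>\<^bsub>HH\<^esub>"
      unfolding cc_def k_def hc.coordinates_zero[symmetric]
      by (rule iffI) (rule hc.coordinates_inj[OF cl[OF that] W.zero_closed], assumption, simp only:)
    then show ?thesis using cls_eq_zero[OF that] by simp
  qed
  have cc_sum: "cc (\<lambda>u. \<Sum>p\<in>I. a p *\<^sub>R h p u) = Matrix.vec k (\<lambda>r. \<Sum>p\<in>I. a p * vec_index (cc (h p)) r)"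
    if "finite I" "\<And>p. p \<in> I \<Longrightarrow> deriv (h p)" for I a and h :: "nat \<Rightarrow> fiber_gen free_group \<Rightarrow> real ^ 4 ^ 4"
    using that
  proof (induction I)
    case empty
    have "\<delta>d 0 = (\<lambda>u. 0)" by (rule ext) (simp add: \<delta>d_def ad_zero)
    then have "cc (\<lambda>u. 0) = 0\<^sub>v k" using cc_zero[OF deriv_zero] by (metis trace_zero)
    then show ?case by auto
  next
    case (insert p I)
    have d: "deriv (h p)" "deriv (\<lambda>u. a p *\<^sub>R h p u)" "deriv (\<lambda>u. \<Sum>p\<in>I. a p *\<^sub>R h p u)"
      using insert by (auto intro!: deriv_scale deriv_combination)
    have "cc (\<lambda>u. \<Sum>p\<in>insert p I. a p *\<^sub>R h p u) = a p \<cdot>\<^sub>v cc (h p) + cc (\<lambda>u. \<Sum>p\<in>I. a p *\<^sub>R h p u)"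
      using insert.hyps by (simp add: cc_add[OF d(2,3)] cc_scale[OF d(1)])
    then show ?case using insert cc_carrier[OF d(1)] by auto
  qed
  define P where "P = Matrix.mat k (N * 2) (\<lambda>(r, p). vec_index (cc (zb p)) r)"
  have P: "P \<in> carrier_mat k (N * 2)" by (simp add: P_def)
  have Pv: "P *\<^sub>v vecd f = cc f" if f: "deriv f" for f
  proof -
    have "cc f = cc (\<lambda>u. \<Sum>p<N * 2. vec_index (vecd f) p *\<^sub>R zb p u)"
      by (simp only: deriv_expansion[OF f, symmetric])
    also have "\<dots> = Matrix.vec k (\<lambda>r. \<Sum>p<N * 2. vec_index (vecd f) p * vec_index (cc (zb p)) r)"
      by (rule cc_sum) (simp_all add: deriv_zb)
    also have "\<dots> = P *\<^sub>v vecd f"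
      by (intro eq_vecI) (simp_all add: P_def scalar_prod_def lessThan_atLeast0 mult.commute)
    finally show ?thesis by simp
  qed
  have H: "matrix_of HH hs T \<in> carrier_mat k k" unfolding k_def by (rule hc.matrix_of_carrier)
  have HT: "cc (shift f) = matrix_of HH hs T *\<^sub>v cc f" if f: "deriv f" for f
  proof -
    have "coordinates HH hs (T (cls f)) = matrix_of HH hs T *\<^sub>v coordinates HH hs (cls f)"
    proof (rule hc.coordinates_matrix_of)
      fix C assume "C \<in> carrier HH"
      then obtain g where g: "deriv g" "C = cls g" unfolding carrier_HH by blast
      show "T C \<in> carrier HH" unfolding g(2) H1_action_cls[OF g(1)] by (rule cl[OF deriv_shift[OF g(1)]])
      show "T (r \<odot>\<^bsub>HH\<^esub> C) = r \<odot>\<^bsub>HH\<^esub> T C" for r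
        unfolding g(2) cls_scale[OF g(1)] H1_action_cls[OF g(1)] H1_action_cls[OF deriv_scale[OF g(1)]]
          cls_scale[OF deriv_shift[OF g(1)]] shift_scale ..
      fix C' assume "C' \<in> carrier HH"
      then obtain g' where g': "deriv g'" "C' = cls g'" unfolding carrier_HH by blast
      show "T (C \<oplus>\<^bsub>HH\<^esub> C') = T C \<oplus>\<^bsub>HH\<^esub> T C'"
        unfolding g(2) g'(2) cls_add[OF g(1) g'(1)] H1_action_cls[OF g(1)] H1_action_cls[OF g'(1)]
          H1_action_cls[OF deriv_plus[OF g(1) g'(1)]] cls_add[OF deriv_shift[OF g(1)] deriv_shift[OF g'(1)]] shift_plus ..
    qed (rule cl[OF f])
    then show ?thesis unfolding cc_def H1_action_cls[OF f] .
  qed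
  show ?thesis
  proof (rule char_poly_exact_sequence[OF I_mat_carrier P mats_carrier(1) Ad_mat_carrier H M_I])
    show "P * M_mat = matrix_of HH hs T * P"
    proof (rule eq_mat_unit_vecI[of _ k "N * 2"])
      fix q assume q: "q < N * 2"
      note d = deriv_zb[OF q]
      have "(P * M_mat) *\<^sub>v vecd (zb q) = P *\<^sub>v (M_mat *\<^sub>v vecd (zb q))"
        by (rule assoc_mult_mat_vec[OF P mats_carrier(1)]) simp
      also have "\<dots> = matrix_of HH hs T *\<^sub>v (P *\<^sub>v vecd (zb q))"
        unfolding M_mat[OF d] Pv[OF deriv_shift[OF d]] Pv[OF d] by (rule HT[OF d])
      also have "\<dots> = (matrix_of HH hs T * P) *\<^sub>v vecd (zb q)"
        by (rule assoc_mult_mat_vec[OF H P, symmetric]) simp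
      finally show "(P * M_mat) *\<^sub>v unit_vec (N * 2) q = (matrix_of HH hs T * P) *\<^sub>v unit_vec (N * 2) q"
        unfolding vecd_zb[OF q] .
    qed (use P H in \<open>auto intro: mult_carrier_mat[of _ _ "N * 2"] mult_carrier_mat[of _ _ k]\<close>)
    show "w \<in> carrier_vec N \<Longrightarrow> I_mat *\<^sub>v w = 0\<^sub>v (N * 2) \<Longrightarrow> w = 0\<^sub>v N" for w by (rule I_mat_inj)
    show "\<exists>v\<in>carrier_vec (N * 2). P *\<^sub>v v = w" if w: "w \<in> carrier_vec k" for w
    proof -
      have "hc.combination w \<in> carrier HH" by simp
      then obtain f where f: "deriv f" "hc.combination w = cls f" unfolding carrier_HH by blast
      have "P *\<^sub>v vecd f = w"
        unfolding Pv[OF f(1)] cc_def f(2)[symmetric] by (rule hc.coordinates_combination) (use w k_def in simp)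
      then show ?thesis using vecg_carrier by blast
    qed
    show "P *\<^sub>v (I_mat *\<^sub>v w) = 0\<^sub>v k" if w: "w \<in> carrier_vec N" for w
    proof -
      obtain X where X: "Determinants.trace X = 0" "co X = w" using co_surj[OF w] by blast
      show ?thesis
        unfolding X(2)[symmetric] I_mat[OF X(1)] Pv[OF deriv_\<delta>d[OF X(1)]] cc_zero[OF deriv_\<delta>d[OF X(1)]] using X(1) by blast
    qed
    show "\<exists>v\<in>carrier_vec N. w = I_mat *\<^sub>v v" if w: "w \<in> carrier_vec (N * 2)" "P *\<^sub>v w = 0\<^sub>v k" for w
    proof -
      obtain f where f: "deriv f" "vecd f = w" using vecd_surj[OF w(1)] by blast
      have "cc f = 0\<^sub>v k" using w(2) Pv[OF f(1)] f(2) by simp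
      then obtain X where X: "Determinants.trace X = 0" "f = \<delta>d X" using cc_zero[OF f(1)] by blast
      have "w = I_mat *\<^sub>v co X" unfolding I_mat[OF X(1)] using f(2) X(2) by simp
      then show ?thesis using co_carrier[OF X(1)] by blast
    qed
  qed
qed

section \<open>The Alexander matrix\<close>

definition weight :: "bundle_gen free_group \<Rightarrow> nat \<Rightarrow> nat \<Rightarrow> real poly fract" where
  "weight w i j = t_var powi \<alpha> (free_eval \<Gamma> v w) * const_fract (Ad_mat (free_eval \<Gamma> v w) $$ (i, j))"

text \<open>The entries of \<open>alexander_hom\<close> as a function of two indices, which turns
  the Fox rules into identities between finite sums.\<close>

definition AH :: "(bundle_gen free_group \<Rightarrow>\<^sub>0 int) \<Rightarrow> nat \<Rightarrow> nat \<Rightarrow> real poly fract" where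
  "AH p i j = (\<Sum>w\<in>Poly_Mapping.keys p. of_int (Poly_Mapping.lookup p w) * weight w i j)"

text \<open>Terms may cancel in a difference, so its support is only contained in the union of the
  supports; summing over a common larger set gives additivity.\<close>

lemma AH_superset:
  assumes "finite S" "Poly_Mapping.keys p \<subseteq> S"
  shows "AH p i j = (\<Sum>w\<in>S. of_int (Poly_Mapping.lookup p w) * weight w i j)"
  unfolding AH_def by (rule sum.mono_neutral_left) (use assms in \<open>auto simp: in_keys_iff\<close>)

lemma AH_diff: "AH (p - q) i j = AH p i j - AH q i j"
proof -
  let ?S = "Poly_Mapping.keys p \<union> Poly_Mapping.keys q"
  have "Poly_Mapping.keys (p - q) \<subseteq> ?S" by (auto simp: in_keys_iff lookup_minus)
  then show ?thesis
    using AH_superset[of ?S "p - q"] AH_superset[of ?S p] AH_superset[of ?S q]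
    by (simp add: lookup_minus sum_subtractf left_diff_distrib)
qed

lemma AH_zero: "AH 0 i j = 0" by (simp add: AH_def)

lemma AH_minus: "AH (- p) i j = - AH p i j"
  using AH_diff[of 0 p] by (simp add: AH_zero)

lemma AH_add: "AH (p + q) i j = AH p i j + AH q i j"
  using AH_diff[of p "- q"] by (simp add: AH_minus)

lemma AH_single: "AH (Poly_Mapping.single w 1) i j = weight w i j"
  by (simp add: AH_def)

lemma Ad_mat_dim [simp]: "dim_row (Ad_mat g) = N" "dim_col (Ad_mat g) = N"
  using Ad_mat_carrier[of g] by (auto simp del: Ad_mat_carrier)

lemma const_fract_add: "const_fract (a + b :: real) = const_fract a + const_fract b"
  by (simp flip: to_fract_add)

lemma const_fract_mult: "const_fract (a * b :: real) = const_fract a * const_fract b"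
  by (simp flip: to_fract_mult)

lemma const_fract_minus: "const_fract (- a :: real) = - const_fract a"
  by (simp flip: to_fract_uminus)

lemma const_fract_sum: "const_fract (\<Sum>r\<in>I. a r) = (\<Sum>r\<in>I. const_fract (a r :: real))"
proof (induction I rule: infinite_finite_induct)
  case (insert r I)
  then show ?case by (simp only: sum.insert[OF insert.hyps] const_fract_add)
qed simp_all

lemma Ad_mat_mult:
  assumes "g \<in> carrier \<Gamma>" "h \<in> carrier \<Gamma>" "i < N" "j < N"
  shows "Ad_mat (g \<otimes>\<^bsub>\<Gamma>\<^esub> h) $$ (i, j) = (\<Sum>r<N. Ad_mat g $$ (i, r) * Ad_mat h $$ (r, j))"
proof -
  have tr: "Determinants.trace (ad h (Xs ! j)) = 0" using assms by (simp add: trace_ad trace_Xs)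
  have "Ad_mat (g \<otimes>\<^bsub>\<Gamma>\<^esub> h) $$ (i, j) = vec_index (Ad_mat g *\<^sub>v co (ad h (Xs ! j))) i"
    using assms tr by (simp add: Ad_mat_entry ad_mult co_ad)
  also have "\<dots> = (\<Sum>r<N. Ad_mat g $$ (i, r) * vec_index (co (ad h (Xs ! j))) r)"
    using assms co_carrier[OF tr] Ad_mat_carrier[of g] by (simp add: scalar_prod_def lessThan_atLeast0)
  finally show ?thesis using assms by (simp add: Ad_mat_entry)
qed

lemma Ad_mat_one: "i < N \<Longrightarrow> j < N \<Longrightarrow> Ad_mat \<one>\<^bsub>\<Gamma>\<^esub> $$ (i, j) = (if i = j then 1 else 0)"
  by (simp add: Ad_mat_entry ad_one sl.coordinates_basis)

lemma alpha_one: "\<alpha> \<one>\<^bsub>\<Gamma>\<^esub> = 0"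
  using alpha_iota[of 0] by simp

lemma weight_mult: "i < N \<Longrightarrow> j < N \<Longrightarrow> weight (u + w) i j = (\<Sum>r<N. weight u i r * weight w r j)"
proof -
  assume ij: "i < N" "j < N"
  have t: "(t_var :: real poly fract) \<noteq> 0" by simp
  let ?g = "free_eval \<Gamma> v u" and ?h = "free_eval \<Gamma> v w"
  show ?thesis
    using ij by (simp add: weight_def total.free_eval_add Ad_mat_mult const_fract_sum const_fract_mult alpha_mult power_int_add[OF disjI1[OF t]] sum_distrib_left ac_simps)
qed

lemma weight_kernel: "free_eval \<Gamma> v w = \<one>\<^bsub>\<Gamma>\<^esub> \<Longrightarrow> i < N \<Longrightarrow> j < N \<Longrightarrow> weight w i j = (if i = j then 1 else 0)"
  by (simp add: weight_def alpha_one Ad_mat_one flip: one_pCons)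

lemma AH_one: "i < N \<Longrightarrow> j < N \<Longrightarrow> AH 1 i j = (if i = j then 1 else 0)"
  using weight_kernel[of 0 i j] by (simp add: AH_single flip: single_one)

text \<open>Multiplication from the left by a group element is the case that occurs in the product
  rule. The group ring is additively generated by group elements, over which
  \<open>frag_induction\<close> runs.\<close>

lemma AH_mult: assumes "i < N" "j < N"
  shows "AH (Poly_Mapping.single u 1 * p) i j = (\<Sum>r<N. weight u i r * AH p r j)"
proof (rule frag_induction[of p UNIV])
  show "AH (Poly_Mapping.single u 1 * 0) i j = (\<Sum>r<N. weight u i r * AH 0 r j)" by (simp add: AH_zero)
  show "AH (Poly_Mapping.single u 1 * frag_of w) i j = (\<Sum>r<N. weight u i r * AH (frag_of w) r j)" for w
    using assms by (simp add: mult_single AH_single weight_mult)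
  fix p q
  assume "AH (Poly_Mapping.single u 1 * p) i j = (\<Sum>r<N. weight u i r * AH p r j)"
    "AH (Poly_Mapping.single u 1 * q) i j = (\<Sum>r<N. weight u i r * AH q r j)"
  then show "AH (Poly_Mapping.single u 1 * (p - q)) i j = (\<Sum>r<N. weight u i r * AH (p - q) r j)"
    by (simp add: right_diff_distrib AH_diff sum_subtractf)
qed simp

lemma AH_fox_add:
  "i < N \<Longrightarrow> j < N \<Longrightarrow> AH (fox l (u + w)) i j = AH (fox l u) i j + (\<Sum>r<N. weight u i r * AH (fox l w) r j)"
  by (simp add: fox_add AH_add AH_mult)

lemma fox_zero: "fox l 0 = 0"
  by (simp add: fox_def zero_free_group.rep_eq)

lemma fox_minus: "fox l (- u) = - (Poly_Mapping.single (- u) 1 * fox l u)"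
  using fox_add[of l "- u" u] by (simp add: fox_zero eq_neg_iff_add_eq_0)

lemma weight_emb: "weight (emb u) i j = const_fract (Ad_mat (\<iota> u) $$ (i, j))"
  by (simp add: weight_def eval_emb alpha_iota)

lemma co_act: "Determinants.trace X = 0 \<Longrightarrow> i < N \<Longrightarrow>
    vec_index (co (act u X)) i = (\<Sum>r<N. Ad_mat (\<iota> u) $$ (i, r) * vec_index (co X) r)"
  using co_carrier[of X] Ad_mat_carrier[of "\<iota> u"] by (simp add: co_ad scalar_prod_def lessThan_atLeast0)

text \<open>On words in the generators of the fiber the Fox derivatives evaluate to the matrix entries
  of the crossed homomorphisms that form the basis \<^term>\<open>zb\<close>: both satisfy the product rule.\<close>

lemma AH_fox_emb:
  assumes q: "q < N * 2" and i: "i < N"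
  shows "AH (fox (Fiber (gidx q)) (emb u)) i (q mod N) = const_fract (vec_index (co (zb q u)) i)"
proof -
  note m = mod_less_N[OF q] and d = deriv_zb[OF q]
  \<comment> \<open>All rows are treated at once because the product rule mixes them.\<close>
  define R where "R u \<longleftrightarrow> (\<forall>i<N. AH (fox (Fiber (gidx q)) (emb u)) i (q mod N) = const_fract (vec_index (co (zb q u)) i))" for u
  have co_plus: "vec_index (co (zb q u + Y)) r = vec_index (co (zb q u)) r + vec_index (co Y) r"
    if "Determinants.trace Y = 0" "r < N" for u Y r
    using that sl.coordinates_add[of "zb q u" Y] co_carrier[of "zb q u"] co_carrier[of Y] deriv_trace[OF d] by simp
  have add: "R (u + w)" if "R u" "R w" for u w
    unfolding R_def
  proof (intro allI impI)
    fix i assume i: "i < N"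
    have "AH (fox (Fiber (gidx q)) (emb (u + w))) i (q mod N) = const_fract (vec_index (co (zb q u)) i) +
        (\<Sum>r<N. const_fract (Ad_mat (\<iota> u) $$ (i, r)) * const_fract (vec_index (co (zb q w)) r))"
      using that i m by (simp add: emb_add AH_fox_add R_def weight_emb)
    also have "\<dots> = const_fract (vec_index (co (zb q u)) i + (\<Sum>r<N. Ad_mat (\<iota> u) $$ (i, r) * vec_index (co (zb q w)) r))"
      by (simp only: const_fract_sum const_fract_add const_fract_mult)
    also have "\<dots> = const_fract (vec_index (co (zb q (u + w))) i)"
      using i by (simp add: deriv_add[OF d] co_plus co_act trace_ad deriv_trace[OF d])
    finally show "AH (fox (Fiber (gidx q)) (emb (u + w))) i (q mod N) = const_fract (vec_index (co (zb q (u + w))) i)" .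
  qed
  have zero: "R 0"
    unfolding R_def using free.free_eval_zero fga.crossed_zero[of "zb q"] d
    by (simp add: fox_zero AH_zero deriv_def co_zero)
  have gen: "R (gen j)" for j
    unfolding R_def using m sl.coordinates_basis[OF m]
    by (auto simp: emb_gen fox_gen AH_one AH_zero zb_gen[OF q] co_zero simp flip: one_pCons)
  have minus: "R (- u)" if "R u" for u
    unfolding R_def
  proof (intro allI impI)
    fix i assume i: "i < N"
    have "AH (fox (Fiber (gidx q)) (emb (- u))) i (q mod N) =
        - (\<Sum>r<N. const_fract (Ad_mat (\<iota> (- u)) $$ (i, r)) * const_fract (vec_index (co (zb q u)) r))"
      using that i m weight_emb[of "- u"] by (simp add: emb_minus fox_minus AH_minus AH_mult R_def)
    also have "\<dots> = const_fract (- (\<Sum>r<N. Ad_mat (\<iota> (- u)) $$ (i, r) * vec_index (co (zb q u)) r))"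
      by (simp only: const_fract_sum const_fract_minus const_fract_mult)
    also have "\<dots> = const_fract (vec_index (co (zb q (- u))) i)"
    proof -
      have "zb q (- u + u) = zb q (- u) + act (- u) (zb q u)" by (rule deriv_add[OF d])
      then have "vec_index (co (zb q (- u) + act (- u) (zb q u))) i = 0"
        using fga.crossed_zero[of "zb q"] d i by (simp add: deriv_def co_zero)
      then have "vec_index (co (zb q (- u))) i = - (\<Sum>r<N. Ad_mat (\<iota> (- u)) $$ (i, r) * vec_index (co (zb q u)) r)"
        using i by (simp only: co_plus co_act trace_ad fiber.free_eval_closed deriv_trace[OF d])
      then show ?thesis by simp
    qed
    finally show "AH (fox (Fiber (gidx q)) (emb (- u))) i (q mod N) = const_fract (vec_index (co (zb q (- u))) i)" .
  qed
  have "R u"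
  proof (induction u rule: free_group_induct)
    case (add l u)
    have "R (letter_val l)" using gen minus by (cases l) (auto simp: letter_val_def)
    then show ?case using add.IH \<open>\<And>u w. R u \<Longrightarrow> R w \<Longrightarrow> R (u + w)\<close> by blast
  qed (rule zero)
  then show ?thesis using i by (simp add: R_def)
qed

text \<open>The relator \<open>r\<close> evaluates to 1, so \<open>r + w = u\<close> makes its
  derivative the difference of those of \<open>u\<close> and \<open>w\<close>. In the conjugate
  \<open>w\<close> only the fiber letter contributes, and the meridian in front of it supplies the
  factor t.\<close>

lemma AH_fox_relator:
  assumes q: "q < N * 2" and i: "i < N"
  shows "AH (fox (Fiber (gidx q)) (bundle_relator \<phi> l)) i (q mod N) =
    const_fract (vec_index (co (zb q (\<phi> (gen l)))) i) -
    (if l = gidx q then t_var * const_fract (Ad_mat x $$ (i, q mod N)) else 0)"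
proof -
  note m = mod_less_N[OF q]
  define j where "j = Fiber (gidx q)"
  define u where "u = emb (\<phi> (gen l))"
  define w :: "bundle_gen free_group" where "w = gen Meridian + gen (Fiber l) - gen Meridian"
  define r where "r = bundle_relator \<phi> l"
  have kernel_sum: "(\<Sum>s<N. (if i = s then 1 else 0) * F s) = F i" for F :: "nat \<Rightarrow> real poly fract"
    using i by (simp add: if_distrib[of "\<lambda>y. y * _"] cong: if_cong)
  have "r + w = u" by (simp add: r_def u_def w_def bundle_relator_def)
  then have "AH (fox j u) i (q mod N) = AH (fox j r) i (q mod N) + (\<Sum>s<N. weight r i s * AH (fox j w) s (q mod N))"
    using AH_fox_add[OF i m, of j r w] by simp
  also have "(\<Sum>s<N. weight r i s * AH (fox j w) s (q mod N)) = (\<Sum>s<N. (if i = s then 1 else 0) * AH (fox j w) s (q mod N))"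
    by (rule sum.cong) (use i in \<open>simp_all add: weight_kernel r_def relator_kernel\<close>)
  finally have 1: "AH (fox j r) i (q mod N) = AH (fox j u) i (q mod N) - AH (fox j w) i (q mod N)"
    unfolding kernel_sum by simp
  have M0: "fox j (gen Meridian) = 0" by (simp add: j_def fox_gen)
  \<comment> \<open>Moving the inverse of the meridian to the other side avoids the derivative of an
    inverse.\<close>
  have "w + gen Meridian = gen Meridian + gen (Fiber l)" by (simp add: w_def)
  then have "AH (fox j w) i (q mod N) = (\<Sum>s<N. weight (gen Meridian) i s * AH (fox j (gen (Fiber l))) s (q mod N))"
    using AH_fox_add[OF i m, of j w "gen Meridian"] AH_fox_add[OF i m, of j "gen Meridian" "gen (Fiber l)"]
    by (simp add: M0 AH_zero)
  also have "\<dots> = (\<Sum>s<N. if s = q mod N then (if l = gidx q then weight (gen Meridian) i s else 0) else 0)"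
    by (rule sum.cong) (use m in \<open>auto simp: j_def fox_gen AH_one AH_zero\<close>)
  also have "\<dots> = (if l = gidx q then t_var * const_fract (Ad_mat x $$ (i, q mod N)) else 0)"
    using m by (simp add: weight_def alpha_meridian)
  finally have 2: "AH (fox j w) i (q mod N) = (if l = gidx q then t_var * const_fract (Ad_mat x $$ (i, q mod N)) else 0)" .
  show ?thesis
    using 1 unfolding 2 unfolding j_def u_def r_def AH_fox_emb[OF q i] .
qed

lemma alexander_hom_entry: "i < N \<Longrightarrow> j < N \<Longrightarrow> alexander_hom \<Gamma> v N Ad_mat \<alpha> p $$ (i, j) = AH p i j"
  by (simp add: alexander_hom_def AH_def weight_def)

lemma alexander_matrix_eq:
  "alexander_matrix \<Gamma> v [Fiber A, Fiber B] (bundle_relators \<phi>) N Ad_mat \<alpha> =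
     map_mat to_fract (const_mat J_mat - [:0, 1:] \<cdot>\<^sub>m const_mat X2_mat)"
proof (rule eq_matI)
  fix p q
  assume "p < dim_row (map_mat to_fract (const_mat J_mat - [:0, 1:] \<cdot>\<^sub>m const_mat X2_mat) :: real poly fract mat)"
    "q < dim_col (map_mat to_fract (const_mat J_mat - [:0, 1:] \<cdot>\<^sub>m const_mat X2_mat) :: real poly fract mat)"
  then have p: "p < N * 2" and q: "q < N * 2" using mats_carrier by auto
  have div: "p div N < 2" "q div N < 2" using p q by (simp_all add: less_mult_imp_div_less mult.commute)
  then have idx: "[Fiber A, Fiber B] ! (q div N) = Fiber (gidx q)" "bundle_relators \<phi> ! (p div N) = bundle_relator \<phi> (gidx p)"
    by (auto simp: gidx_def bundle_relators_def less_2_cases_iff)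
  have "alexander_matrix \<Gamma> v [Fiber A, Fiber B] (bundle_relators \<phi>) N Ad_mat \<alpha> $$ (p, q) =
      AH (fox (Fiber (gidx q)) (bundle_relator \<phi> (gidx p))) (p mod N) (q mod N)"
    using p q mod_less_N[OF p] mod_less_N[OF q]
    by (simp add: alexander_matrix_def bundle_relators_def[THEN arg_cong[where f = length]] idx alexander_hom_entry)
  also have "\<dots> = const_fract (J_mat $$ (p, q)) - t_var * const_fract (X2_mat $$ (p, q))"
    using p q unfolding AH_fox_relator[OF q mod_less_N[OF p]] X2_entry[OF p q]
    by (simp add: J_mat_def lin_mat_def vecg_def)
  also have "\<dots> = map_mat to_fract (const_mat J_mat - [:0, 1:] \<cdot>\<^sub>m const_mat X2_mat) $$ (p, q)"
    using p q carrier_matD[OF mats_carrier(2)] carrier_matD[OF mats_carrier(3)]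
    by (simp del: mult_pCons_left mult_pCons_right)
  finally show "alexander_matrix \<Gamma> v [Fiber A, Fiber B] (bundle_relators \<phi>) N Ad_mat \<alpha> $$ (p, q) =
      map_mat to_fract (const_mat J_mat - [:0, 1:] \<cdot>\<^sub>m const_mat X2_mat) $$ (p, q)" .
qed (use carrier_matD[OF mats_carrier(3)] in \<open>simp_all add: alexander_matrix_def bundle_relators_def\<close>)

lemma alexander_hom_meridian:
  "alexander_hom \<Gamma> v N Ad_mat \<alpha> (1 - Poly_Mapping.single (gen Meridian) 1) =
     map_mat to_fract (1\<^sub>m N - [:0, 1:] \<cdot>\<^sub>m const_mat (Ad_mat x))"
proof (rule eq_matI)
  fix i j
  assume "i < dim_row (map_mat to_fract (1\<^sub>m N - [:0, 1:] \<cdot>\<^sub>m const_mat (Ad_mat x)) :: real poly fract mat)"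
    "j < dim_col (map_mat to_fract (1\<^sub>m N - [:0, 1:] \<cdot>\<^sub>m const_mat (Ad_mat x)) :: real poly fract mat)"
  then have ij: "i < N" "j < N" by auto
  then show "alexander_hom \<Gamma> v N Ad_mat \<alpha> (1 - Poly_Mapping.single (gen Meridian) 1) $$ (i, j) =
      map_mat to_fract (1\<^sub>m N - [:0, 1:] \<cdot>\<^sub>m const_mat (Ad_mat x)) $$ (i, j)"
    by (simp add: alexander_hom_entry AH_diff AH_one AH_single weight_def alpha_meridian
        del: mult_pCons_left mult_pCons_right)
qed (auto simp: alexander_hom_def)

lemma alexander_hom_fiber:
  "alexander_hom \<Gamma> v N Ad_mat \<alpha> (1 - Poly_Mapping.single (gen (Fiber l)) 1) =
     map_mat to_fract (const_mat (1\<^sub>m N - Ad_mat (\<iota> (gen l))))"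
proof (rule eq_matI)
  fix i j
  assume "i < dim_row (map_mat to_fract (const_mat (1\<^sub>m N - Ad_mat (\<iota> (gen l)))) :: real poly fract mat)"
    "j < dim_col (map_mat to_fract (const_mat (1\<^sub>m N - Ad_mat (\<iota> (gen l)))) :: real poly fract mat)"
  then have ij: "i < N" "j < N" by auto
  have w: "weight (gen (Fiber l)) i j = const_fract (Ad_mat (\<iota> (gen l)) $$ (i, j))"
    using weight_emb[of "gen l" i j] by (simp only: emb_gen)
  have d: "const_fract (a - b :: real) = const_fract a - const_fract b" for a b by (simp flip: to_fract_diff)
  have e: "map_mat to_fract (const_mat (1\<^sub>m N - Ad_mat (\<iota> (gen l)))) $$ (i, j) =
      const_fract ((if i = j then 1 else 0) - Ad_mat (\<iota> (gen l)) $$ (i, j))"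
    using ij by simp
  show "alexander_hom \<Gamma> v N Ad_mat \<alpha> (1 - Poly_Mapping.single (gen (Fiber l)) 1) $$ (i, j) =
      map_mat to_fract (const_mat (1\<^sub>m N - Ad_mat (\<iota> (gen l)))) $$ (i, j)"
    unfolding e d alexander_hom_entry[OF ij] AH_diff AH_single AH_one[OF ij] w by (simp flip: one_pCons)
qed (auto simp: alexander_hom_def)

text \<open>The traceless part of a matrix is fixed by conjugation with that matrix, so the generators
  of the fiber are useless for normalising the Alexander polynomial.\<close>

lemma det_fiber_generator: "Determinant.det (1\<^sub>m N - Ad_mat (\<iota> (gen l))) = 0"
proof -
  define g where "g = \<iota> (gen l)"
  have g: "g \<in> carrier \<Gamma>" by (simp add: g_def)
  define r where "r = Determinants.trace (lift g) / 4"
  define Y where "Y = lift g - r *\<^sub>R Finite_Cartesian_Product.mat 1"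
  have tr: "Determinants.trace Y = 0"
    by (simp add: Y_def trace_sub trace_scaleR trace_I r_def)
  have inv: "lift g ** lift (inv\<^bsub>\<Gamma>\<^esub> g) = Finite_Cartesian_Product.mat 1"
    using g by (simp add: lift_one flip: lift_mult)
  have 1: "ad g (lift g) = lift g" "ad g (Finite_Cartesian_Product.mat 1) = Finite_Cartesian_Product.mat 1"
    using g inv by (simp_all add: Ad_rho flip: matrix_mul_assoc)
  have ad: "ad g Y = Y" using g by (simp only: Y_def ad_diff ad_scaleR 1)
  \<comment> \<open>A scalar \<open>lift g\<close> would commute with the lift of the other
    generator, but distinct generators of a free group do not commute.\<close>
  have "Y \<noteq> 0"
  proof
    assume "Y = 0"
    then have sc: "lift g = r *\<^sub>R Finite_Cartesian_Product.mat 1" by (simp add: Y_def)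
    define l' where "l' = (if l = A then B else A)"
    define h where "h = \<iota> (gen l')"
    have h: "h \<in> carrier \<Gamma>" by (simp add: h_def)
    have "lift (g \<otimes>\<^bsub>\<Gamma>\<^esub> h) = lift (h \<otimes>\<^bsub>\<Gamma>\<^esub> g)" using g h by (simp add: lift_mult sc matrix_mult_scaleR)
    then have "\<iota> (gen l + gen l') = \<iota> (gen l' + gen l)"
      using lift_inj g h unfolding g_def h_def fiber.free_eval_add by (metis m_closed)
    then have "gen l + gen l' = gen l' + gen l" using inj_fiber by (simp add: inj_eq)
    then have "word (gen l + gen l') = word (gen l' + gen l)" by simp
    then show False
      by (cases l) (simp_all add: l'_def plus_free_group.rep_eq gen.rep_eq letter_inv_def)
  qed
  then have "co Y \<noteq> 0\<^sub>v N" using sl.coordinates_inj[of Y 0] tr co_zero by auto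
  moreover have "(1\<^sub>m N - Ad_mat g) *\<^sub>v co Y = 0\<^sub>v N"
  proof -
    have "(1\<^sub>m N - Ad_mat g) *\<^sub>v co Y = 1\<^sub>m N *\<^sub>v co Y - Ad_mat g *\<^sub>v co Y"
      by (rule minus_mult_distrib_mat_vec[of _ N N]) (simp_all add: co_carrier[OF tr])
    also have "Ad_mat g *\<^sub>v co Y = co Y" using co_ad[OF g tr] ad by simp
    also have "1\<^sub>m N *\<^sub>v co Y = co Y" using co_carrier[OF tr] by simp
    finally show ?thesis using co_carrier[OF tr] by (simp add: minus_cancel_vec)
  qed
  ultimately show ?thesis
    using det_0_iff_vec_prod_zero_field[of "1\<^sub>m N - Ad_mat g" N] co_carrier[OF tr] minus_carrier_mat[OF Ad_mat_carrier]
    unfolding g_def by blast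
qed

lemma det_X2: "Determinant.det X2_mat \<noteq> 0"
proof
  assume "Determinant.det X2_mat = 0"
  then obtain w where w: "w \<in> carrier_vec (N * 2)" "w \<noteq> 0\<^sub>v (N * 2)" "X2_mat *\<^sub>v w = 0\<^sub>v (N * 2)"
    using det_0_iff_vec_prod_zero_field[OF mats_carrier(3)] by blast
  obtain f where f: "deriv f" "vecd f = w" using vecd_surj[OF w(1)] by blast
  have "vecg (\<lambda>i. ad x (f (gen i))) = vecd (\<lambda>u. 0)" using X2_mat[OF f(1)] w(3) f(2) vecd_zero by simp
  then have "(\<lambda>i. ad x (f (gen i))) = (\<lambda>i. 0)"
    by (intro vecg_inj) (simp_all add: trace_ad deriv_trace[OF f(1)])
  then have "ad x (f (gen i)) = 0" for i by (rule fun_cong)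
  then have "ad (inv\<^bsub>\<Gamma>\<^esub> x) (ad x (f (gen i))) = 0" for i by (simp add: ad_zero)
  then have "f (gen i) = 0" for i by (simp add: ad_one flip: ad_mult)
  then have "f = (\<lambda>u. 0)" by (intro deriv_eqI[OF f(1) deriv_zero])
  then show False using f(2) w(2) vecd_zero by simp
qed

text \<open>By \<open>det_fiber_generator\<close> the removed column must be that of the meridian.
  Its determinant is nonzero, being a nonzero constant times a monic characteristic
  polynomial.\<close>

lemma twisted_alexander_polynomial_iff:
  "is_twisted_alexander_polynomial \<Gamma> bundle_gens v (bundle_relators \<phi>) N Ad_mat \<alpha> \<Delta> \<longleftrightarrow>
     \<Delta> = to_fract (Determinant.det (const_mat J_mat - [:0, 1:] \<cdot>\<^sub>m const_mat X2_mat)) /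
       to_fract (Determinant.det (1\<^sub>m N - [:0, 1:] \<cdot>\<^sub>m const_mat (Ad_mat x)))"
  (is "_ \<longleftrightarrow> \<Delta> = ?\<Delta>")
proof -
  have x: "x \<in> carrier \<Gamma>" by simp
  obtain r where r: "r \<noteq> 0" "Determinant.det (1\<^sub>m N - [:0, 1:] \<cdot>\<^sub>m const_mat (Ad_mat x)) = [:r:] * char_poly (Ad_mat x)"
    by (rule char_poly_isometry[OF Ad_mat_carrier gram_carrier Ad_mat_isometry[OF x] det_gram])
  have "char_poly (Ad_mat x) \<noteq> 0" using degree_monic_char_poly[OF Ad_mat_carrier, of x] by auto
  then have nz: "Determinant.det (1\<^sub>m N - [:0, 1:] \<cdot>\<^sub>m const_mat (Ad_mat x)) \<noteq> 0"
    unfolding r(2) using r(1) by simp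
  have gens: "set bundle_gens = {Fiber A, Fiber B, Meridian}" "removeAll Meridian bundle_gens = [Fiber A, Fiber B]"
    "length bundle_gens = length (bundle_relators \<phi>) + 1"
    by (auto simp: bundle_gens_def bundle_relators_def)
  have fib: "Determinant.det (alexander_hom \<Gamma> v N Ad_mat \<alpha> (1 - Poly_Mapping.single (gen (Fiber l)) 1)) = 0" for l
    unfolding alexander_hom_fiber det_map_to_fract det_const_mat det_fiber_generator by simp
  have mer: "Determinant.det (alexander_hom \<Gamma> v N Ad_mat \<alpha> (1 - Poly_Mapping.single (gen Meridian) 1)) =
      to_fract (Determinant.det (1\<^sub>m N - [:0, 1:] \<cdot>\<^sub>m const_mat (Ad_mat x)))"
    unfolding alexander_hom_meridian det_map_to_fract ..
  show ?thesis
    unfolding is_twisted_alexander_polynomial_def gens(1) Let_def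
    using gens(3) nz by (simp add: fib mer gens(2) alexander_matrix_eq det_map_to_fract)
qed

text \<open>The characteristic polynomial of \<open>Ad_mat x\<close> cancels between numerator and
  denominator.\<close>

lemma alexander_equal_char_poly:
  "alexander_equal N (to_fract (char_poly_endo HH T))
     (to_fract (Determinant.det (const_mat J_mat - [:0, 1:] \<cdot>\<^sub>m const_mat X2_mat)) /
       to_fract (Determinant.det (1\<^sub>m N - [:0, 1:] \<cdot>\<^sub>m const_mat (Ad_mat x))))"
proof -
  have x: "x \<in> carrier \<Gamma>" by simp
  define hs where "hs = (SOME hs. ordered_basis HH hs)"
  have hs: "ordered_basis HH hs" unfolding hs_def by (rule someI_ex[OF ex_ordered_basis_HH])
  define h where "h = char_poly (matrix_of HH hs T)"
  define p where "p = char_poly (Ad_mat x)"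
  have Mp: "char_poly M_mat = p * h" unfolding p_def h_def by (rule char_poly_M[OF hs])
  have p0: "p \<noteq> 0" using degree_monic_char_poly[OF Ad_mat_carrier, of x] by (auto simp: p_def)
  obtain r where r: "r \<noteq> 0" "Determinant.det (1\<^sub>m N - [:0, 1:] \<cdot>\<^sub>m const_mat (Ad_mat x)) = [:r:] * p"
    unfolding p_def by (rule char_poly_isometry[OF Ad_mat_carrier gram_carrier Ad_mat_isometry[OF x] det_gram])
  obtain s where s: "s \<noteq> 0" "Determinant.det (1\<^sub>m (N * 2) - [:0, 1:] \<cdot>\<^sub>m const_mat M_mat) = [:s:] * (p * h)"
    unfolding Mp[symmetric] by (rule char_poly_isometry[OF mats_carrier(1) om_mat_carrier M_isometry det_om_mat])
  define a where "a = Determinant.det J_mat"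
  \<comment> \<open>\<open>J_mat\<close> is a factor of the invertible matrix
    \<open>X2_mat\<close>.\<close>
  have a0: "a \<noteq> 0"
    using det_X2 det_mult[OF mats_carrier(2,1)] unfolding J_M a_def by auto
  have "const_mat J_mat - [:0, 1:] \<cdot>\<^sub>m const_mat X2_mat = const_mat J_mat * (1\<^sub>m (N * 2) - [:0, 1:] \<cdot>\<^sub>m const_mat M_mat)"
  proof -
    have cJ: "const_mat J_mat \<in> carrier_mat (N * 2) (N * 2)" and cM: "const_mat M_mat \<in> carrier_mat (N * 2) (N * 2)"
      by simp_all
    have "const_mat J_mat * (1\<^sub>m (N * 2) - [:0, 1:] \<cdot>\<^sub>m const_mat M_mat) =
        const_mat J_mat * 1\<^sub>m (N * 2) - const_mat J_mat * ([:0, 1:] \<cdot>\<^sub>m const_mat M_mat)"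
      using cM by (intro mult_minus_distrib_mat[OF cJ]) auto
    also have "const_mat J_mat * 1\<^sub>m (N * 2) = const_mat J_mat" by (rule right_mult_one_mat[OF cJ])
    also have "const_mat J_mat * ([:0, 1:] \<cdot>\<^sub>m const_mat M_mat) = [:0, 1:] \<cdot>\<^sub>m (const_mat J_mat * const_mat M_mat)"
      by (rule mult_smult_distrib[OF cJ cM])
    also have "const_mat J_mat * const_mat M_mat = const_mat X2_mat"
      unfolding J_M[symmetric] by (rule map_poly_mult(1)[OF mats_carrier(2,1), symmetric])
    finally show ?thesis by simp
  qed
  moreover have "1\<^sub>m (N * 2) - [:0, 1:] \<cdot>\<^sub>m const_mat M_mat \<in> carrier_mat (N * 2) (N * 2)"
    by (intro minus_carrier_mat smult_carrier_mat) simp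
  ultimately have num: "Determinant.det (const_mat J_mat - [:0, 1:] \<cdot>\<^sub>m const_mat X2_mat) = [:a:] * ([:s:] * (p * h))"
    using det_mult[of "const_mat J_mat" "N * 2" "1\<^sub>m (N * 2) - [:0, 1:] \<cdot>\<^sub>m const_mat M_mat"]
    by (simp only: det_const_mat a_def[symmetric] s(2)) simp
  have cf: "const_fract y \<noteq> 0" if "y \<noteq> 0" for y :: real using that by simp
  have cd: "const_fract (y / z) = const_fract y / const_fract z" if "z \<noteq> 0" for y z :: real
    using const_fract_mult[of "y / z" z] cf[OF that] that by (simp add: field_simps)
  have cancel: "H = R / (A' * S) * 1 * (A' * (S * (P * H)) / (R * P))"
    if "R \<noteq> 0" "A' \<noteq> 0" "S \<noteq> 0" "P \<noteq> 0" for R A' S P H :: "real poly fract"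
    using that by (simp add: field_simps)
  have "a * s \<noteq> 0" "to_fract p \<noteq> 0" using a0 s(1) p0 by simp_all
  \<comment> \<open>\<open>a\<close> and \<open>s\<close> stem from the numerator and
    \<open>r\<close> from the denominator. The exponent of t is 0, as
    \<open>char_poly_isometry\<close> introduces constants only.\<close>
  then have "to_fract h = const_fract (r / (a * s)) * t_var powi (int N * 0) *
      (to_fract ([:a:] * ([:s:] * (p * h))) / to_fract ([:r:] * p))"
    unfolding to_fract_mult cd[OF \<open>a * s \<noteq> 0\<close>] const_fract_mult mult_zero_right power_int_0_right
    by (intro cancel cf r(1) s(1) a0)
  moreover have "r / (a * s) \<noteq> 0" using r(1) s(1) a0 by simp
  ultimately show ?thesis
    unfolding alexander_equal_def num r(2) char_poly_endo_def hs_def[symmetric] h_def[symmetric] by blast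
qed

end

theorem theorem3p2:
  fixes \<Gamma> :: "('g, 'm) monoid_scheme"
    and v :: "bundle_gen \<Rightarrow> 'g"
    and P :: "int ^ fiber_gen ^ fiber_gen"
    and \<phi> :: "fiber_gen free_group \<Rightarrow> fiber_gen free_group"
    and \<rho> :: "'g \<Rightarrow> (real ^ 4 ^ 4) set"
    and \<alpha> :: "'g \<Rightarrow> int"
    and Xs :: "(real ^ 4 ^ 4) list"
  assumes "Determinants.det P = 1" and "\<bar>Determinants.trace P\<bar> > 2"
    and "represents_monodromy P \<phi>"
    and "group_presentation \<Gamma> bundle_gens v (bundle_relators \<phi>)"
    and "discrete_faithful \<Gamma> \<rho>"
    and "\<alpha> \<in> hom \<Gamma> integer_group"
    and "\<forall>g\<in>fiber_group \<Gamma> v. \<alpha> g = 0" and "\<alpha> (v Meridian) = 1"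
    and "ordered_basis sl4 Xs"
  shows "(\<exists>\<Delta>. is_twisted_alexander_polynomial \<Gamma> bundle_gens v (bundle_relators \<phi>)
            (length Xs) (\<lambda>g. matrix_of sl4 Xs (Ad (\<rho> g))) \<alpha> \<Delta>) \<and>
         (\<forall>\<Delta>. is_twisted_alexander_polynomial \<Gamma> bundle_gens v (bundle_relators \<phi>)
            (length Xs) (\<lambda>g. matrix_of sl4 Xs (Ad (\<rho> g))) \<alpha> \<Delta> \<longrightarrow>
            alexander_equal (length Xs)
              (to_fract (char_poly_endo
                 (H1 \<Gamma> (fiber_group \<Gamma> v) sl4 (\<lambda>g. Ad (\<rho> g)))
                 (H1_action \<Gamma> (fiber_group \<Gamma> v) (\<lambda>g. Ad (\<rho> g))
                    (fiber_group \<Gamma> v #>\<^bsub>\<Gamma>\<^esub> v Meridian))))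
              \<Delta>)"
proof -
  interpret cohomology \<Gamma> v \<phi> \<rho> \<alpha> Xs
    using assms(3-9) unfolding cohomology_def cohomology_axioms_def holonomy_def holonomy_axioms_def
      bundle_group_def represents_monodromy_def by blast
  have M: "(\<lambda>g. matrix_of sl4 Xs (Ad (\<rho> g))) = Ad_mat" by (rule ext) (simp only: Ad_mat_def)
  show ?thesis
    unfolding M twisted_alexander_polynomial_iff using alexander_equal_char_poly by blast
qed

end
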